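(* Let $\alpha=(\alpha_1,\ldots,\alpha_d)\in[0,\infty)^d$. Then $\{T_t^{\alpha,\mathcal L}\}_{t\ge 0}$ is a submarkovian (but not Markovian) symmetric diffusion semigroup on $(\mathbb{R}_+^d,dx)$. More precisely, for each $1\le p\le\infty$, $$\|T_t^{\alpha,\mathcal L}\|_{p\to p}\le \big(\cosh(t/2)\big)^{-d},\qquad t>0.$$
   Context: Notation: $d\ge 1$, $\mathbb{R}_+=(0,\infty)$, $L^p=L^p(\mathbb{R}_+^d,dx)$, $\|\cdot\|_{p\to p}$ is the operator norm on $L^p$, $\mathbf 1$ is the constant function $1$, $|\alpha|=\alpha_1+\ldots+\alpha_d$, and $I_\nu$ is the modified Bessel function of the first kind of order $\nu$. The semigroup. For $k\in\mathbb{N}^d$, $\mathbb N=\{0,1,2,\ldots\}$, the standard Laguerre functions are $\mathcal L_k^\alpha(x)=\prod_{i=1}^d \big(\frac{\Gamma(k_i+1)}{\Gamma(k_i+\alpha_i+1)}\big)^{1/2}L_{k_i}^{\alpha_i}(x_i)x_i^{\alpha_i/2}e^{-x_i/2}$, where $L_n^{a}$ is the Laguerre polynomial of degree $n$ and order $a$; they form an orthonormal basis of $L^2(\mathbb{R}_+^d,dx)$ and are eigenfunctions, with eigenvalues $|k|+(|\alpha|+d)/2$ ($|k|=k_1+\ldots+k_d$), of $L_\alpha^{\mathcal L}=-\sum_{i=1}^d\big(x_i\partial_{x_i}^2+\partial_{x_i}-\frac{x_i^2+\alpha_i^2}{4x_i}\big)$. Using the same symbol for the self-adjoint extension of this operator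 whose spectral decomposition is given by the $\mathcal L_k^\alpha$, one puts $T_t^{\alpha,\mathcal L}=\exp(-tL_\alpha^{\mathcal L})$ on $L^2$. For $t>0$ this has the integral representation $$T_t^{\alpha,\mathcal L}f(x)=\int_{\mathbb{R}_+^d}G_t^{\alpha,\mathcal L}(x,y)f(y)\,dy,\quad x\in\mathbb{R}_+^d,$$ $$G_t^{\alpha,\mathcal L}(x,y)=(2\sinh(t/2))^{-d}\exp\Big(-\tfrac12\coth(t/2)\sum_{i=1}^d(x_i+y_i)\Big)\prod_{i=1}^d I_{\alpha_i}\Big(\frac{\sqrt{x_iy_i}}{\sinh(t/2)}\Big),$$ and for $\alpha\in[0,\infty)^d$ this formula defines $T_t^{\alpha,\mathcal L}$ on $L^1+L^\infty$; $T_0^{\alpha,\mathcal L}=\mathrm{Id}$. Definitions. On a $\sigma$-finite measure space $(X,\mu)$, a symmetric diffusion semigroup is a family of linear operators $\{T_t\}_{t\ge0}$, $T_0=\mathrm{Id}$, mapping a linear subspace of the measurable functions that contains all $L^p(X,\mu)$, $1\le p\le\infty$ (e.g. $L^1+L^\infty$) into measurable functions, such that: (i) for each $1\le p\le\infty$ every $T_t$ is a contraction on $L^p$ and $\{T_t\}_{t\ge0}$ is a semigroup there; (ii) each $T_t$ is self-adjoint on $L^2$; (iii) $\lim_{t\to0^+}T_tf=f$ in $L^2$ for each $f\in L^2$. It is Markovian if in addition (iv) $T_tf\ge0$ whenever $f\ge0$, for all $t$, and (v) $T_t\mathbf 1=\mathbf 1$ for all $t$. It is submarkovian if (i)-(iv)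 hold and (v') $T_t\mathbf 1\le\mathbf 1$ for all $t$. *)

theory Defs
  imports
    "HOL-Probability.Essential_Supremum"
    "HOL-Library.Complex_Order"
begin

section \<open>Lebesgue spaces of complex-valued functions\<close>

text \<open>
  Elements of $L^p(X,\mu)$ are represented by measurable functions, and equality of such elements
  is equality almost everywhere. Exponents $1 \le p \le \infty$ are extended nonnegative reals.
  There is no power function on \<^typ>\<open>ennreal\<close>, hence the case distinction for the $p$-th root.
\<close>

definition Lp_norm :: "'a measure \<Rightarrow> ennreal \<Rightarrow> ('a \<Rightarrow> complex) \<Rightarrow> ennreal" where
  "Lp_norm M p f =
    (if p = \<infinity> then esssup M (\<lambda>x. ennreal (norm (f x)))
     else (let I = (\<integral>\<^sup>+x. ennreal (norm (f x) powr enn2real p) \<partial>M)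
           in if I = \<infinity> then \<infinity> else ennreal (enn2real I powr (1 / enn2real p))))"

definition Lp_space :: "'a measure \<Rightarrow> ennreal \<Rightarrow> ('a \<Rightarrow> complex) set" where
  "Lp_space M p = {f \<in> borel_measurable M. Lp_norm M p f < \<infinity>}"

definition Lp_opnorm ::
  "'a measure \<Rightarrow> ennreal \<Rightarrow> (('a \<Rightarrow> complex) \<Rightarrow> ('a \<Rightarrow> complex)) \<Rightarrow> ennreal" where
  "Lp_opnorm M p S = (SUP f \<in> {f \<in> Lp_space M p. Lp_norm M p f \<le> 1}. Lp_norm M p (S f))"

definition L1_plus_Linf :: "'a measure \<Rightarrow> ('a \<Rightarrow> complex) set" where
  "L1_plus_Linf M = {f \<in> borel_measurable M.
     \<exists>g\<in>Lp_space M 1. \<exists>h\<in>Lp_space M \<infinity>. \<forall>x\<in>space M. f x = g x + h x}"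


section \<open>Symmetric diffusion semigroups\<close>

text \<open>
  \<open>D\<close> is the linear space of measurable functions on which the operators \<open>T t\<close>, $t \ge 0$, act.
  The values of \<open>T\<close> at negative times are irrelevant. The assumptions \<open>dom_AE_cong\<close> and
  \<open>AE_cong\<close> say that \<open>D\<close> and the operators are well defined on classes of functions modulo
  equality almost everywhere. In \<open>contraction\<close>, together with \<open>measurable\<close>, the inequality
  includes that \<open>T t\<close> maps $L^p$ into itself.
\<close>

locale symmetric_diffusion_semigroup = sigma_finite_measure M
  for M :: "'a measure" +
  fixes D :: "('a \<Rightarrow> complex) set"
    and T :: "real \<Rightarrow> ('a \<Rightarrow> complex) \<Rightarrow> ('a \<Rightarrow> complex)"
  assumes dom_measurable: "D \<subseteq> borel_measurable M"
    and dom_lincomb: "\<And>a b f g. f \<in> D \<Longrightarrow> g \<in> D \<Longrightarrow> (\<lambda>x. a * f x + b * g x) \<in> D"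
    and dom_AE_cong:
      "\<And>f g. f \<in> D \<Longrightarrow> g \<in> borel_measurable M \<Longrightarrow> (AE x in M. f x = g x) \<Longrightarrow> g \<in> D"
    and dom_Lp: "\<And>p. 1 \<le> p \<Longrightarrow> Lp_space M p \<subseteq> D"
    and measurable: "\<And>t f. 0 \<le> t \<Longrightarrow> f \<in> D \<Longrightarrow> T t f \<in> borel_measurable M"
    and AE_cong:
      "\<And>t f g. 0 \<le> t \<Longrightarrow> f \<in> D \<Longrightarrow> g \<in> D \<Longrightarrow> (AE x in M. f x = g x) \<Longrightarrow>
         AE x in M. T t f x = T t g x"
    and linear:
      "\<And>t a b f g. 0 \<le> t \<Longrightarrow> f \<in> D \<Longrightarrow> g \<in> D \<Longrightarrow>
         AE x in M. T t (\<lambda>x. a * f x + b * g x) x = a * T t f x + b * T t g x"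
    and zero: "\<And>f. f \<in> D \<Longrightarrow> AE x in M. T 0 f x = f x"
    and contraction:
      "\<And>p t f. 1 \<le> p \<Longrightarrow> 0 \<le> t \<Longrightarrow> f \<in> Lp_space M p \<Longrightarrow> Lp_norm M p (T t f) \<le> Lp_norm M p f"
    and semigroup:
      "\<And>p s t f. 1 \<le> p \<Longrightarrow> 0 \<le> s \<Longrightarrow> 0 \<le> t \<Longrightarrow> f \<in> Lp_space M p \<Longrightarrow>
         AE x in M. T (s + t) f x = T s (T t f) x"
    and selfadjoint:
      "\<And>t f g. 0 \<le> t \<Longrightarrow> f \<in> Lp_space M 2 \<Longrightarrow> g \<in> Lp_space M 2 \<Longrightarrow>
         (LINT x|M. T t f x * cnj (g x)) = (LINT x|M. f x * cnj (T t g x))"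
    and strongly_continuous:
      "\<And>f. f \<in> Lp_space M 2 \<Longrightarrow>
         ((\<lambda>t. Lp_norm M 2 (\<lambda>x. T t f x - f x)) \<longlongrightarrow> 0) (at_right 0)"

text \<open>
  Below, \<open>0 \<le> z\<close> for complex \<open>z\<close> means that \<open>z\<close> is real and nonnegative; likewise \<open>z \<le> 1\<close>
  includes that \<open>z\<close> is real.
\<close>

locale markovian_symmetric_diffusion_semigroup = symmetric_diffusion_semigroup M D T
  for M :: "'a measure" and D T +
  assumes positive:
      "\<And>t f. 0 \<le> t \<Longrightarrow> f \<in> D \<Longrightarrow> (AE x in M. 0 \<le> f x) \<Longrightarrow> AE x in M. 0 \<le> T t f x"
    and conservative: "\<And>t. 0 \<le> t \<Longrightarrow> AE x in M. T t (\<lambda>_. 1) x = 1"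

locale submarkovian_symmetric_diffusion_semigroup = symmetric_diffusion_semigroup M D T
  for M :: "'a measure" and D T +
  assumes positive:
      "\<And>t f. 0 \<le> t \<Longrightarrow> f \<in> D \<Longrightarrow> (AE x in M. 0 \<le> f x) \<Longrightarrow> AE x in M. 0 \<le> T t f x"
    and subconservative: "\<And>t. 0 \<le> t \<Longrightarrow> AE x in M. T t (\<lambda>_. 1) x \<le> 1"


section \<open>The semigroup of standard Laguerre functions\<close>

text \<open>
  The modified Bessel function of the first kind, by its power series. It is only meant for
  \<open>z > 0\<close> (at \<open>z = 0\<close>, \<open>\<nu> = 0\<close> the convention \<open>0 powr 0 = 0\<close> gives the wrong value).
\<close>

definition bessel_I :: "real \<Rightarrow> real \<Rightarrow> real" where
  "bessel_I \<nu> z = (\<Sum>m. (z / 2) powr (\<nu> + 2 * real m) / (fact m * Gamma (\<nu> + real m + 1)))"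

definition pos_orthant :: "(real ^ 'n) set" where
  "pos_orthant = {x. \<forall>i. 0 < x $ i}"

definition orthant_measure :: "(real ^ 'n) measure" where
  "orthant_measure = restrict_space lborel pos_orthant"

definition laguerre_kernel :: "real ^ 'n \<Rightarrow> real \<Rightarrow> real ^ 'n \<Rightarrow> real ^ 'n \<Rightarrow> real" where
  "laguerre_kernel \<alpha> t x y =
     1 / (2 * sinh (t / 2)) ^ CARD('n)
     * exp (- (1 / 2) * (cosh (t / 2) / sinh (t / 2)) * (\<Sum>i\<in>UNIV. x $ i + y $ i))
     * (\<Prod>i\<in>UNIV. bessel_I (\<alpha> $ i) (sqrt (x $ i * y $ i) / sinh (t / 2)))"

definition laguerre_semigroup ::
  "real ^ 'n \<Rightarrow> real \<Rightarrow> (real ^ 'n \<Rightarrow> complex) \<Rightarrow> (real ^ 'n \<Rightarrow> complex)" where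
  "laguerre_semigroup \<alpha> t f =
     (if t = 0 then f
      else (\<lambda>x. LINT y|orthant_measure. complex_of_real (laguerre_kernel \<alpha> t x y) * f y))"

end

theory Submission
  imports Defs
begin

text \<open>
  By the Schur test, a symmetric nonnegative kernel of mass at most \<open>K\<close> has norm at most \<open>K\<close> on every
  $L^p$. The Laguerre kernel is a product of one-dimensional kernels, so everything reduces to
  one-dimensional integrals of \<open>exp (-p y)\<close> against modified Bessel functions, computed termwise
  from the power series: Weber's second exponential integral, whose coefficients are compared by the
  Chu--Vandermonde identity, gives the Chapman--Kolmogorov equation, and a Beta integral bounds the
  mass by \<open>1 / cosh (t / 2)\<close>, uniformly in \<open>\<alpha> \<ge> 0\<close>. For the strong continuity, contractivity reduces
  the problem to indicator functions of open sets \<open>U\<close>, where the $L^2$ deviation is at most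
  twice \<open>\<integral>\<^sub>U (1 - T\<^sub>t 1\<^sub>U)\<close>; that \<open>T\<^sub>t 1\<^sub>U \<rightarrow> 1\<close> on \<open>U\<close> follows from a Korovkin
  argument with the functions \<open>y powr (\<alpha> / 2) * exp (- l * y)\<close>, whose images are explicit.
\<close>

section \<open>Lebesgue spaces\<close>

text \<open>Every property is read off the kernel. For general \<open>\<alpha>\<close> its mass is
  not elementary, so it is only bounded from above; the constant comes from \<alpha> = 0, where the
  one-dimensional mass is \<open>exp (- x * tanh (t / 2) / 2) / cosh (t / 2)\<close>, with supremum
  \<open>1 / cosh (t / 2)\<close> as x tends to 0. An upper bound on the mass says nothing about
  convergence to the identity. The lower bounds for small t need test functions with explicit
  images: the weight \<open>y powr (a / 2)\<close> cancels the Gamma factors of the Bessel series,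
  which the constant function does not do for a > 0. Indicators of open sets are convenient because
  they ask only for pointwise convergence of the mass inside the set, without uniformity. Kernel
  integrals and series are kept in \<open>ennreal\<close>, so that they can be interchanged without
  convergence conditions. The Markov property fails because \<open>1 < cosh (t / 2)\<close> is
  strict.\<close>

lemma Lp_norm_less_infinity_iff:
  assumes "p \<noteq> \<infinity>" "1 \<le> p"
  shows "Lp_norm M p f < \<infinity> \<longleftrightarrow> (\<integral>\<^sup>+x. ennreal (norm (f x) powr enn2real p) \<partial>M) < \<infinity>"
  using assms by (auto simp: Lp_norm_def Let_def less_top)

text \<open>The norm is defined by cases, with a real root only of a finite integral. Comparing p-th
  powers separates this bookkeeping from the estimates, which all concern integrals of
  \<open>norm (f x) powr r\<close>.\<close>

lemma Lp_norm_le_of_powr_le: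
  assumes p: "p \<noteq> \<infinity>" "1 \<le> p" and c: "0 < c"
    and le: "(\<integral>\<^sup>+x. ennreal (norm (f x) powr enn2real p) \<partial>M)
      \<le> ennreal (c powr enn2real p) * (\<integral>\<^sup>+x. ennreal (norm (g x) powr enn2real p) \<partial>M)"
  shows "Lp_norm M p f \<le> ennreal c * Lp_norm M p g"
proof -
  define r where "r = enn2real p"
  have r: "1 \<le> r"
    using p by (simp add: r_def) (metis enn2real_1 enn2real_mono infinity_ennreal_def less_top)
  define I where "I = (\<integral>\<^sup>+x. ennreal (norm (f x) powr r) \<partial>M)"
  define J where "J = (\<integral>\<^sup>+x. ennreal (norm (g x) powr r) \<partial>M)"
  have le: "I \<le> ennreal (c powr r) * J"
    using le by (simp add: I_def J_def r_def)
  show ?thesis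
  proof (cases "J = \<infinity>")
    case True
    then have "Lp_norm M p g = \<infinity>"
      using p by (simp add: Lp_norm_def J_def r_def)
    then show ?thesis
      using c by (simp add: ennreal_mult_top)
  next
    case False
    then obtain j where j: "J = ennreal j" "0 \<le> j" by (cases J) auto
    from le obtain i where i: "I = ennreal i" "0 \<le> i"
      by (cases I) (auto simp: j ennreal_mult[symmetric] top_unique)
    have ij: "i \<le> c powr r * j"
      using le by (simp add: i j ennreal_mult[symmetric])
    have "i powr (1 / r) \<le> (c powr r * j) powr (1 / r)"
      using ij i r by (intro powr_mono2) auto
    also have "\<dots> = c * j powr (1 / r)"
      using c j r by (simp add: powr_mult powr_powr)
    finally have "ennreal (i powr (1 / r)) \<le> ennreal c * ennreal (j powr (1 / r))"
      using c by (simp add: ennreal_mult[symmetric])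
    moreover have "Lp_norm M p f = ennreal (i powr (1 / r))"
      using p i by (simp add: Lp_norm_def Let_def I_def[symmetric] r_def[symmetric])
    moreover have "Lp_norm M p g = ennreal (j powr (1 / r))"
      using p j by (simp add: Lp_norm_def Let_def J_def[symmetric] r_def[symmetric])
    ultimately show ?thesis by simp
  qed
qed

lemma Lp_space_infinityI:
  assumes "f \<in> borel_measurable M" "\<And>x. x \<in> space M \<Longrightarrow> norm (f x) \<le> C"
  shows "f \<in> Lp_space M \<infinity>"
proof -
  have "esssup M (\<lambda>x. ennreal (norm (f x))) \<le> ennreal C"
    using assms by (intro esssup_I) (auto intro!: AE_I2 ennreal_leI)
  also have "\<dots> < \<infinity>" by simp
  finally show ?thesis
    using assms by (simp add: Lp_space_def Lp_norm_def)
qed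

lemma Lp_space_infinityD:
  assumes "f \<in> Lp_space M \<infinity>"
  obtains C where "0 \<le> C" "AE x in M. norm (f x) \<le> C"
proof -
  from assms obtain C where C: "esssup M (\<lambda>x. ennreal (norm (f x))) = ennreal C" "0 \<le> C"
    by (cases "esssup M (\<lambda>x. ennreal (norm (f x)))") (auto simp: Lp_space_def Lp_norm_def)
  have "AE x in M. norm (f x) \<le> C"
    using esssup_AE[of "\<lambda>x. ennreal (norm (f x))" M] C by (auto simp: ennreal_le_iff)
  with C show ?thesis using that by blast
qed

lemma Lp_space_1_iff: "f \<in> Lp_space M 1 \<longleftrightarrow> integrable M f"
  using Lp_norm_less_infinity_iff[of 1 M f] by (auto simp: Lp_space_def integrable_iff_bounded)

lemma Lp_space_2_iff:
  "f \<in> Lp_space M 2 \<longleftrightarrow> f \<in> borel_measurable M \<and> (\<integral>\<^sup>+x. ennreal ((norm (f x))\<^sup>2) \<partial>M) < \<infinity>"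
  using Lp_norm_less_infinity_iff[of 2 M f] by (auto simp: Lp_space_def)

lemma Lp_norm_2_eq:
  "Lp_norm M 2 f = (let I = (\<integral>\<^sup>+x. ennreal ((norm (f x))\<^sup>2) \<partial>M)
     in if I = \<infinity> then \<infinity> else ennreal (sqrt (enn2real I)))"
  by (simp add: Lp_norm_def Let_def powr_half_sqrt)

section \<open>The sum space L^1 + L^\<infinity>\<close>

lemma L1_plus_Linf_measurable: "f \<in> L1_plus_Linf M \<Longrightarrow> f \<in> borel_measurable M"
  by (simp add: L1_plus_Linf_def)

text \<open>On the null set where the essentially bounded summand exceeds its bound it is replaced
  by 0, and the difference is absorbed by the integrable summand. The bound then holds at every
  point, so later pointwise estimates need no exceptional set.\<close>

lemma L1_plus_Linf_iff:
  "f \<in> L1_plus_Linf M \<longleftrightarrow> f \<in> borel_measurable M \<and>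
     (\<exists>g h C. integrable M g \<and> h \<in> borel_measurable M \<and> 0 \<le> C \<and>
       (\<forall>x\<in>space M. norm (h x) \<le> C \<and> f x = g x + h x))"
  (is "_ \<longleftrightarrow> ?R")
proof
  assume "f \<in> L1_plus_Linf M"
  then obtain g h where [measurable]: "f \<in> borel_measurable M" and g: "integrable M g"
    and h: "h \<in> Lp_space M \<infinity>" and eq: "\<And>x. x \<in> space M \<Longrightarrow> f x = g x + h x"
    by (auto simp: L1_plus_Linf_def Lp_space_1_iff)
  from h obtain C where C: "0 \<le> C" "AE x in M. norm (h x) \<le> C"
    by (rule Lp_space_infinityD)
  have [measurable]: "h \<in> borel_measurable M" "g \<in> borel_measurable M"
    using h g by (auto simp: Lp_space_def)
  define h' where "h' x = (if norm (h x) \<le> C then h x else 0)" for x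
  have [measurable]: "h' \<in> borel_measurable M"
    unfolding h'_def by measurable
  have "integrable M (\<lambda>x. f x - h' x) \<longleftrightarrow> integrable M g"
    using C(2) by (intro integrable_cong_AE) (auto simp: h'_def eq)
  then show ?R
    using g C(1) by (intro conjI exI[of _ "\<lambda>x. f x - h' x"] exI[of _ h'] exI[of _ C])
      (auto simp: h'_def)
next
  assume ?R
  then obtain g h C where *: "f \<in> borel_measurable M" "g \<in> Lp_space M 1" "h \<in> borel_measurable M"
      "\<forall>x\<in>space M. norm (h x) \<le> C \<and> f x = g x + h x"
    by (auto simp: Lp_space_1_iff)
  moreover from * have "h \<in> Lp_space M \<infinity>"
    by (intro Lp_space_infinityI[of _ _ C]) auto
  ultimately show "f \<in> L1_plus_Linf M"
    unfolding L1_plus_Linf_def by blast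
qed

text \<open>For finite p the function is cut at height 1: the low part is bounded, and on the high
  part \<open>norm (f x) \<le> norm (f x) powr r\<close> because \<open>1 \<le> r\<close>, so that
  part is integrable.\<close>

lemma Lp_space_subset_L1_plus_Linf:
  assumes p: "1 \<le> p"
  shows "Lp_space M p \<subseteq> L1_plus_Linf M"
proof
  fix f assume f: "f \<in> Lp_space M p"
  then have [measurable]: "f \<in> borel_measurable M" by (simp add: Lp_space_def)
  show "f \<in> L1_plus_Linf M"
  proof (cases "p = \<infinity>")
    case True
    have "integrable M (\<lambda>_. 0 :: complex)" by simp
    then have "\<exists>g\<in>Lp_space M 1. \<exists>h\<in>Lp_space M \<infinity>. \<forall>x\<in>space M. f x = g x + h x"
      using f True by (intro bexI[where x = "\<lambda>_. 0"] bexI[where x = f]) (auto simp: Lp_space_1_iff)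
    then show ?thesis
      by (simp add: L1_plus_Linf_def)
  next
    case False
    define r where "r = enn2real p"
    have r: "1 \<le> r"
      using p False by (simp add: r_def) (metis enn2real_1 enn2real_mono infinity_ennreal_def less_top)
    define h where "h x = (if norm (f x) \<le> 1 then f x else 0)" for x
    define g where "g x = f x - h x" for x
    have [measurable]: "h \<in> borel_measurable M" "g \<in> borel_measurable M"
      unfolding g_def h_def by measurable
    have "norm (g x) \<le> norm (f x) powr r" for x
      using r powr_mono[of 1 r "norm (f x)"] by (auto simp: g_def h_def)
    then have "(\<integral>\<^sup>+x. norm (g x) \<partial>M) \<le> (\<integral>\<^sup>+x. ennreal (norm (f x) powr r) \<partial>M)"
      by (intro nn_integral_mono ennreal_leI)
    also have "\<dots> < \<infinity>"
      using f Lp_norm_less_infinity_iff[OF False p, of M f] by (simp add: Lp_space_def r_def)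
    finally have "integrable M g"
      by (intro integrableI_bounded) auto
    then show ?thesis
      unfolding L1_plus_Linf_iff
      by (intro conjI exI[where x = g] exI[where x = h] exI[where x = 1]) (auto simp: h_def g_def)
  qed
qed

lemma L1_plus_Linf_lincomb:
  assumes "f \<in> L1_plus_Linf M" "g \<in> L1_plus_Linf M"
  shows "(\<lambda>x. a * f x + b * g x) \<in> L1_plus_Linf M"
proof -
  from assms obtain f1 f2 C g1 g2 D where f: "f \<in> borel_measurable M" "integrable M f1"
      "f2 \<in> borel_measurable M" "\<And>x. x \<in> space M \<Longrightarrow> norm (f2 x) \<le> C"
      "\<And>x. x \<in> space M \<Longrightarrow> f x = f1 x + f2 x" "0 \<le> C"
    and g: "g \<in> borel_measurable M" "integrable M g1" "g2 \<in> borel_measurable M"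
      "\<And>x. x \<in> space M \<Longrightarrow> norm (g2 x) \<le> D"
      "\<And>x. x \<in> space M \<Longrightarrow> g x = g1 x + g2 x" "0 \<le> D"
    unfolding L1_plus_Linf_iff by metis
  have "norm (a * f2 x + b * g2 x) \<le> norm a * C + norm b * D" if "x \<in> space M" for x
    using f(4)[OF that] g(4)[OF that] norm_triangle_ineq[of "a * f2 x" "b * g2 x"]
      mult_left_mono[of "norm (f2 x)" C "norm a"] mult_left_mono[of "norm (g2 x)" D "norm b"]
    by (auto simp: norm_mult)
  then show ?thesis
    unfolding L1_plus_Linf_iff using f g
    by (intro conjI exI[where x = "\<lambda>x. a * f1 x + b * g1 x"] exI[where x = "\<lambda>x. a * f2 x + b * g2 x"]
        exI[where x = "norm a * C + norm b * D"]) (auto simp: algebra_simps)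
qed

lemma L1_plus_Linf_cong_AE:
  assumes f: "f \<in> L1_plus_Linf M" and g [measurable]: "g \<in> borel_measurable M"
    and eq: "AE x in M. f x = g x"
  shows "g \<in> L1_plus_Linf M"
proof -
  from f obtain f1 f2 C where f1: "integrable M f1" and f2 [measurable]: "f2 \<in> borel_measurable M"
    and C: "\<And>x. x \<in> space M \<Longrightarrow> norm (f2 x) \<le> C" "0 \<le> C"
    and f12: "\<And>x. x \<in> space M \<Longrightarrow> f x = f1 x + f2 x"
    unfolding L1_plus_Linf_iff by metis
  have "integrable M (\<lambda>x. g x - f2 x)"
  proof (rule integrable_cong_AE_imp[OF f1])
    show "AE x in M. f1 x = g x - f2 x"
      using eq AE_space by eventually_elim (simp add: f12 algebra_simps)
  qed measurable
  then show ?thesis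
    unfolding L1_plus_Linf_iff using g C f2
    by (intro conjI exI[where x = "\<lambda>x. g x - f2 x"] exI[where x = f2] exI[where x = C]) auto
qed

section \<open>Symmetric kernels with bounded mass\<close>

definition kernel_op :: "'a measure \<Rightarrow> ('a \<Rightarrow> 'a \<Rightarrow> real) \<Rightarrow> ('a \<Rightarrow> complex) \<Rightarrow> 'a \<Rightarrow> complex" where
  "kernel_op M k f = (\<lambda>x. LINT y|M. complex_of_real (k x y) * f y)"

text \<open>Symmetry turns the bound \<open>K\<close> on the mass in one variable into the same
  bound in the other, so one constant serves both halves of the Schur test. Positivity of
  \<open>K\<close> permits the division by \<open>K\<close> in the proof of the L^p bound.\<close>

locale symmetric_kernel = sigma_finite_measure M
  for M :: "'a measure" +
  fixes k :: "'a \<Rightarrow> 'a \<Rightarrow> real" and K :: real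
  assumes kernel_measurable [measurable]: "(\<lambda>z. k (fst z) (snd z)) \<in> borel_measurable (M \<Otimes>\<^sub>M M)"
    and kernel_nonneg: "\<And>x y. x \<in> space M \<Longrightarrow> y \<in> space M \<Longrightarrow> 0 \<le> k x y"
    and kernel_sym: "\<And>x y. x \<in> space M \<Longrightarrow> y \<in> space M \<Longrightarrow> k x y = k y x"
    and kernel_mass: "\<And>x. x \<in> space M \<Longrightarrow> (\<integral>\<^sup>+y. ennreal (k x y) \<partial>M) \<le> ennreal K"
    and K_pos: "0 < K"
begin

sublocale P: pair_sigma_finite M M ..

section \<open>The Schur test\<close>

lemma kernel_measurable1 [measurable]:
  assumes "f \<in> N \<rightarrow>\<^sub>M M" "g \<in> N \<rightarrow>\<^sub>M M"
  shows "(\<lambda>w. k (f w) (g w)) \<in> borel_measurable N"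
  using measurable_compose[OF measurable_Pair[OF assms] kernel_measurable] by simp

lemma kernel_op_measurable [measurable]:
  assumes [measurable]: "f \<in> borel_measurable M"
  shows "kernel_op M k f \<in> borel_measurable M"
  unfolding kernel_op_def by measurable

lemma kernel_op_norm_le:
  assumes x: "x \<in> space M"
  shows "ennreal (norm (kernel_op M k f x)) \<le> (\<integral>\<^sup>+y. ennreal (k x y) * ennreal (norm (f y)) \<partial>M)"
proof (cases "integrable M (\<lambda>y. complex_of_real (k x y) * f y)")
  case True
  have "ennreal (norm (kernel_op M k f x))
      \<le> (\<integral>\<^sup>+y. ennreal (norm (complex_of_real (k x y) * f y)) \<partial>M)"
    using integral_norm_bound_ennreal[OF True] by (simp add: kernel_op_def)
  also have "\<dots> = (\<integral>\<^sup>+y. ennreal (k x y) * ennreal (norm (f y)) \<partial>M)"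
    using x by (intro nn_integral_cong) (simp add: norm_mult kernel_nonneg ennreal_mult)
  finally show ?thesis .
\<comment> \<open>Without integrability the Bochner integral is 0 by default, so the bound holds for
  every f.\<close>
qed (simp add: kernel_op_def not_integrable_integral_eq)

lemma kernel_op_cong_AE:
  assumes [measurable]: "f \<in> borel_measurable M" "g \<in> borel_measurable M"
    and eq: "AE x in M. f x = g x" and x [measurable]: "x \<in> space M"
  shows "kernel_op M k f x = kernel_op M k g x"
  unfolding kernel_op_def
proof (rule integral_cong_AE)
  show "AE y in M. complex_of_real (k x y) * f y = complex_of_real (k x y) * g y"
    using eq by eventually_elim simp
qed measurable

text \<open>The L^1 endpoint of the Schur test: after Tonelli, symmetry lets the mass bound act in
  the first variable.\<close>

lemma nn_integral_kernel_le:
  assumes [measurable]: "u \<in> borel_measurable M"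
  shows "(\<integral>\<^sup>+x. (\<integral>\<^sup>+y. ennreal (k x y) * u y \<partial>M) \<partial>M) \<le> ennreal K * (\<integral>\<^sup>+y. u y \<partial>M)"
proof -
  have "(\<integral>\<^sup>+x. (\<integral>\<^sup>+y. ennreal (k x y) * u y \<partial>M) \<partial>M)
      = (\<integral>\<^sup>+y. (\<integral>\<^sup>+x. ennreal (k x y) * u y \<partial>M) \<partial>M)"
    by (rule P.Fubini'[symmetric]) simp
  also have "\<dots> = (\<integral>\<^sup>+y. (\<integral>\<^sup>+x. ennreal (k y x) \<partial>M) * u y \<partial>M)"
    by (intro nn_integral_cong) (auto simp: nn_integral_multc[symmetric] kernel_sym intro!: nn_integral_cong)
  also have "\<dots> \<le> (\<integral>\<^sup>+y. ennreal K * u y \<partial>M)"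
    by (intro nn_integral_mono mult_right_mono kernel_mass) auto
  also have "\<dots> = ennreal K * (\<integral>\<^sup>+y. u y \<partial>M)"
    by (simp add: nn_integral_cmult)
  finally show ?thesis .
qed

text \<open>For the bounded summand the integral converges at every x by the mass bound. For the
  integrable summand only the integral over x of the inner integral is known to be finite, which
  gives convergence for almost every x; hence the almost-everywhere form of
  \<open>kernel_op_linear\<close> and \<open>kernel_op_semigroup\<close>.\<close>

lemma integrable_kernel_mult:
  assumes "f \<in> L1_plus_Linf M"
  shows "AE x in M. integrable M (\<lambda>y. complex_of_real (k x y) * f y)"
proof -
  from assms obtain g h C where [measurable]: "f \<in> borel_measurable M" and g: "integrable M g"
    and [measurable]: "h \<in> borel_measurable M" and C: "0 \<le> C" "\<And>x. x \<in> space M \<Longrightarrow> norm (h x) \<le> C"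
    and eq: "\<And>x. x \<in> space M \<Longrightarrow> f x = g x + h x"
    by (auto simp: L1_plus_Linf_iff)
  have [measurable]: "g \<in> borel_measurable M" using g by simp
  have "(\<integral>\<^sup>+x. (\<integral>\<^sup>+y. ennreal (k x y) * ennreal (norm (g y)) \<partial>M) \<partial>M)
      \<le> ennreal K * (\<integral>\<^sup>+y. ennreal (norm (g y)) \<partial>M)"
    by (rule nn_integral_kernel_le) simp
  also have "\<dots> < \<infinity>"
    using g by (simp add: integrable_iff_bounded ennreal_mult_less_top)
  finally have "AE x in M. (\<integral>\<^sup>+y. ennreal (k x y) * ennreal (norm (g y)) \<partial>M) \<noteq> \<infinity>"
    by (intro nn_integral_PInf_AE) auto
  then show ?thesis
    using AE_space
  proof eventually_elim
    case (elim x)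
    note [measurable] = elim(2)
    have "(\<integral>\<^sup>+y. ennreal (norm (complex_of_real (k x y) * f y)) \<partial>M)
        \<le> (\<integral>\<^sup>+y. ennreal (k x y) * ennreal (norm (g y)) + ennreal C * ennreal (k x y) \<partial>M)"
    proof (rule nn_integral_mono)
      fix y assume y: "y \<in> space M"
      have "norm (complex_of_real (k x y) * f y) = k x y * norm (f y)"
        using elim(2) y by (simp add: norm_mult kernel_nonneg)
      also have "\<dots> \<le> k x y * (norm (g y) + C)"
        using elim(2) y C(2)[of y] norm_triangle_ineq[of "g y" "h y"]
        by (intro mult_left_mono kernel_nonneg) (auto simp: eq)
      finally show "ennreal (norm (complex_of_real (k x y) * f y))
          \<le> ennreal (k x y) * ennreal (norm (g y)) + ennreal C * ennreal (k x y)"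
        using elim(2) y C(1)
        by (simp add: ennreal_mult[symmetric] kernel_nonneg ennreal_plus[symmetric] algebra_simps
            del: ennreal_plus)
    qed
    also have "\<dots> = (\<integral>\<^sup>+y. ennreal (k x y) * ennreal (norm (g y)) \<partial>M)
        + ennreal C * (\<integral>\<^sup>+y. ennreal (k x y) \<partial>M)"
      using elim(2) by (simp add: nn_integral_add nn_integral_cmult)
    also have "\<dots> < \<infinity>"
      using elim(1) order.strict_trans1[OF kernel_mass[OF elim(2)] ennreal_less_top]
      by (simp add: less_top ennreal_mult_less_top)
    finally show ?case
      using elim(2) by (intro integrableI_bounded) measurable
  qed
qed

text \<open>Young's inequality \<open>u \<le> u\<^sup>r c\<^bsup>1-r\<^esup> / r + (1 - 1/r) c\<close>, integrated against the kernel
  with \<open>c = \<bar>Tf(x)\<bar> / K\<close>, plays the part of Jensen's inequality.\<close>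

lemma kernel_op_powr_le:
  assumes r: "1 \<le> r" and x: "x \<in> space M" and [measurable]: "f \<in> borel_measurable M"
  shows "ennreal (norm (kernel_op M k f x) powr r)
    \<le> ennreal (K powr (r - 1)) * (\<integral>\<^sup>+y. ennreal (k x y) * ennreal (norm (f y) powr r) \<partial>M)"
proof -
  define R where "R = norm (kernel_op M k f x)"
  define B where "B = (\<integral>\<^sup>+y. ennreal (k x y) * ennreal (norm (f y) powr r) \<partial>M)"
  note [measurable] = x
  have "ennreal (R powr r) \<le> ennreal (K powr (r - 1)) * B" if "R \<noteq> 0" "B \<noteq> \<infinity>"
  proof -
    from \<open>B \<noteq> \<infinity>\<close> obtain b where b: "B = ennreal b" "0 \<le> b" by (cases B) auto
    have R: "R > 0" using \<open>R \<noteq> 0\<close> by (simp add: R_def)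
    define c where "c = R / K"
    have c: "c > 0" using R K_pos by (simp add: c_def)
    have young: "u \<le> c powr (1 - r) / r * u powr r + (1 - 1 / r) * c" if "0 \<le> u" for u
    proof (cases "u = 0")
      case False
      with that have u: "0 < u" by simp
      have "(u powr r * c powr (1 - r)) powr (1 / r) * c powr (1 - 1 / r)
          \<le> (1 / r) * (u powr r * c powr (1 - r)) + (1 - 1 / r) * c"
        using r c u by (intro Youngs_inequality_0) auto
      also have "(u powr r * c powr (1 - r)) powr (1 / r) * c powr (1 - 1 / r) = u"
        using that False r c by (simp add: powr_mult powr_powr powr_add[symmetric] diff_divide_distrib)
      finally show ?thesis by (simp add: mult_ac)
    qed (use r c in simp)
    have "ennreal R \<le> (\<integral>\<^sup>+y. ennreal (k x y) * ennreal (norm (f y)) \<partial>M)"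
      unfolding R_def by (rule kernel_op_norm_le[OF x])
    also have "\<dots> \<le> (\<integral>\<^sup>+y. ennreal (c powr (1 - r) / r) * (ennreal (k x y) * ennreal (norm (f y) powr r))
        + ennreal ((1 - 1 / r) * c) * ennreal (k x y) \<partial>M)"
    proof (rule nn_integral_mono)
      fix y assume y: "y \<in> space M"
      have "k x y * norm (f y) \<le> k x y * (c powr (1 - r) / r * norm (f y) powr r + (1 - 1 / r) * c)"
        using x y by (intro mult_left_mono young kernel_nonneg) auto
      then have "ennreal (k x y * norm (f y))
        \<le> ennreal (c powr (1 - r) / r * (k x y * norm (f y) powr r) + (1 - 1 / r) * c * k x y)"
        by (intro ennreal_leI) (simp add: algebra_simps)
      then show "ennreal (k x y) * ennreal (norm (f y))
          \<le> ennreal (c powr (1 - r) / r) * (ennreal (k x y) * ennreal (norm (f y) powr r))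
            + ennreal ((1 - 1 / r) * c) * ennreal (k x y)"
        using r c x y by (simp add: kernel_nonneg ennreal_mult[symmetric] ennreal_plus[symmetric]
            del: ennreal_plus)
    qed
    also have "\<dots> = ennreal (c powr (1 - r) / r) * B
        + ennreal ((1 - 1 / r) * c) * (\<integral>\<^sup>+y. ennreal (k x y) \<partial>M)"
      by (simp add: nn_integral_add nn_integral_cmult B_def)
    also have "\<dots> \<le> ennreal (c powr (1 - r) / r) * B + ennreal ((1 - 1 / r) * c) * ennreal K"
      using x by (intro add_left_mono mult_left_mono kernel_mass) auto
    also have "\<dots> = ennreal (c powr (1 - r) / r * b + (1 - 1 / r) * c * K)"
      using r c b K_pos by (simp add: ennreal_mult[symmetric] ennreal_plus[symmetric] del: ennreal_plus)
    finally have "R \<le> c powr (1 - r) / r * b + (1 - 1 / r) * c * K"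
      using r c b K_pos by (subst (asm) ennreal_le_iff) auto
    \<comment> \<open>With \<open>c = R / K\<close> the second term is
      \<open>(1 - 1 / r) * R\<close>, which is absorbed on the left and leaves \<open>R / r\<close>
      there.\<close>
    also have "\<dots> = c powr (1 - r) / r * b + R - R / r"
      using K_pos by (simp add: c_def algebra_simps)
    finally have "R \<le> c powr (1 - r) * b"
      using r by (simp add: divide_right_mono field_simps)
    then have "R * R powr (r - 1) \<le> c powr (1 - r) * b * R powr (r - 1)"
      by (rule mult_right_mono) simp
    also have "c powr (1 - r) * b * R powr (r - 1) = K powr (r - 1) * b"
      using R K_pos by (simp add: c_def powr_divide powr_diff field_simps)
    also have "R * R powr (r - 1) = R powr r"
      using R by (simp add: powr_diff)
    finally show ?thesis
      using b by (simp add: ennreal_mult[symmetric])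
  qed
  then show ?thesis
    using r K_pos by (cases "R = 0"; cases "B = \<infinity>") (auto simp: R_def B_def ennreal_mult_top)
qed

text \<open>For p = \<infinity> the mass bound in y suffices. For finite p a factor
  \<open>K powr (r - 1)\<close> comes from Young's inequality and a factor \<open>K\<close> from
  integrating in x; together they make \<open>K powr r\<close>.\<close>

lemma Lp_norm_kernel_op_le:
  assumes p: "1 \<le> p" and f [measurable]: "f \<in> borel_measurable M"
  shows "Lp_norm M p (kernel_op M k f) \<le> ennreal K * Lp_norm M p f"
proof (cases "p = \<infinity>")
  case True
  let ?S = "esssup M (\<lambda>x. ennreal (norm (f x)))"
  have "ennreal (norm (kernel_op M k f x)) \<le> ennreal K * ?S" if x: "x \<in> space M" for x
  proof -
    note [measurable] = x
    have "ennreal (norm (kernel_op M k f x)) \<le> (\<integral>\<^sup>+y. ennreal (k x y) * ennreal (norm (f y)) \<partial>M)"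
      by (rule kernel_op_norm_le[OF x])
    also have "\<dots> \<le> (\<integral>\<^sup>+y. ennreal (k x y) * ?S \<partial>M)"
      using esssup_AE[of "\<lambda>x. ennreal (norm (f x))" M]
      by (intro nn_integral_mono_AE) (auto intro!: mult_left_mono elim!: eventually_mono)
    also have "\<dots> = (\<integral>\<^sup>+y. ennreal (k x y) \<partial>M) * ?S"
      by (rule nn_integral_multc) simp
    also have "\<dots> \<le> ennreal K * ?S"
      using x by (intro mult_right_mono kernel_mass) auto
    finally show ?thesis .
  qed
  then show ?thesis
    using True by (auto simp: Lp_norm_def intro!: esssup_I AE_I2)
next
  case False
  define r where "r = enn2real p"
  have r: "1 \<le> r"
    using p False by (simp add: r_def) (metis enn2real_1 enn2real_mono infinity_ennreal_def less_top)
  have "(\<integral>\<^sup>+x. ennreal (norm (kernel_op M k f x) powr r) \<partial>M)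
     \<le> (\<integral>\<^sup>+x. ennreal (K powr (r - 1)) * (\<integral>\<^sup>+y. ennreal (k x y) * ennreal (norm (f y) powr r) \<partial>M) \<partial>M)"
    using r by (intro nn_integral_mono kernel_op_powr_le) auto
  also have "\<dots> = ennreal (K powr (r - 1)) * (\<integral>\<^sup>+x. (\<integral>\<^sup>+y. ennreal (k x y) * ennreal (norm (f y) powr r) \<partial>M) \<partial>M)"
    by (simp add: nn_integral_cmult)
  also have "\<dots> \<le> ennreal (K powr (r - 1)) * (ennreal K * (\<integral>\<^sup>+y. ennreal (norm (f y) powr r) \<partial>M))"
    by (intro mult_left_mono nn_integral_kernel_le) auto
  also have "\<dots> = ennreal (K powr r) * (\<integral>\<^sup>+y. ennreal (norm (f y) powr r) \<partial>M)"
    using K_pos by (simp add: ennreal_mult[symmetric] powr_diff mult.assoc[symmetric])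
  finally show ?thesis
    unfolding r_def by (rule Lp_norm_le_of_powr_le[OF False p K_pos])
qed

lemma kernel_op_L2_le:
  assumes [measurable]: "f \<in> borel_measurable M"
  shows "(\<integral>\<^sup>+x. ennreal ((norm (kernel_op M k f x))\<^sup>2) \<partial>M)
    \<le> ennreal (K\<^sup>2) * (\<integral>\<^sup>+x. ennreal ((norm (f x))\<^sup>2) \<partial>M)"
proof -
  have "(\<integral>\<^sup>+x. ennreal ((norm (kernel_op M k f x))\<^sup>2) \<partial>M)
     \<le> (\<integral>\<^sup>+x. ennreal K * (\<integral>\<^sup>+y. ennreal (k x y) * ennreal ((norm (f y))\<^sup>2) \<partial>M) \<partial>M)"
    using kernel_op_powr_le[of 2] K_pos by (intro nn_integral_mono) simp
  also have "\<dots> = ennreal K * (\<integral>\<^sup>+x. (\<integral>\<^sup>+y. ennreal (k x y) * ennreal ((norm (f y))\<^sup>2) \<partial>M) \<partial>M)"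
    by (simp add: nn_integral_cmult)
  also have "\<dots> \<le> ennreal K * (ennreal K * (\<integral>\<^sup>+y. ennreal ((norm (f y))\<^sup>2) \<partial>M))"
    by (intro mult_left_mono nn_integral_kernel_le) auto
  also have "\<dots> = ennreal (K\<^sup>2) * (\<integral>\<^sup>+x. ennreal ((norm (f x))\<^sup>2) \<partial>M)"
    using K_pos by (simp add: ennreal_mult[symmetric] power2_eq_square mult.assoc[symmetric])
  finally show ?thesis .
qed

section \<open>Linearity, positivity and self-adjointness\<close>

lemma kernel_op_linear:
  assumes "f \<in> L1_plus_Linf M" "g \<in> L1_plus_Linf M"
  shows "AE x in M. kernel_op M k (\<lambda>x. a * f x + b * g x) x
    = a * kernel_op M k f x + b * kernel_op M k g x"
  using integrable_kernel_mult[OF assms(1)] integrable_kernel_mult[OF assms(2)]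
proof eventually_elim
  case (elim x)
  have "kernel_op M k (\<lambda>x. a * f x + b * g x) x
      = (LINT y|M. a * (complex_of_real (k x y) * f y) + b * (complex_of_real (k x y) * g y))"
    by (simp add: kernel_op_def algebra_simps)
  also have "\<dots> = a * kernel_op M k f x + b * kernel_op M k g x"
    using elim by (subst Bochner_Integration.integral_add) (auto simp: kernel_op_def)
  finally show ?case .
qed

lemma kernel_op_nonneg:
  assumes [measurable]: "f \<in> borel_measurable M" and f: "AE x in M. 0 \<le> f x" and x: "x \<in> space M"
  shows "0 \<le> kernel_op M k f x"
proof -
  note [measurable] = x
  have "kernel_op M k f x = (LINT y|M. complex_of_real (k x y * Re (f y)))"
    unfolding kernel_op_def
  proof (rule integral_cong_AE)
    show "AE y in M. complex_of_real (k x y) * f y = complex_of_real (k x y * Re (f y))"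
      using f by eventually_elim (simp add: less_eq_complex_def complex_eq_iff)
  qed measurable
  also have "\<dots> = complex_of_real (LINT y|M. k x y * Re (f y))"
    by (rule integral_complex_of_real)
  also have "(LINT y|M. k x y * Re (f y)) \<ge> 0"
  proof (rule integral_nonneg_AE)
    show "AE y in M. 0 \<le> k x y * Re (f y)"
      using f AE_space by eventually_elim (use x in \<open>simp add: kernel_nonneg less_eq_complex_def\<close>)
  qed
  then have "complex_of_real (LINT y|M. k x y * Re (f y)) \<ge> 0"
    by (simp add: less_eq_complex_def)
  finally show ?thesis .
qed

lemma kernel_op_of_real:
  assumes x [measurable]: "x \<in> space M" and [measurable]: "u \<in> borel_measurable M"
    and u: "\<And>y. y \<in> space M \<Longrightarrow> 0 \<le> u y"
  shows "kernel_op M k (\<lambda>y. complex_of_real (u y)) x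
    = complex_of_real (enn2real (\<integral>\<^sup>+y. ennreal (k x y) * ennreal (u y) \<partial>M))"
proof -
  have "kernel_op M k (\<lambda>y. complex_of_real (u y)) x = complex_of_real (LINT y|M. k x y * u y)"
    unfolding kernel_op_def by (simp flip: of_real_mult)
  also have "(LINT y|M. k x y * u y) = enn2real (\<integral>\<^sup>+y. ennreal (k x y * u y) \<partial>M)"
    using x u by (intro integral_eq_nn_integral) (auto simp: kernel_nonneg)
  also have "(\<integral>\<^sup>+y. ennreal (k x y * u y) \<partial>M) = (\<integral>\<^sup>+y. ennreal (k x y) * ennreal (u y) \<partial>M)"
    using x u by (intro nn_integral_cong) (simp add: ennreal_mult kernel_nonneg)
  finally show ?thesis .
qed

lemma kernel_op_one_le:
  assumes x: "x \<in> space M"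
  shows "kernel_op M k (\<lambda>_. 1) x \<le> complex_of_real K"
proof -
  have "enn2real (\<integral>\<^sup>+y. ennreal (k x y) \<partial>M) \<le> K"
    using kernel_mass[OF x] K_pos by (intro enn2real_leI) auto
  then show ?thesis
    using kernel_op_of_real[OF x, of "\<lambda>_. 1"] by (simp add: less_eq_complex_def)
qed

lemma kernel_op_selfadjoint:
  assumes "f \<in> Lp_space M 2" "g \<in> Lp_space M 2"
  shows "(LINT x|M. kernel_op M k f x * cnj (g x)) = (LINT x|M. f x * cnj (kernel_op M k g x))"
proof -
  have [measurable]: "f \<in> borel_measurable M" "g \<in> borel_measurable M"
    and fin: "(\<integral>\<^sup>+x. ennreal ((norm (f x))\<^sup>2) \<partial>M) < \<infinity>" "(\<integral>\<^sup>+x. ennreal ((norm (g x))\<^sup>2) \<partial>M) < \<infinity>"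
    using assms by (auto simp: Lp_space_2_iff)
  let ?F = "\<lambda>x y. complex_of_real (k x y) * f y * cnj (g x)"
  have [measurable]: "cnj \<in> borel_measurable borel"
    by (intro borel_measurable_continuous_onI continuous_intros)
  have F [measurable]: "(\<lambda>z. case z of (x, y) \<Rightarrow> ?F x y) \<in> borel_measurable (M \<Otimes>\<^sub>M M)"
    by measurable
  have F': "(\<lambda>z. ennreal (norm (case z of (x, y) \<Rightarrow> ?F x y))) \<in> borel_measurable (M \<Otimes>\<^sub>M M)"
    by (rule measurable_compose[OF F]) simp
  have int: "integrable (M \<Otimes>\<^sub>M M) (\<lambda>(x, y). ?F x y)"
  proof (rule integrableI_bounded)
    have "(\<integral>\<^sup>+z. ennreal (norm (case z of (x, y) \<Rightarrow> ?F x y)) \<partial>(M \<Otimes>\<^sub>M M))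
        = (\<integral>\<^sup>+x. \<integral>\<^sup>+y. ennreal (norm (?F x y)) \<partial>M \<partial>M)"
      using nn_integral_fst[OF F'] by simp
    also have "\<dots> \<le> (\<integral>\<^sup>+x. \<integral>\<^sup>+y. ennreal (k x y) * ennreal ((norm (f y))\<^sup>2)
        + ennreal (k x y) * ennreal ((norm (g x))\<^sup>2) \<partial>M \<partial>M)"
    proof (intro nn_integral_mono)
      fix x y assume xy: "x \<in> space M" "y \<in> space M"
      \<comment> \<open>This decouples the two variables: each square then meets the mass of the
        kernel in the other variable, so the double integral is at most \<open>K\<close> times the
        sum of the two squared L^2 norms.\<close>
      have "norm (f y) * norm (g x) \<le> (norm (f y))\<^sup>2 + (norm (g x))\<^sup>2"
        using sum_squares_bound[of "norm (f y)" "norm (g x)"] mult_nonneg_nonneg[OF norm_ge_zero[of "f y"] norm_ge_zero[of "g x"]]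
        by linarith
      then have "norm (?F x y) \<le> k x y * (norm (f y))\<^sup>2 + k x y * (norm (g x))\<^sup>2"
        using mult_left_mono[OF _ kernel_nonneg[OF xy]] kernel_nonneg[OF xy]
        by (simp add: norm_mult mult.assoc distrib_left[symmetric])
      then show "ennreal (norm (?F x y)) \<le> ennreal (k x y) * ennreal ((norm (f y))\<^sup>2)
          + ennreal (k x y) * ennreal ((norm (g x))\<^sup>2)"
        using kernel_nonneg[OF xy] by (simp add: ennreal_mult[symmetric] ennreal_plus[symmetric]
            del: ennreal_plus)
    qed
    also have "\<dots> = (\<integral>\<^sup>+x. \<integral>\<^sup>+y. ennreal (k x y) * ennreal ((norm (f y))\<^sup>2) \<partial>M \<partial>M)
        + (\<integral>\<^sup>+x. (\<integral>\<^sup>+y. ennreal (k x y) \<partial>M) * ennreal ((norm (g x))\<^sup>2) \<partial>M)"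
      by (simp add: nn_integral_add nn_integral_multc cong: nn_integral_cong_simp)
    also have "\<dots> \<le> ennreal K * (\<integral>\<^sup>+x. ennreal ((norm (f x))\<^sup>2) \<partial>M)
        + (\<integral>\<^sup>+x. ennreal K * ennreal ((norm (g x))\<^sup>2) \<partial>M)"
      by (intro add_mono nn_integral_kernel_le nn_integral_mono mult_right_mono kernel_mass) auto
    also have "\<dots> < \<infinity>"
      using fin by (simp add: nn_integral_cmult ennreal_mult_less_top)
    finally show "(\<integral>\<^sup>+z. ennreal (norm (case z of (x, y) \<Rightarrow> ?F x y)) \<partial>(M \<Otimes>\<^sub>M M)) < \<infinity>" .
  qed (rule F)
  have "(LINT x|M. kernel_op M k f x * cnj (g x)) = (LINT x|M. LINT y|M. ?F x y)"
    by (simp add: kernel_op_def)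
  also have "\<dots> = (LINT y|M. LINT x|M. ?F x y)"
    by (rule P.Fubini_integral[OF int, symmetric])
  also have "\<dots> = (LINT y|M. f y * cnj (kernel_op M k g y))"
  proof (rule Bochner_Integration.integral_cong[OF refl])
    fix y assume y: "y \<in> space M"
    have "f y * cnj (kernel_op M k g y) = (LINT x|M. f y * cnj (complex_of_real (k y x) * g x))"
      by (simp add: kernel_op_def integral_cnj[symmetric] del: complex_cnj_mult)
    also have "\<dots> = (LINT x|M. ?F x y)"
      using y by (intro Bochner_Integration.integral_cong) (auto simp: kernel_sym mult_ac)
    finally show "(LINT x|M. ?F x y) = f y * cnj (kernel_op M k g y)" ..
  qed
  finally show ?thesis .
qed

end

section \<open>Semigroups of symmetric kernels\<close>

lemma norm_add_sq_le: "(norm (a + b :: complex))\<^sup>2 \<le> 2 * (norm a)\<^sup>2 + 2 * (norm b)\<^sup>2"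
proof -
  have "(norm (a + b))\<^sup>2 \<le> (norm a + norm b)\<^sup>2"
    by (intro power_mono norm_triangle_ineq) auto
  also have "\<dots> \<le> 2 * (norm a)\<^sup>2 + 2 * (norm b)\<^sup>2"
    using sum_squares_bound[of "norm a" "norm b"] by (simp add: power2_sum)
  finally show ?thesis .
qed

text \<open>The measure space carries no topology: \<open>approximate_identity\<close> lets suitable
  sets U play the part of open sets that approximate A from outside in measure. As the total mass is
  at most 1, convergence inside U also makes the mass outside U disappear for each x in U.\<close>

locale kernel_semigroup = sigma_finite_measure M
  for M :: "'a measure" +
  fixes k :: "real \<Rightarrow> 'a \<Rightarrow> 'a \<Rightarrow> real" and K :: "real \<Rightarrow> real"
  assumes kernel: "\<And>t. 0 < t \<Longrightarrow> symmetric_kernel M (k t) (K t)"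
    and K_le_1: "\<And>t. 0 < t \<Longrightarrow> K t \<le> 1"
    and chapman_kolmogorov:
      "\<And>s t x y. 0 < s \<Longrightarrow> 0 < t \<Longrightarrow> x \<in> space M \<Longrightarrow> y \<in> space M \<Longrightarrow>
        (\<integral>\<^sup>+z. ennreal (k s x z) * ennreal (k t z y) \<partial>M) = ennreal (k (s + t) x y)"
    and approximate_identity:
      "\<And>A e. A \<in> sets M \<Longrightarrow> emeasure M A < \<infinity> \<Longrightarrow> 0 < e \<Longrightarrow>
        \<exists>U\<in>sets M. A \<subseteq> U \<and> emeasure M (U - A) < ennreal e \<and>
          (\<forall>x\<in>U. ((\<lambda>t. \<integral>\<^sup>+y. ennreal (k t x y) * indicator U y \<partial>M) \<longlongrightarrow> 1) (at_right 0))"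
begin

section \<open>The operators and their vectors of strong continuity\<close>

definition T :: "real \<Rightarrow> ('a \<Rightarrow> complex) \<Rightarrow> 'a \<Rightarrow> complex" where
  "T t f = (if t = 0 then f else kernel_op M (k t) f)"

text \<open>The squared L^2 distance with values in \<open>ennreal\<close>: no integrability is
  presupposed and no root occurs in the estimates.\<close>

definition deviation :: "('a \<Rightarrow> complex) \<Rightarrow> real \<Rightarrow> ennreal" where
  "deviation f t = (\<integral>\<^sup>+x. ennreal ((norm (T t f x - f x))\<^sup>2) \<partial>M)"

definition continuity_space :: "('a \<Rightarrow> complex) set" where
  "continuity_space = {f \<in> Lp_space M 2. (deviation f \<longlongrightarrow> 0) (at_right 0)}"

lemma T_measurable [measurable]:
  assumes "0 \<le> t" "f \<in> borel_measurable M"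
  shows "T t f \<in> borel_measurable M"
  using assms symmetric_kernel.kernel_op_measurable[OF kernel, of t f] by (auto simp: T_def)

lemma T_L2_le:
  assumes "0 < t" and [measurable]: "f \<in> borel_measurable M"
  shows "(\<integral>\<^sup>+x. ennreal ((norm (T t f x))\<^sup>2) \<partial>M) \<le> (\<integral>\<^sup>+x. ennreal ((norm (f x))\<^sup>2) \<partial>M)"
proof -
  interpret k: symmetric_kernel M "k t" "K t" by (rule kernel[OF \<open>0 < t\<close>])
  have "(K t)\<^sup>2 \<le> 1"
    using K_le_1[OF \<open>0 < t\<close>] k.K_pos by (simp add: power_le_one)
  then have "ennreal ((K t)\<^sup>2) * (\<integral>\<^sup>+x. ennreal ((norm (f x))\<^sup>2) \<partial>M)
      \<le> 1 * (\<integral>\<^sup>+x. ennreal ((norm (f x))\<^sup>2) \<partial>M)"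
    by (intro mult_right_mono) auto
  then show ?thesis
    using k.kernel_op_L2_le[of f] \<open>0 < t\<close> by (auto simp: T_def)
qed

lemma T_linear:
  assumes "0 < t" "f \<in> L1_plus_Linf M" "g \<in> L1_plus_Linf M"
  shows "AE x in M. T t (\<lambda>x. a * f x + b * g x) x = a * T t f x + b * T t g x"
  using symmetric_kernel.kernel_op_linear[OF kernel, of t f g a b] assms by (simp add: T_def)

lemma L2_lincomb:
  assumes "f \<in> Lp_space M 2" "g \<in> Lp_space M 2"
  shows "(\<lambda>x. a * f x + b * g x) \<in> Lp_space M 2"
proof -
  have [measurable]: "f \<in> borel_measurable M" "g \<in> borel_measurable M"
    and fin: "(\<integral>\<^sup>+x. ennreal ((norm (f x))\<^sup>2) \<partial>M) < \<infinity>" "(\<integral>\<^sup>+x. ennreal ((norm (g x))\<^sup>2) \<partial>M) < \<infinity>"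
    using assms by (auto simp: Lp_space_2_iff)
  have "(\<integral>\<^sup>+x. ennreal ((norm (a * f x + b * g x))\<^sup>2) \<partial>M)
      \<le> (\<integral>\<^sup>+x. ennreal (2 * (norm a)\<^sup>2) * ennreal ((norm (f x))\<^sup>2)
            + ennreal (2 * (norm b)\<^sup>2) * ennreal ((norm (g x))\<^sup>2) \<partial>M)"
    using norm_add_sq_le[of "a * f _" "b * g _"]
    by (intro nn_integral_mono) (auto simp: ennreal_mult[symmetric] ennreal_plus[symmetric]
        norm_mult power_mult_distrib mult_ac simp del: ennreal_plus intro!: ennreal_leI)
  also have "\<dots> < \<infinity>"
    using fin by (simp add: nn_integral_add nn_integral_cmult ennreal_mult_less_top)
  finally show ?thesis
    by (simp add: Lp_space_2_iff)
qed

lemma continuity_space_lincomb: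
  assumes f: "f \<in> continuity_space" and g: "g \<in> continuity_space"
  shows "(\<lambda>x. a * f x + b * g x) \<in> continuity_space"
proof -
  let ?h = "\<lambda>x. a * f x + b * g x"
  have fg: "f \<in> Lp_space M 2" "g \<in> Lp_space M 2" using f g by (auto simp: continuity_space_def)
  then have [measurable]: "f \<in> borel_measurable M" "g \<in> borel_measurable M"
    by (auto simp: Lp_space_2_iff)
  have fg': "f \<in> L1_plus_Linf M" "g \<in> L1_plus_Linf M"
    using fg Lp_space_subset_L1_plus_Linf[of 2 M] by auto
  have le: "deviation ?h t
      \<le> ennreal (2 * (norm a)\<^sup>2) * deviation f t + ennreal (2 * (norm b)\<^sup>2) * deviation g t"
    if "0 < t" for t
  proof -
    have "deviation ?h t \<le> (\<integral>\<^sup>+x. ennreal (2 * (norm a)\<^sup>2) * ennreal ((norm (T t f x - f x))\<^sup>2)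
            + ennreal (2 * (norm b)\<^sup>2) * ennreal ((norm (T t g x - g x))\<^sup>2) \<partial>M)"
      unfolding deviation_def
    proof (rule nn_integral_mono_AE)
      show "AE x in M. ennreal ((norm (T t ?h x - ?h x))\<^sup>2)
          \<le> ennreal (2 * (norm a)\<^sup>2) * ennreal ((norm (T t f x - f x))\<^sup>2)
            + ennreal (2 * (norm b)\<^sup>2) * ennreal ((norm (T t g x - g x))\<^sup>2)"
        using T_linear[OF that fg', of a b]
      proof eventually_elim
        case (elim x)
        have "T t ?h x - ?h x = a * (T t f x - f x) + b * (T t g x - g x)"
          by (simp add: elim algebra_simps)
        then have "(norm (T t ?h x - ?h x))\<^sup>2
            \<le> 2 * (norm a)\<^sup>2 * (norm (T t f x - f x))\<^sup>2 + 2 * (norm b)\<^sup>2 * (norm (T t g x - g x))\<^sup>2"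
          using norm_add_sq_le[of "a * (T t f x - f x)" "b * (T t g x - g x)"]
          by (simp add: norm_mult power_mult_distrib)
        then show ?case
          by (simp add: ennreal_mult[symmetric] ennreal_plus[symmetric] del: ennreal_plus)
      qed
    qed
    also have "\<dots> = ennreal (2 * (norm a)\<^sup>2) * deviation f t + ennreal (2 * (norm b)\<^sup>2) * deviation g t"
      using that by (simp add: nn_integral_add nn_integral_cmult deviation_def)
    finally show ?thesis .
  qed
  have "((\<lambda>t. ennreal (2 * (norm a)\<^sup>2) * deviation f t + ennreal (2 * (norm b)\<^sup>2) * deviation g t)
      \<longlongrightarrow> ennreal (2 * (norm a)\<^sup>2) * 0 + ennreal (2 * (norm b)\<^sup>2) * 0) (at_right 0)"
    using f g by (intro tendsto_add ennreal_tendsto_cmult) (auto simp: continuity_space_def)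
  then have "((\<lambda>t. ennreal (2 * (norm a)\<^sup>2) * deviation f t + ennreal (2 * (norm b)\<^sup>2) * deviation g t)
      \<longlongrightarrow> 0) (at_right 0)" by simp
  then have "(deviation ?h \<longlongrightarrow> 0) (at_right 0)"
    by (rule tendsto_sandwich[OF _ _ tendsto_const, rotated 2])
      (use le in \<open>auto intro: eventually_mono[OF eventually_at_right_less]\<close>)
  then show ?thesis
    using fg by (simp add: continuity_space_def L2_lincomb)
qed

lemma continuity_space_closed:
  assumes f: "f \<in> Lp_space M 2"
    and approx: "\<And>e :: real. 0 < e \<Longrightarrow>
      \<exists>g\<in>continuity_space. (\<integral>\<^sup>+x. ennreal ((norm (f x - g x))\<^sup>2) \<partial>M) < ennreal e"
  shows "f \<in> continuity_space"
proof -
  have [measurable]: "f \<in> borel_measurable M" using f by (simp add: Lp_space_2_iff)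
  have "(deviation f \<longlongrightarrow> 0) (at_right 0)"
  proof (rule tendsto_zero_ennreal)
    fix r :: real assume r: "0 < r"
    \<comment> \<open>The estimate below gives \<open>2 * e + 8 * e = r / 2\<close>, strictly below
      r.\<close>
    define e where "e = r / 20"
    have e: "0 < e" using r by (simp add: e_def)
    from approx[OF e] obtain g where g: "g \<in> continuity_space"
      and ge: "(\<integral>\<^sup>+x. ennreal ((norm (f x - g x))\<^sup>2) \<partial>M) < ennreal e" by auto
    have g2: "g \<in> Lp_space M 2" and g0: "(deviation g \<longlongrightarrow> 0) (at_right 0)"
      using g by (auto simp: continuity_space_def)
    have [measurable]: "g \<in> borel_measurable M" using g2 by (simp add: Lp_space_2_iff)
    have fg': "f \<in> L1_plus_Linf M" "g \<in> L1_plus_Linf M"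
      using f g2 Lp_space_subset_L1_plus_Linf[of 2 M] by auto
    let ?d = "\<lambda>x. 1 * f x + (- 1) * g x"
    have "\<forall>\<^sub>F t in at_right 0. deviation g t < ennreal e"
      using order_tendstoD(2)[OF g0, of "ennreal e"] e by simp
    then show "\<forall>\<^sub>F t in at_right 0. deviation f t < ennreal r"
      using eventually_at_right_less[of 0]
    proof eventually_elim
      case (elim t)
      have dd: "?d x = f x - g x" for x by simp
      have "deviation f t \<le> (\<integral>\<^sup>+x. ennreal 2 * ennreal ((norm (T t g x - g x))\<^sup>2) +
          (ennreal 4 * ennreal ((norm (T t ?d x))\<^sup>2) + ennreal 4 * ennreal ((norm (?d x))\<^sup>2)) \<partial>M)"
        unfolding deviation_def
      proof (rule nn_integral_mono_AE)
        show "AE x in M. ennreal ((norm (T t f x - f x))\<^sup>2)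
            \<le> ennreal 2 * ennreal ((norm (T t g x - g x))\<^sup>2) +
              (ennreal 4 * ennreal ((norm (T t ?d x))\<^sup>2) + ennreal 4 * ennreal ((norm (?d x))\<^sup>2))"
          using T_linear[OF elim(2) fg', of 1 "- 1"]
        proof eventually_elim
          case (elim x)
          \<comment> \<open>The term \<open>T t ?d x\<close> is controlled by \<open>?d\<close>
            uniformly in t, by contractivity; only the first term depends on the smallness of
            t.\<close>
          have "T t f x - f x = (T t g x - g x) + (T t ?d x + (- ?d x))"
            unfolding elim by simp
          then have "(norm (T t f x - f x))\<^sup>2
              \<le> 2 * (norm (T t g x - g x))\<^sup>2 + 2 * (norm (T t ?d x + (- ?d x)))\<^sup>2"
            using norm_add_sq_le[of "T t g x - g x" "T t ?d x + (- ?d x)"] by metis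
          also have "\<dots> \<le> 2 * (norm (T t g x - g x))\<^sup>2 + (4 * (norm (T t ?d x))\<^sup>2 + 4 * (norm (?d x))\<^sup>2)"
            using norm_add_sq_le[of "T t ?d x" "- ?d x"] unfolding norm_minus_cancel by linarith
          finally show ?case
            by (simp add: ennreal_mult[symmetric] ennreal_plus[symmetric] del: ennreal_plus ennreal_numeral)
        qed
      qed
      also have "\<dots> = ennreal 2 * deviation g t + (ennreal 4 * (\<integral>\<^sup>+x. ennreal ((norm (T t ?d x))\<^sup>2) \<partial>M)
          + ennreal 4 * (\<integral>\<^sup>+x. ennreal ((norm (?d x))\<^sup>2) \<partial>M))"
        using elim(2) by (simp add: nn_integral_add nn_integral_cmult deviation_def del: ennreal_numeral)
      also have "\<dots> \<le> ennreal 2 * deviation g t + (ennreal 4 * (\<integral>\<^sup>+x. ennreal ((norm (?d x))\<^sup>2) \<partial>M)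
          + ennreal 4 * (\<integral>\<^sup>+x. ennreal ((norm (?d x))\<^sup>2) \<partial>M))"
        using elim(2) by (intro add_left_mono add_right_mono mult_left_mono T_L2_le) auto
      also have "\<dots> = ennreal 2 * deviation g t + ennreal 8 * (\<integral>\<^sup>+x. ennreal ((norm (f x - g x))\<^sup>2) \<partial>M)"
        by (simp add: dd distrib_right[symmetric])
      also have "\<dots> \<le> ennreal 2 * ennreal e + ennreal 8 * ennreal e"
        using elim(1) ge by (intro add_mono mult_left_mono) auto
      also have "\<dots> = ennreal (10 * e)"
        using e by (simp add: ennreal_mult[symmetric] ennreal_plus[symmetric] del: ennreal_plus ennreal_numeral)
      also have "\<dots> < ennreal r"
        using r by (simp add: e_def ennreal_less_iff)
      finally show ?case .
    qed
  qed
  then show ?thesis using f by (simp add: continuity_space_def)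
qed

lemma nn_integral_T_le:
  assumes t: "0 < t" and u [measurable]: "u \<in> borel_measurable M"
  shows "(\<integral>\<^sup>+x. (\<integral>\<^sup>+y. ennreal (k t x y) * u y \<partial>M) \<partial>M) \<le> (\<integral>\<^sup>+y. u y \<partial>M)"
proof -
  interpret k: symmetric_kernel M "k t" "K t" by (rule kernel[OF t])
  have "ennreal (K t) * (\<integral>\<^sup>+y. u y \<partial>M) \<le> 1 * (\<integral>\<^sup>+y. u y \<partial>M)"
    using K_le_1[OF t] by (intro mult_right_mono) auto
  then show ?thesis
    using k.nn_integral_kernel_le[OF u] by simp
qed

text \<open>With u the image of the indicator, \<open>(1 - u)\<^sup>2 \<le> 1 - u\<close> inside U
  and \<open>u\<^sup>2 \<le> u\<close> outside, because u lies between 0 and 1. The mass that leaks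
  out of U is at most the mass missing inside, since the integral of u over the whole space is at
  most the measure of U. So the defect inside controls everything, and dominated convergence applies
  to it.\<close>

lemma indicator_continuity_space_open:
  assumes U [measurable]: "U \<in> sets M" and fin: "emeasure M U < \<infinity>"
    and lim: "\<And>x. x \<in> U \<Longrightarrow>
      ((\<lambda>t. \<integral>\<^sup>+y. ennreal (k t x y) * indicator U y \<partial>M) \<longlongrightarrow> 1) (at_right 0)"
  shows "(\<lambda>x. complex_of_real (indicator U x)) \<in> continuity_space"
proof -
  define u where "u t x = (\<integral>\<^sup>+y. ennreal (k t x y) * indicator U y \<partial>M)" for t x
  let ?f = "\<lambda>x. complex_of_real (indicator U x)"
  have u_meas [measurable]: "u t \<in> borel_measurable M" if "0 < t" for t
  proof -
    interpret k: symmetric_kernel M "k t" "K t" by (rule kernel[OF that])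
    show ?thesis unfolding u_def by measurable
  qed
  have u_le_1: "u t x \<le> 1" if "0 < t" "x \<in> space M" for t x
  proof -
    interpret k: symmetric_kernel M "k t" "K t" by (rule kernel[OF that(1)])
    have "u t x \<le> (\<integral>\<^sup>+y. ennreal (k t x y) \<partial>M)"
      unfolding u_def by (intro nn_integral_mono) (auto simp: indicator_def)
    also have "\<dots> \<le> ennreal (K t)" by (rule k.kernel_mass[OF that(2)])
    also have "\<dots> \<le> 1" using K_le_1[OF that(1)] by simp
    finally show ?thesis .
  qed
  have dev: "deviation ?f t \<le> 2 * (\<integral>\<^sup>+x. indicator U x * (1 - u t x) \<partial>M)" if t: "0 < t" for t
  proof -
    interpret k: symmetric_kernel M "k t" "K t" by (rule kernel[OF t])
    note [measurable] = u_meas[OF t]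
    let ?in = "\<integral>\<^sup>+x. indicator U x * u t x \<partial>M"
    let ?out = "\<integral>\<^sup>+x. indicator (space M - U) x * u t x \<partial>M"
    let ?def = "\<integral>\<^sup>+x. indicator U x * (1 - u t x) \<partial>M"
    have "?out + ?in = (\<integral>\<^sup>+x. u t x \<partial>M)"
      by (subst nn_integral_add[symmetric]) (auto intro!: nn_integral_cong simp: indicator_def)
    also have "\<dots> \<le> (\<integral>\<^sup>+x. indicator U x \<partial>M)"
      unfolding u_def by (rule nn_integral_T_le[OF t]) simp
    also have "\<dots> = ?def + ?in"
    proof (subst nn_integral_add[symmetric], goal_cases)
      case 3
      show ?case
        using u_le_1[OF t] by (intro nn_integral_cong) (auto simp: indicator_def diff_add_cancel_ennreal)
    qed simp_all
    finally have "?out + ?in \<le> ?def + ?in" .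
    \<comment> \<open>Cancelling \<open>?in\<close> in \<open>ennreal\<close> requires it to be
      finite.\<close>
    moreover have "?in < \<infinity>"
    proof -
      have "?in \<le> (\<integral>\<^sup>+x. indicator U x \<partial>M)"
        using u_le_1[OF t] by (intro nn_integral_mono) (auto simp: indicator_def)
      then show ?thesis using fin by simp
    qed
    ultimately have out: "?out \<le> ?def"
      using ennreal_add_left_cancel_le[of ?in ?out ?def] by (auto simp: add.commute[of _ ?in])
    have "deviation ?f t \<le> (\<integral>\<^sup>+x. indicator U x * (1 - u t x) + indicator (space M - U) x * u t x \<partial>M)"
      unfolding deviation_def
    proof (rule nn_integral_mono)
      fix x assume x: "x \<in> space M"
      define v where "v = enn2real (u t x)"
      have v: "0 \<le> v" "v \<le> 1" "u t x = ennreal v"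
        using u_le_1[OF t x] by (cases "u t x"; auto simp: v_def top_unique ennreal_le_1)+
      have "T t ?f x = complex_of_real v"
        using t x k.kernel_op_of_real[of x "indicator U"]
        by (simp add: T_def v_def u_def ennreal_indicator)
      then have "T t ?f x - ?f x = complex_of_real (v - indicator U x)"
        by simp
      then have "(norm (T t ?f x - ?f x))\<^sup>2 = (v - indicator U x)\<^sup>2"
        by (simp only: norm_of_real power2_abs)
      moreover have "v\<^sup>2 \<le> v" "(v - 1)\<^sup>2 \<le> 1 - v"
        using v mult_left_le[of v v] mult_left_le[of "1 - v" "1 - v"]
        by (auto simp: power2_eq_square algebra_simps)
      moreover have "1 - ennreal v = ennreal (1 - v)"
        using ennreal_minus[of v 1] v(1) by simp
      ultimately show "ennreal ((norm (T t ?f x - ?f x))\<^sup>2)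
          \<le> indicator U x * (1 - u t x) + indicator (space M - U) x * u t x"
        using x v by (cases "x \<in> U") (simp_all add: ennreal_leI)
    qed
    also have "\<dots> = ?def + ?out"
      by (simp add: nn_integral_add)
    also have "\<dots> \<le> 2 * ?def"
      using out by (simp add: mult_2 add_left_mono)
    finally show ?thesis .
  qed
  have "((\<lambda>t. \<integral>\<^sup>+x. indicator U x * (1 - u t x) \<partial>M) \<longlongrightarrow> 0) (at_right 0)"
  \<comment> \<open>Dominated convergence concerns sequences, so the limit is tested on positive
    sequences tending to 0; \<open>indicator U\<close> is an integrable majorant.\<close>
  proof (rule tendsto_at_right_sequentially[of 0 1])
    fix S :: "nat \<Rightarrow> real" assume S: "\<And>n. 0 < S n" "S \<longlonglongrightarrow> 0"
    have "S n \<noteq> 0" for n using S(1)[of n] by simp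
    then have S': "filterlim S (at_right 0) sequentially"
      using S by (auto simp: filterlim_at intro!: always_eventually)
    note [measurable] = u_meas[OF S(1)]
    have "(\<lambda>n. \<integral>\<^sup>+x. indicator U x * (1 - u (S n) x) \<partial>M) \<longlonglongrightarrow> (\<integral>\<^sup>+x. 0 \<partial>M)"
    proof (rule nn_integral_dominated_convergence[where w = "indicator U"])
      show "AE x in M. (\<lambda>n. indicator U x * (1 - u (S n) x)) \<longlonglongrightarrow> 0"
      proof (rule AE_I2)
        fix x assume "x \<in> space M"
        have "(\<lambda>n. 1 - u (S n) x) \<longlonglongrightarrow> 1 - 1" if "x \<in> U"
        proof -
          have "((\<lambda>t. u t x) \<longlongrightarrow> 1) (at_right 0)"
            unfolding u_def by (rule lim[OF that])
          from filterlim_compose[OF this S'] show ?thesis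
            by (intro tendsto_diff_ennreal tendsto_const) auto
        qed
        then show "(\<lambda>n. indicator U x * (1 - u (S n) x)) \<longlonglongrightarrow> 0"
          by (auto simp: indicator_def)
      qed
      show "AE x in M. indicator U x * (1 - u (S n) x) \<le> indicator U x" for n
        by (auto simp: indicator_def diff_le_self_ennreal)
    qed (use fin in simp_all)
    then show "(\<lambda>n. \<integral>\<^sup>+x. indicator U x * (1 - u (S n) x) \<partial>M) \<longlonglongrightarrow> 0" by simp
  qed simp
  then have "((\<lambda>t. 2 * (\<integral>\<^sup>+x. indicator U x * (1 - u t x) \<partial>M)) \<longlongrightarrow> 2 * 0) (at_right 0)"
    by (intro ennreal_tendsto_cmult) auto
  then have "((\<lambda>t. 2 * (\<integral>\<^sup>+x. indicator U x * (1 - u t x) \<partial>M)) \<longlongrightarrow> 0) (at_right 0)"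
    by simp
  then have "(deviation ?f \<longlongrightarrow> 0) (at_right 0)"
    by (rule tendsto_sandwich[OF _ _ tendsto_const, rotated 2])
      (use dev in \<open>auto intro: eventually_mono[OF eventually_at_right_less]\<close>)
  moreover have "?f \<in> Lp_space M 2"
    using fin by (simp add: Lp_space_2_iff ennreal_indicator power2_eq_square
        flip: indicator_inter_arith)
  ultimately show ?thesis by (simp add: continuity_space_def)
qed

section \<open>From indicator functions to all of L^2\<close>

lemma indicator_continuity_space:
  assumes A [measurable]: "A \<in> sets M" and fin: "emeasure M A < \<infinity>"
  shows "(\<lambda>x. complex_of_real (indicator A x)) \<in> continuity_space"
proof (rule continuity_space_closed)
  show "(\<lambda>x. complex_of_real (indicator A x)) \<in> Lp_space M 2"
    using fin by (simp add: Lp_space_2_iff ennreal_indicator power2_eq_square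
        flip: indicator_inter_arith)
  fix e :: real assume "0 < e"
  from approximate_identity[OF A fin this] obtain U where U [measurable]: "U \<in> sets M"
    and AU: "A \<subseteq> U" "emeasure M (U - A) < ennreal e"
    and lim: "\<forall>x\<in>U. ((\<lambda>t. \<integral>\<^sup>+y. ennreal (k t x y) * indicator U y \<partial>M) \<longlongrightarrow> 1) (at_right 0)"
    by blast
  have "emeasure M U \<le> emeasure M (U - A) + emeasure M A"
    using AU(1) by (subst plus_emeasure) (auto simp: Un_absorb2)
  also have "\<dots> < \<infinity>"
    using AU(2) fin by (simp add: order_less_trans)
  finally have "(\<lambda>x. complex_of_real (indicator U x)) \<in> continuity_space"
    using lim by (intro indicator_continuity_space_open) auto
  moreover have "(\<integral>\<^sup>+x. ennreal ((norm (complex_of_real (indicator A x) - complex_of_real (indicator U x)))\<^sup>2) \<partial>M)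
      = (\<integral>\<^sup>+x. indicator (U - A) x \<partial>M)"
    using AU(1) by (intro nn_integral_cong) (auto simp: indicator_def)
  ultimately show "\<exists>g\<in>continuity_space.
      (\<integral>\<^sup>+x. ennreal ((norm (complex_of_real (indicator A x) - g x))\<^sup>2) \<partial>M) < ennreal e"
    using AU(2) by (intro bexI[of _ "\<lambda>x. complex_of_real (indicator U x)"]) auto
qed

lemma simple_function_continuity_space:
  assumes s: "simple_function M s" and L2: "s \<in> Lp_space M 2"
  shows "s \<in> continuity_space"
proof -
  let ?A = "\<lambda>c. s -` {c} \<inter> space M"
  have [measurable]: "?A c \<in> sets M" for c
    using s by (rule simple_functionD)
  have zero: "(\<lambda>x. 0) \<in> continuity_space"
    using indicator_continuity_space[of "{}"] by simp
  have "(\<lambda>x. \<Sum>c\<in>C. c * complex_of_real (indicator (?A c) x)) \<in> continuity_space"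
    if "finite C" "C \<subseteq> s ` space M" for C
    using that
  proof (induction C)
    case empty
    then show ?case by (simp add: zero)
  next
    case (insert c C)
    show ?case
    \<comment> \<open>The level set of the value 0 may have infinite measure, but its summand
      vanishes; the level sets of nonzero values have finite measure because s is square
      integrable.\<close>
    proof (cases "c = 0")
      case True
      then show ?thesis using insert by simp
    next
      case False
      have "ennreal ((norm c)\<^sup>2) * emeasure M (?A c) = (\<integral>\<^sup>+x. ennreal ((norm c)\<^sup>2) * indicator (?A c) x \<partial>M)"
        by (simp add: nn_integral_cmult_indicator)
      also have "\<dots> \<le> (\<integral>\<^sup>+x. ennreal ((norm (s x))\<^sup>2) \<partial>M)"
        by (intro nn_integral_mono) (auto simp: indicator_def)
      also have "\<dots> < \<infinity>" using L2 by (simp add: Lp_space_2_iff)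
      finally have "emeasure M (?A c) < \<infinity>"
        using False by (auto simp: ennreal_mult_less_top)
      then have "(\<lambda>x. complex_of_real (indicator (?A c) x)) \<in> continuity_space"
        by (intro indicator_continuity_space) auto
      then have "(\<lambda>x. c * complex_of_real (indicator (?A c) x)
          + 1 * (\<Sum>c\<in>C. c * complex_of_real (indicator (?A c) x))) \<in> continuity_space"
        using insert by (intro continuity_space_lincomb) auto
      then show ?thesis using insert by simp
    qed
  qed
  moreover define g where "g x = (\<Sum>c\<in>s ` space M. c * complex_of_real (indicator (?A c) x))" for x
  ultimately have g: "g \<in> continuity_space"
    using s by (simp add: simple_functionD g_def[abs_def])
  have "s x = g x" if "x \<in> space M" for x
    unfolding g_def
    by (rule trans[OF simple_function_indicator_representation_banach[OF s that]])
      (intro sum.cong refl, simp add: scaleR_conv_of_real mult.commute)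
  then have "(\<integral>\<^sup>+x. ennreal ((norm (s x - g x))\<^sup>2) \<partial>M) = (\<integral>\<^sup>+x. 0 \<partial>M)"
    by (intro nn_integral_cong) auto
  then show ?thesis
    by (intro continuity_space_closed[OF L2] bexI[OF _ g]) simp
qed

lemma L2_continuity_space: "Lp_space M 2 \<subseteq> continuity_space"
proof
  fix f assume f: "f \<in> Lp_space M 2"
  then have [measurable]: "f \<in> borel_measurable M"
    and fin: "(\<integral>\<^sup>+x. ennreal ((norm (f x))\<^sup>2) \<partial>M) < \<infinity>" by (auto simp: Lp_space_2_iff)
  from borel_measurable_implies_sequence_metric[OF \<open>f \<in> borel_measurable M\<close>, of 0] obtain s where
    s: "\<And>i. simple_function M (s i)" and
    lim: "\<And>x. x \<in> space M \<Longrightarrow> (\<lambda>i. s i x) \<longlonglongrightarrow> f x" and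
    bound: "\<And>i x. x \<in> space M \<Longrightarrow> norm (s i x) \<le> 2 * norm (f x)"
    by simp metis
  have [measurable]: "s i \<in> borel_measurable M" for i
    using s by (rule borel_measurable_simple_function)
  have "s i \<in> Lp_space M 2" for i
  proof -
    have "(\<integral>\<^sup>+x. ennreal ((norm (s i x))\<^sup>2) \<partial>M) \<le> (\<integral>\<^sup>+x. ennreal 4 * ennreal ((norm (f x))\<^sup>2) \<partial>M)"
    proof (rule nn_integral_mono)
      fix x assume x: "x \<in> space M"
      have "(norm (s i x))\<^sup>2 \<le> (2 * norm (f x))\<^sup>2"
        using bound[OF x] by (intro power_mono) auto
      then show "ennreal ((norm (s i x))\<^sup>2) \<le> ennreal 4 * ennreal ((norm (f x))\<^sup>2)"
        by (simp add: ennreal_mult[symmetric] power_mult_distrib del: ennreal_numeral)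
    qed
    also have "\<dots> < \<infinity>"
      using fin by (simp add: nn_integral_cmult ennreal_mult_less_top del: ennreal_numeral)
    finally show ?thesis by (simp add: Lp_space_2_iff)
  qed
  then have sc: "s i \<in> continuity_space" for i
    using s by (intro simple_function_continuity_space)
  have "(\<lambda>i. \<integral>\<^sup>+x. ennreal ((norm (f x - s i x))\<^sup>2) \<partial>M) \<longlonglongrightarrow> (\<integral>\<^sup>+x. 0 \<partial>M)"
  \<comment> \<open>From \<open>norm (s i x) \<le> 2 * norm (f x)\<close> follows
    \<open>norm (f x - s i x) \<le> 3 * norm (f x)\<close>, whence the factor 9.\<close>
  proof (rule nn_integral_dominated_convergence[where w = "\<lambda>x. ennreal 9 * ennreal ((norm (f x))\<^sup>2)"])
    show "(\<integral>\<^sup>+x. ennreal 9 * ennreal ((norm (f x))\<^sup>2) \<partial>M) < \<infinity>"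
      using fin by (simp add: nn_integral_cmult ennreal_mult_less_top del: ennreal_numeral)
    show "AE x in M. ennreal ((norm (f x - s i x))\<^sup>2) \<le> ennreal 9 * ennreal ((norm (f x))\<^sup>2)" for i
    proof (rule AE_I2)
      fix x assume x: "x \<in> space M"
      have "(norm (f x - s i x))\<^sup>2 \<le> (3 * norm (f x))\<^sup>2"
        using bound[OF x, of i] norm_triangle_ineq4[of "f x" "s i x"] by (intro power_mono) auto
      then show "ennreal ((norm (f x - s i x))\<^sup>2) \<le> ennreal 9 * ennreal ((norm (f x))\<^sup>2)"
        by (simp add: ennreal_mult[symmetric] power_mult_distrib del: ennreal_numeral)
    qed
    show "AE x in M. (\<lambda>i. ennreal ((norm (f x - s i x))\<^sup>2)) \<longlonglongrightarrow> 0"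
    proof (rule AE_I2)
      fix x assume "x \<in> space M"
      then have "(\<lambda>i. (norm (f x - s i x))\<^sup>2) \<longlonglongrightarrow> (norm (f x - f x))\<^sup>2"
        by (intro tendsto_intros lim)
      then show "(\<lambda>i. ennreal ((norm (f x - s i x))\<^sup>2)) \<longlonglongrightarrow> 0"
        using tendsto_ennrealI by fastforce
    qed
  qed auto
  then have *: "(\<lambda>i. \<integral>\<^sup>+x. ennreal ((norm (f x - s i x))\<^sup>2) \<partial>M) \<longlonglongrightarrow> 0" by simp
  show "f \<in> continuity_space"
  proof (rule continuity_space_closed[OF f])
    fix e :: real assume "0 < e"
    then have "\<forall>\<^sub>F i in sequentially. (\<integral>\<^sup>+x. ennreal ((norm (f x - s i x))\<^sup>2) \<partial>M) < ennreal e"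
      using order_tendstoD(2)[OF *] by simp
    then show "\<exists>g\<in>continuity_space. (\<integral>\<^sup>+x. ennreal ((norm (f x - g x))\<^sup>2) \<partial>M) < ennreal e"
      using sc by (auto simp: eventually_sequentially)
  qed
qed

lemma T_strongly_continuous:
  assumes f: "f \<in> Lp_space M 2"
  shows "((\<lambda>t. Lp_norm M 2 (\<lambda>x. T t f x - f x)) \<longlongrightarrow> 0) (at_right 0)"
proof (rule tendsto_zero_ennreal)
  fix r :: real assume r: "0 < r"
  have "(deviation f \<longlongrightarrow> 0) (at_right 0)"
    using f L2_continuity_space by (auto simp: continuity_space_def)
  then have "\<forall>\<^sub>F t in at_right 0. deviation f t < ennreal (r\<^sup>2)"
    using r by (intro order_tendstoD(2)[where y = 0]) auto
  then show "\<forall>\<^sub>F t in at_right 0. Lp_norm M 2 (\<lambda>x. T t f x - f x) < ennreal r"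
  proof eventually_elim
    case (elim t)
    then obtain d where d: "deviation f t = ennreal d" "0 \<le> d"
      by (cases "deviation f t") auto
    with elim have "d < r\<^sup>2" by (simp add: ennreal_less_iff)
    then have "sqrt d < r"
      using r by (simp add: real_less_lsqrt)
    then show ?case
      using d r by (simp add: Lp_norm_2_eq Let_def deviation_def[symmetric] ennreal_less_iff)
  qed
qed

section \<open>The semigroup law and the submarkovian axioms\<close>

lemma kernel_op_semigroup:
  assumes s: "0 < s" and t: "0 < t" and f: "f \<in> L1_plus_Linf M"
  shows "AE x in M. kernel_op M (k (s + t)) f x = kernel_op M (k s) (kernel_op M (k t) f) x"
proof -
  interpret s: symmetric_kernel M "k s" "K s" by (rule kernel[OF s])
  interpret t: symmetric_kernel M "k t" "K t" by (rule kernel[OF t])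
  have st: "0 < s + t" using s t by simp
  interpret st: symmetric_kernel M "k (s + t)" "K (s + t)" by (rule kernel[OF st])
  have [measurable]: "f \<in> borel_measurable M" using f by (simp add: L1_plus_Linf_iff)
  show ?thesis
    using st.integrable_kernel_mult[OF f] AE_space
  proof eventually_elim
    case (elim x)
    note x [measurable] = elim(2)
    let ?F = "\<lambda>z y. complex_of_real (k s x z) * (complex_of_real (k t z y) * f y)"
    have F [measurable]: "(\<lambda>w. case w of (z, y) \<Rightarrow> ?F z y) \<in> borel_measurable (M \<Otimes>\<^sub>M M)"
      by measurable
    have F': "(\<lambda>w. ennreal (norm (case w of (z, y) \<Rightarrow> ?F z y))) \<in> borel_measurable (M \<Otimes>\<^sub>M M)"
      by (rule measurable_compose[OF F]) simp
    have int: "integrable (M \<Otimes>\<^sub>M M) (\<lambda>(z, y). ?F z y)"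
    proof (rule integrableI_bounded)
      have "(\<integral>\<^sup>+w. ennreal (norm (case w of (z, y) \<Rightarrow> ?F z y)) \<partial>(M \<Otimes>\<^sub>M M))
          = (\<integral>\<^sup>+z. \<integral>\<^sup>+y. ennreal (norm (?F z y)) \<partial>M \<partial>M)"
        using nn_integral_fst[OF F'] by simp
      \<comment> \<open>Integrability in two variables comes from the Chapman--Kolmogorov equation
        itself: integrating in z first turns the product of kernels into
        \<open>k (s + t) x y\<close>, against which f is integrable for almost every x.\<close>
      also have "\<dots> = (\<integral>\<^sup>+y. \<integral>\<^sup>+z. ennreal (norm (?F z y)) \<partial>M \<partial>M)"
        by (rule s.P.Fubini'[symmetric]) (use F' in \<open>simp add: case_prod_beta'\<close>)
      also have "\<dots> = (\<integral>\<^sup>+y. (\<integral>\<^sup>+z. ennreal (k s x z) * ennreal (k t z y) \<partial>M) * ennreal (norm (f y)) \<partial>M)"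
        using x by (intro nn_integral_cong) (auto simp: nn_integral_multc[symmetric] norm_mult
            s.kernel_nonneg t.kernel_nonneg ennreal_mult mult.assoc intro!: nn_integral_cong)
      also have "\<dots> = (\<integral>\<^sup>+y. ennreal (norm (complex_of_real (k (s + t) x y) * f y)) \<partial>M)"
        using x s t by (intro nn_integral_cong)
          (auto simp: chapman_kolmogorov norm_mult st.kernel_nonneg ennreal_mult)
      also have "\<dots> < \<infinity>"
        using elim(1) by (simp add: integrable_iff_bounded)
      finally show "(\<integral>\<^sup>+w. ennreal (norm (case w of (z, y) \<Rightarrow> ?F z y)) \<partial>(M \<Otimes>\<^sub>M M)) < \<infinity>" .
    qed (rule F)
    have "kernel_op M (k s) (kernel_op M (k t) f) x = (LINT z|M. LINT y|M. ?F z y)"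
      by (simp add: kernel_op_def)
    also have "\<dots> = (LINT y|M. LINT z|M. ?F z y)"
      by (rule s.P.Fubini_integral[OF int, symmetric])
    also have "\<dots> = (LINT y|M. complex_of_real (k (s + t) x y) * f y)"
    proof (rule Bochner_Integration.integral_cong[OF refl])
      fix y assume y [measurable]: "y \<in> space M"
      have "(LINT z|M. k s x z * k t z y) = enn2real (\<integral>\<^sup>+z. ennreal (k s x z * k t z y) \<partial>M)"
        using x y by (intro integral_eq_nn_integral) (auto simp: s.kernel_nonneg t.kernel_nonneg)
      also have "(\<integral>\<^sup>+z. ennreal (k s x z * k t z y) \<partial>M) = (\<integral>\<^sup>+z. ennreal (k s x z) * ennreal (k t z y) \<partial>M)"
        using x y by (intro nn_integral_cong) (simp add: ennreal_mult s.kernel_nonneg t.kernel_nonneg)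
      also have "\<dots> = ennreal (k (s + t) x y)"
        by (rule chapman_kolmogorov[OF s t x y])
      finally have "(LINT z|M. k s x z * k t z y) = k (s + t) x y"
        using x y by (simp add: st.kernel_nonneg)
      then have "complex_of_real (k (s + t) x y) * f y = (LINT z|M. complex_of_real (k s x z * k t z y)) * f y"
        by (simp only: integral_complex_of_real)
      also have "\<dots> = (LINT z|M. complex_of_real (k s x z * k t z y) * f y)"
        by (rule integral_mult_left_zero[symmetric])
      finally show "(LINT z|M. ?F z y) = complex_of_real (k (s + t) x y) * f y"
        by (simp add: mult.assoc)
    qed
    also have "\<dots> = kernel_op M (k (s + t)) f x"
      by (simp add: kernel_op_def)
    finally show ?case ..
  qed
qed

theorem submarkovian:
  "submarkovian_symmetric_diffusion_semigroup M (L1_plus_Linf M) T"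
proof unfold_locales
  show "L1_plus_Linf M \<subseteq> borel_measurable M"
    by (auto dest: L1_plus_Linf_measurable)
  show "(\<lambda>x. a * f x + b * g x) \<in> L1_plus_Linf M"
    if "f \<in> L1_plus_Linf M" "g \<in> L1_plus_Linf M" for a b f g
    using that by (rule L1_plus_Linf_lincomb)
  show "g \<in> L1_plus_Linf M"
    if "f \<in> L1_plus_Linf M" "g \<in> borel_measurable M" "AE x in M. f x = g x" for f g
    using that by (rule L1_plus_Linf_cong_AE)
  show "Lp_space M p \<subseteq> L1_plus_Linf M" if "1 \<le> p" for p
    using that by (rule Lp_space_subset_L1_plus_Linf)
  show "T t f \<in> borel_measurable M" if "0 \<le> t" "f \<in> L1_plus_Linf M" for t f
    using that by (intro T_measurable) (auto dest: L1_plus_Linf_measurable)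
  show "AE x in M. T t f x = T t g x"
    if "0 \<le> t" "f \<in> L1_plus_Linf M" "g \<in> L1_plus_Linf M" "AE x in M. f x = g x" for t f g
  proof (cases "t = 0")
    case False
    then have "0 < t" using that by simp
    from symmetric_kernel.kernel_op_cong_AE[OF kernel[OF this], of f g] that False
    show ?thesis
      unfolding T_def by (intro AE_I2) (simp add: L1_plus_Linf_measurable)
  qed (use that in \<open>simp add: T_def\<close>)
  show "AE x in M. T t (\<lambda>x. a * f x + b * g x) x = a * T t f x + b * T t g x"
    if "0 \<le> t" "f \<in> L1_plus_Linf M" "g \<in> L1_plus_Linf M" for t a b f g
    using T_linear[of t f g a b] that by (cases "t = 0") (auto simp: T_def)
  show "AE x in M. T 0 f x = f x" for f
    by (simp add: T_def)
  show "Lp_norm M p (T t f) \<le> Lp_norm M p f" if "1 \<le> p" "0 \<le> t" "f \<in> Lp_space M p" for p t f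
  proof (cases "t = 0")
    case False
    with that have t: "0 < t" by simp
    have "ennreal (K t) * Lp_norm M p f \<le> 1 * Lp_norm M p f"
      using K_le_1[OF t] by (intro mult_right_mono) auto
    then show ?thesis
      using symmetric_kernel.Lp_norm_kernel_op_le[OF kernel[OF t] \<open>1 \<le> p\<close>, of f] that False
      by (auto simp: T_def Lp_space_def)
  qed (simp add: T_def)
  show "AE x in M. T (s + t) f x = T s (T t f) x"
    if "1 \<le> p" "0 \<le> s" "0 \<le> t" "f \<in> Lp_space M p" for p s t f
    using kernel_op_semigroup[of s t f] Lp_space_subset_L1_plus_Linf[of p M] that
    by (cases "s = 0"; cases "t = 0") (auto simp: T_def)
  show "(LINT x|M. T t f x * cnj (g x)) = (LINT x|M. f x * cnj (T t g x))"
    if "0 \<le> t" "f \<in> Lp_space M 2" "g \<in> Lp_space M 2" for t f g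
    using that symmetric_kernel.kernel_op_selfadjoint[OF kernel, of t f g]
    by (cases "t = 0") (auto simp: T_def)
  show "((\<lambda>t. Lp_norm M 2 (\<lambda>x. T t f x - f x)) \<longlongrightarrow> 0) (at_right 0)" if "f \<in> Lp_space M 2" for f
    by (rule T_strongly_continuous[OF that])
  show "AE x in M. 0 \<le> T t f x"
    if "0 \<le> t" "f \<in> L1_plus_Linf M" "AE x in M. 0 \<le> f x" for t f
  proof (cases "t = 0")
    case False
    then have "0 < t" using that by simp
    from symmetric_kernel.kernel_op_nonneg[OF kernel[OF this], of f] that False
    show ?thesis
      unfolding T_def by (intro AE_I2) (simp add: L1_plus_Linf_measurable)
  qed (use that in \<open>simp add: T_def\<close>)
  show "AE x in M. T t (\<lambda>_. 1) x \<le> 1" if "0 \<le> t" for t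
  proof (cases "t = 0")
    case False
    with that have t: "0 < t" by simp
    interpret k: symmetric_kernel M "k t" "K t" by (rule kernel[OF t])
    show ?thesis
      using False K_le_1[OF t] k.kernel_op_one_le
      by (auto simp: T_def less_eq_complex_def intro: order_trans)
  qed (simp add: T_def)
qed

end

section \<open>Integrals of the modified Bessel function\<close>

lemma suminf_swap_ennreal: "(\<Sum>i. \<Sum>j. f i j) = (\<Sum>j. \<Sum>i. f i j :: ennreal)" for f :: "nat \<Rightarrow> nat \<Rightarrow> ennreal"
  by (rule nn_integral_suminf[of "\<lambda>j i. f i j" "count_space UNIV", unfolded nn_integral_count_space_nat]) simp

lemma suminf_shift_ennreal: "(\<Sum>i. f (i + k)) = (\<Sum>m. if k \<le> m then f m else 0 :: ennreal)"
proof -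
  have "(\<Sum>m. if k \<le> m then f m else 0)
      = (\<Sum>i. if k \<le> i + k then f (i + k) else 0) + (\<Sum>i<k. if k \<le> i then f i else 0)"
    by (rule suminf_offset) (rule summableI)
  then show ?thesis by simp
qed

declare suminf_ennreal [simp del]

lemma suminf_ennreal_exp: "0 \<le> x \<Longrightarrow> (\<Sum>m. ennreal (x ^ m / fact m)) = ennreal (exp x)"
  using exp_converges[of x] by (intro suminf_ennreal_eq) (auto simp: field_simps)

text \<open>The coefficient of \<open>u powr (a / 2 + real m)\<close> in
  \<open>bessel_I a (2 * sqrt u)\<close>; with this argument the powers of 2 in the usual series
  cancel.\<close>

definition bessel_term :: "real \<Rightarrow> nat \<Rightarrow> real" where
  "bessel_term a m = 1 / (fact m * Gamma (a + real m + 1))"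

lemma Gamma_add_nat_pos: "0 \<le> a \<Longrightarrow> 0 < Gamma (a + real m + 1)"
  by (intro Gamma_real_pos) linarith

lemma bessel_term_pos: "0 \<le> a \<Longrightarrow> 0 < bessel_term a m"
  by (simp add: bessel_term_def Gamma_add_nat_pos)

text \<open>Each unit shift multiplies the Gamma value by \<open>a + real m + 1\<close>, which is at
  least 1. The bound makes an exponential series a majorant of the Bessel series.\<close>

lemma bessel_term_le:
  assumes "0 \<le> a"
  shows "bessel_term a m \<le> 1 / (fact m * Gamma (a + 1))"
proof -
  have "Gamma (a + 1) \<le> Gamma (a + real m + 1)"
  proof (induction m)
    case (Suc m)
    have "a + real m + 1 \<notin> \<int>\<^sub>\<le>\<^sub>0"
      using assms by (auto elim!: nonpos_Ints_cases)
    then have "Gamma (a + real (Suc m) + 1) = (a + real m + 1) * Gamma (a + real m + 1)"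
      using Gamma_plus1[of "a + real m + 1"] by (simp add: algebra_simps)
    also have "\<dots> \<ge> 1 * Gamma (a + real m + 1)"
      using assms by (intro mult_right_mono) (auto intro: Gamma_real_nonneg)
    finally show ?case using Suc by simp
  qed simp
  then show ?thesis
    unfolding bessel_term_def using assms
    by (intro divide_left_mono mult_left_mono) (auto simp: Gamma_real_pos)
qed

lemma ennreal_bessel_I:
  assumes a: "0 \<le> a" and u: "0 < u"
  shows "ennreal (bessel_I a (2 * sqrt u)) = (\<Sum>m. ennreal (u powr (a / 2 + real m) * bessel_term a m))"
    and "0 \<le> bessel_I a (2 * sqrt u)"
proof -
  have eq: "(2 * sqrt u / 2) powr (a + 2 * real m) / (fact m * Gamma (a + real m + 1))
      = u powr (a / 2 + real m) * bessel_term a m" for m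
    using u by (simp add: bessel_term_def powr_half_sqrt[symmetric] powr_powr add_divide_distrib)
  have sum: "summable (\<lambda>m. u powr (a / 2 + real m) * bessel_term a m)"
  proof (rule summable_comparison_test')
    show "summable (\<lambda>m. u powr (a / 2) / Gamma (a + 1) * (inverse (fact m) * u ^ m))"
      by (intro summable_mult summable_exp)
    show "norm (u powr (a / 2 + real m) * bessel_term a m)
        \<le> u powr (a / 2) / Gamma (a + 1) * (inverse (fact m) * u ^ m)" for m
    proof -
      have "norm (u powr (a / 2 + real m) * bessel_term a m) = u powr (a / 2) * u ^ m * bessel_term a m"
        using bessel_term_pos[OF a, of m] u by (simp add: powr_add powr_realpow)
      also have "\<dots> \<le> u powr (a / 2) * u ^ m * (1 / (fact m * Gamma (a + 1)))"
        using u by (intro mult_left_mono bessel_term_le[OF a]) simp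
      finally show ?thesis by (simp add: inverse_eq_divide mult_ac)
    qed
  qed
  have nonneg: "0 \<le> u powr (a / 2 + real m) * bessel_term a m" for m
    using bessel_term_pos[OF a, of m] by simp
  show "ennreal (bessel_I a (2 * sqrt u)) = (\<Sum>m. ennreal (u powr (a / 2 + real m) * bessel_term a m))"
    unfolding bessel_I_def eq by (rule suminf_ennreal2[symmetric, OF nonneg sum])
  show "0 \<le> bessel_I a (2 * sqrt u)"
    unfolding bessel_I_def eq by (rule suminf_nonneg[OF sum nonneg])
qed

lemma bessel_I_measurable [measurable]: "bessel_I a \<in> borel_measurable borel"
  unfolding bessel_I_def[abs_def] by (intro borel_measurable_suminf) simp

section \<open>Termwise integrals against one Bessel function\<close>

lemma nn_integral_powr_exp:
  assumes b: "-1 < b" and l: "0 < l"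
  shows "(\<integral>\<^sup>+y\<in>{0<..}. ennreal (y powr b * exp (- l * y)) \<partial>lborel)
    = ennreal (Gamma (b + 1) / l powr (b + 1))"
proof -
  let ?I = "\<integral>\<^sup>+y\<in>{0<..}. ennreal (y powr b * exp (- l * y)) \<partial>lborel"
  have "ennreal (Gamma (b + 1)) = (\<integral>\<^sup>+t. ennreal (indicator {0..} t * t powr b / exp t) \<partial>lborel)"
    using Gamma_conv_nn_integral_real[of "b + 1"] b by simp
  also have "\<dots> = ennreal l * (\<integral>\<^sup>+t. ennreal (indicator {0..} (l * t) * (l * t) powr b / exp (l * t)) \<partial>lborel)"
    using l by (subst nn_integral_real_affine[where c = l and t = 0]) auto
  also have "(\<integral>\<^sup>+t. ennreal (indicator {0..} (l * t) * (l * t) powr b / exp (l * t)) \<partial>lborel)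
      = (\<integral>\<^sup>+t. ennreal (l powr b) * (ennreal (t powr b * exp (- l * t)) * indicator {0<..} t) \<partial>lborel)"
  proof (rule nn_integral_cong)
    fix t :: real
    \<comment> \<open>At \<open>t = 0\<close> the two indicators differ, but the left side vanishes
      as well because \<open>0 powr b = 0\<close>.\<close>
    show "ennreal (indicator {0..} (l * t) * (l * t) powr b / exp (l * t))
      = ennreal (l powr b) * (ennreal (t powr b * exp (- l * t)) * indicator {0<..} t)"
      using l by (cases "t > 0"; cases "t = 0")
        (auto simp: indicator_def zero_le_mult_iff ennreal_mult[symmetric] powr_mult exp_minus field_simps)
  qed
  also have "ennreal l * \<dots> = ennreal (l powr (b + 1)) * ?I"
  proof -
    have "ennreal l * ennreal (l powr b) = ennreal (l powr (b + 1))"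
      using l by (simp add: ennreal_mult[symmetric] powr_add mult.commute)
    then show ?thesis
      by (subst nn_integral_cmult) (simp_all add: mult.assoc[symmetric])
  qed
  finally have "ennreal (1 / l powr (b + 1)) * ennreal (Gamma (b + 1))
      = ennreal (1 / l powr (b + 1)) * ennreal (l powr (b + 1)) * ?I"
    by (simp only: mult.assoc)
  also have "ennreal (1 / l powr (b + 1)) * ennreal (l powr (b + 1)) = 1"
    using l by (simp add: ennreal_mult[symmetric])
  finally show ?thesis
    using l b by (simp add: ennreal_mult[symmetric] Gamma_real_nonneg)
qed

text \<open>The exponent \<open>c\<close> serves three uses: 0 for the mass of the kernel,
  \<open>a / 2\<close> for the test functions, and \<open>a / 2 + real n\<close> for the n-th term
  of a second Bessel series.\<close>

lemma nn_integral_powr_exp_bessel: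
  assumes a: "0 \<le> a" and A: "0 < A" and l: "0 < l" and c: "0 \<le> c"
  shows "(\<integral>\<^sup>+y\<in>{0<..}. ennreal (y powr c * exp (- l * y)) * ennreal (bessel_I a (2 * sqrt (A * y))) \<partial>lborel)
    = (\<Sum>m. ennreal (A powr (a / 2 + real m) * bessel_term a m
        * (Gamma (c + a / 2 + real m + 1) / l powr (c + a / 2 + real m + 1))))"
proof -
  have "(\<integral>\<^sup>+y\<in>{0<..}. ennreal (y powr c * exp (- l * y)) * ennreal (bessel_I a (2 * sqrt (A * y))) \<partial>lborel)
    = (\<integral>\<^sup>+y. (\<Sum>m. ennreal (A powr (a / 2 + real m) * bessel_term a m)
        * (ennreal (y powr (c + a / 2 + real m) * exp (- l * y)) * indicator {0<..} y)) \<partial>lborel)"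
  proof (rule nn_integral_cong)
    fix y :: real
    have "ennreal (y powr c * exp (- l * y)) * ennreal (bessel_I a (2 * sqrt (A * y)))
      = (\<Sum>m. ennreal (A powr (a / 2 + real m) * bessel_term a m)
        * ennreal (y powr (c + a / 2 + real m) * exp (- l * y)))" if "0 < y"
    proof -
      have "ennreal (y powr c * exp (- l * y)) * ennreal (bessel_I a (2 * sqrt (A * y)))
        = (\<Sum>m. ennreal (y powr c * exp (- l * y))
            * ennreal ((A * y) powr (a / 2 + real m) * bessel_term a m))"
        using that A by (subst ennreal_bessel_I[OF a]) auto
      also have "\<dots> = (\<Sum>m. ennreal (A powr (a / 2 + real m) * bessel_term a m)
        * ennreal (y powr (c + a / 2 + real m) * exp (- l * y)))"
        using that A bessel_term_pos[OF a]
        by (intro suminf_cong) (simp add: ennreal_mult[symmetric] less_imp_le powr_mult powr_add mult_ac)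
      finally show ?thesis .
    qed
    then show "ennreal (y powr c * exp (- l * y)) * ennreal (bessel_I a (2 * sqrt (A * y))) * indicator {0<..} y
      = (\<Sum>m. ennreal (A powr (a / 2 + real m) * bessel_term a m)
        * (ennreal (y powr (c + a / 2 + real m) * exp (- l * y)) * indicator {0<..} y))"
      by (cases "0 < y") (simp_all del: ennreal_suminf_cmult)
  qed
  also have "\<dots> = (\<Sum>m. \<integral>\<^sup>+y. ennreal (A powr (a / 2 + real m) * bessel_term a m)
        * (ennreal (y powr (c + a / 2 + real m) * exp (- l * y)) * indicator {0<..} y) \<partial>lborel)"
    by (rule nn_integral_suminf) measurable
  also have "\<dots> = (\<Sum>m. ennreal (A powr (a / 2 + real m) * bessel_term a m
        * (Gamma (c + a / 2 + real m + 1) / l powr (c + a / 2 + real m + 1))))"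
  proof (rule suminf_cong)
    fix m
    have "(\<integral>\<^sup>+y. ennreal (A powr (a / 2 + real m) * bessel_term a m)
        * (ennreal (y powr (c + a / 2 + real m) * exp (- l * y)) * indicator {0<..} y) \<partial>lborel)
      = ennreal (A powr (a / 2 + real m) * bessel_term a m)
        * (\<integral>\<^sup>+y\<in>{0<..}. ennreal (y powr (c + a / 2 + real m) * exp (- l * y)) \<partial>lborel)"
      by (rule nn_integral_cmult) measurable
    also have "\<dots> = ennreal (A powr (a / 2 + real m) * bessel_term a m)
        * ennreal (Gamma (c + a / 2 + real m + 1) / l powr (c + a / 2 + real m + 1))"
      using a c l by (subst nn_integral_powr_exp) auto
    finally show "(\<integral>\<^sup>+y. ennreal (A powr (a / 2 + real m) * bessel_term a m)
        * (ennreal (y powr (c + a / 2 + real m) * exp (- l * y)) * indicator {0<..} y) \<partial>lborel)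
      = ennreal (A powr (a / 2 + real m) * bessel_term a m
        * (Gamma (c + a / 2 + real m + 1) / l powr (c + a / 2 + real m + 1)))"
      using bessel_term_pos[OF a, of m] a c
      by (simp add: ennreal_mult[symmetric] Gamma_real_nonneg)
  qed
  finally show ?thesis .
qed

text \<open>The weight \<open>y powr (a / 2)\<close> raises the Gamma argument to exactly
  \<open>a + real m + 1\<close>, which cancels the Gamma factor of \<open>bessel_term\<close>; an
  exponential series remains.\<close>

lemma nn_integral_powr_half_exp_bessel:
  assumes a: "0 \<le> a" and A: "0 < A" and l: "0 < l"
  shows "(\<integral>\<^sup>+y\<in>{0<..}. ennreal (y powr (a / 2) * exp (- l * y)) * ennreal (bessel_I a (2 * sqrt (A * y))) \<partial>lborel)
    = ennreal (A powr (a / 2) / l powr (a + 1) * exp (A / l))"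
proof -
  define C where "C = A powr (a / 2) / l powr (a + 1)"
  have C: "0 \<le> C" by (simp add: C_def)
  have eq: "A powr (a / 2 + real m) * bessel_term a m
      * (Gamma (a / 2 + a / 2 + real m + 1) / l powr (a / 2 + a / 2 + real m + 1)) = C * ((A / l) ^ m / fact m)" for m
  proof -
    have "Gamma (a + real m + 1) \<noteq> 0"
      using Gamma_add_nat_pos[OF a, of m] by simp
    moreover have "A powr (a / 2 + real m) = A powr (a / 2) * A ^ m"
      using A by (simp add: powr_add powr_realpow)
    moreover have "l powr (a + real m + 1) = l powr (a + 1) * l ^ m"
      using l by (simp add: powr_add powr_realpow)
    ultimately show ?thesis
      by (simp add: C_def bessel_term_def power_divide)
  qed
  have "(\<integral>\<^sup>+y\<in>{0<..}. ennreal (y powr (a / 2) * exp (- l * y)) * ennreal (bessel_I a (2 * sqrt (A * y))) \<partial>lborel)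
    = (\<Sum>m. ennreal (C * ((A / l) ^ m / fact m)))"
    unfolding eq[symmetric] using a by (intro nn_integral_powr_exp_bessel A l) simp_all
  also have "\<dots> = ennreal (C * exp (A / l))"
    using C A l by (simp only: ennreal_mult' ennreal_suminf_cmult suminf_ennreal_exp divide_nonneg_nonneg less_imp_le)
  finally show ?thesis
    by (simp only: C_def)
qed

text \<open>Writing the quotient of Gamma values as a Beta integral turns the series into an exponential;
  replacing a factor \<open>(1 - v)\<^sup>b \<le> 1\<close> then leaves an Euler integral.\<close>

lemma suminf_Gamma_ratio_le:
  assumes b: "0 \<le> b" and w: "0 < w"
  shows "(\<Sum>m. ennreal (w powr (b + real m) * bessel_term (2 * b) m * Gamma (b + real m + 1))) \<le> ennreal (exp w)"
\<comment> \<open>The Beta integral contains the exponent \<open>b - 1\<close>, so it diverges for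
  \<open>b = 0\<close>; there the Gamma quotient is 1 and the series is exactly
  \<open>exp w\<close>.\<close>
proof (cases "b = 0")
  case True
  have "w powr (b + real m) * bessel_term (2 * b) m * Gamma (b + real m + 1) = w ^ m / fact m" for m
    using True w Gamma_fact[of m, where ?'a = real] by (simp add: bessel_term_def powr_realpow add.commute)
  then show ?thesis
    using w by (simp add: suminf_ennreal_exp)
next
  case False
  with b have b: "0 < b" by simp
  let ?B = "\<lambda>m v. v powr (b - 1) * (1 - v) powr (b + real m)"
  have repr: "ennreal (w powr (b + real m) * bessel_term (2 * b) m * Gamma (b + real m + 1))
      = (\<integral>\<^sup>+v. ennreal (w powr b / Gamma b) * (ennreal (w ^ m / fact m * ?B m v) * indicator {0..1} v) \<partial>lborel)" for m
  proof -
    have *: "(?B m has_integral Beta b (b + real m + 1)) {0..1}"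
      using has_integral_Beta_real[of b "b + real m + 1"] b by simp
    have eq: "ennreal (Beta b (b + real m + 1)) = (\<integral>\<^sup>+v. ennreal (?B m v) * indicator {0..1} v \<partial>lborel)"
      by (rule nn_integral_has_integral_lebesgue'[OF _ *, symmetric]) simp
    define q where "q = w powr b / Gamma b * (w ^ m / fact m)"
    have q: "0 \<le> q"
      using w b by (simp add: q_def Gamma_real_nonneg)
    have "Gamma (b + (b + real m + 1)) = Gamma (2 * b + real m + 1)"
      by (rule arg_cong[of _ _ Gamma]) simp
    then have "w powr (b + real m) * bessel_term (2 * b) m * Gamma (b + real m + 1)
        = q * Beta b (b + real m + 1)"
      using w Gamma_real_pos[OF b] by (simp add: q_def bessel_term_def Beta_def powr_add powr_realpow)
    then have "ennreal (w powr (b + real m) * bessel_term (2 * b) m * Gamma (b + real m + 1))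
        = ennreal q * (\<integral>\<^sup>+v. ennreal (?B m v) * indicator {0..1} v \<partial>lborel)"
      unfolding eq[symmetric] using q by (simp only: ennreal_mult')
    also have "\<dots> = (\<integral>\<^sup>+v. ennreal q * (ennreal (?B m v) * indicator {0..1} v) \<partial>lborel)"
      by (rule nn_integral_cmult[symmetric]) measurable
    also have "\<dots> = (\<integral>\<^sup>+v. ennreal (w powr b / Gamma b)
        * (ennreal (w ^ m / fact m * ?B m v) * indicator {0..1} v) \<partial>lborel)"
    proof (rule nn_integral_cong)
      fix v :: real
      have "ennreal q * ennreal (?B m v) = ennreal (w powr b / Gamma b) * ennreal (w ^ m / fact m * ?B m v)"
        unfolding q_def using w b
        by (subst (1 2) ennreal_mult[symmetric]) (simp_all add: Gamma_real_nonneg mult.assoc)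
      then show "ennreal q * (ennreal (?B m v) * indicator {0..1} v) = ennreal (w powr b / Gamma b)
        * (ennreal (w ^ m / fact m * ?B m v) * indicator {0..1} v)"
        by (simp only: mult.assoc[symmetric])
    qed
    finally show ?thesis .
  qed
  have "(\<Sum>m. ennreal (w powr (b + real m) * bessel_term (2 * b) m * Gamma (b + real m + 1)))
     = (\<integral>\<^sup>+v. (\<Sum>m. ennreal (w powr b / Gamma b) * (ennreal (w ^ m / fact m * ?B m v) * indicator {0..1} v)) \<partial>lborel)"
    unfolding repr by (rule nn_integral_suminf[symmetric]) measurable
  \<comment> \<open>The right-hand side also extends the integration from (0, 1) to the half-line;
    the value \<open>Gamma b / w powr b\<close> of that integral then cancels the prefactor and
    leaves \<open>exp w\<close>.\<close>
  also have "\<dots> \<le> (\<integral>\<^sup>+v. ennreal (w powr b * exp w / Gamma b)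
      * (ennreal (v powr (b - 1) * exp (- w * v)) * indicator {0<..} v) \<partial>lborel)"
  proof (rule nn_integral_mono)
    fix v :: real
    show "(\<Sum>m. ennreal (w powr b / Gamma b) * (ennreal (w ^ m / fact m * ?B m v) * indicator {0..1} v))
        \<le> ennreal (w powr b * exp w / Gamma b) * (ennreal (v powr (b - 1) * exp (- w * v)) * indicator {0<..} v)"
    proof (cases "0 < v \<and> v < 1")
      case True
      have "(\<Sum>m. ennreal (w ^ m / fact m * ?B m v))
          = (\<Sum>m. ennreal (v powr (b - 1) * (1 - v) powr b) * ennreal ((w * (1 - v)) ^ m / fact m))"
        using True w by (intro suminf_cong) (simp add: ennreal_mult[symmetric] powr_add powr_realpow
            power_mult_distrib mult_ac)
      also have "\<dots> = ennreal (v powr (b - 1) * (1 - v) powr b) * ennreal (exp (w * (1 - v)))"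
        using True w by (simp add: suminf_ennreal_exp)
      also have "exp (w * (1 - v)) = exp w * exp (- w * v)"
        using exp_add[of w "- w * v"] by (simp add: algebra_simps)
      also have "ennreal (v powr (b - 1) * (1 - v) powr b) * ennreal (exp w * exp (- w * v))
          = ennreal ((1 - v) powr b * (exp w * (v powr (b - 1) * exp (- w * v))))"
        by (simp add: ennreal_mult[symmetric] mult_ac)
      also have "\<dots> \<le> ennreal (1 * (exp w * (v powr (b - 1) * exp (- w * v))))"
        using True b by (intro ennreal_leI mult_right_mono powr_le1) auto
      finally have "ennreal (w powr b / Gamma b) * (\<Sum>m. ennreal (w ^ m / fact m * ?B m v))
          \<le> ennreal (w powr b / Gamma b) * ennreal (exp w * (v powr (b - 1) * exp (- w * v)))"
        by (intro mult_left_mono) auto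
      then show ?thesis
        using True b by (simp add: ennreal_mult[symmetric] Gamma_real_nonneg mult_ac)
    next
      case False
      \<comment> \<open>At the endpoints 0 and 1 the convention \<open>0 powr x = 0\<close> makes
        \<open>?B m v\<close> vanish, even where \<open>b - 1\<close> is negative.\<close>
      then have "?B m v = 0 \<or> v < 0 \<or> 1 < v" for m
        by auto
      then have "ennreal (w ^ m / fact m * ?B m v) * indicator {0..1} v = 0" for m
        by (auto simp: indicator_def)
      then show ?thesis
        by (simp only: mult_zero_right suminf_zero) simp
    qed
  qed
  also have "\<dots> = ennreal (w powr b * exp w / Gamma b) * ennreal (Gamma b / w powr b)"
    using nn_integral_powr_exp[of "b - 1" w] b w by (subst nn_integral_cmult) auto
  also have "\<dots> = ennreal (exp w)"
  proof -
    have "Gamma b \<noteq> 0" using Gamma_real_pos[OF b] by linarith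
    then show ?thesis
      using b w by (simp add: ennreal_mult[symmetric] Gamma_real_nonneg)
  qed
  finally show ?thesis .
qed

text \<open>Termwise integration leaves the Gamma quotients of \<open>suminf_Gamma_ratio_le\<close>
  with \<open>b = a / 2\<close> and \<open>w = A / l\<close>. The bound, which is the exact value
  for \<open>a = 0\<close>, is uniform in a.\<close>

lemma nn_integral_exp_bessel_le:
  assumes a: "0 \<le> a" and A: "0 < A" and l: "0 < l"
  shows "(\<integral>\<^sup>+y\<in>{0<..}. ennreal (exp (- l * y)) * ennreal (bessel_I a (2 * sqrt (A * y))) \<partial>lborel)
    \<le> ennreal (1 / l * exp (A / l))"
proof -
  have "(\<integral>\<^sup>+y\<in>{0<..}. ennreal (exp (- l * y)) * ennreal (bessel_I a (2 * sqrt (A * y))) \<partial>lborel)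
      = (\<integral>\<^sup>+y\<in>{0<..}. ennreal (y powr 0 * exp (- l * y)) * ennreal (bessel_I a (2 * sqrt (A * y))) \<partial>lborel)"
    by (intro nn_integral_cong) (simp add: indicator_def)
  also have "\<dots> = (\<Sum>m. ennreal (A powr (a / 2 + real m) * bessel_term a m
        * (Gamma (0 + a / 2 + real m + 1) / l powr (0 + a / 2 + real m + 1))))"
    using a A l by (intro nn_integral_powr_exp_bessel) auto
  also have "\<dots> = (\<Sum>m. ennreal (1 / l) * ennreal ((A / l) powr (a / 2 + real m) * bessel_term (2 * (a / 2)) m
        * Gamma (a / 2 + real m + 1)))"
  proof (rule suminf_cong)
    fix m
    have "A powr (a / 2 + real m) * bessel_term a m
        * (Gamma (0 + a / 2 + real m + 1) / l powr (0 + a / 2 + real m + 1))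
      = 1 / l * ((A / l) powr (a / 2 + real m) * bessel_term (2 * (a / 2)) m * Gamma (a / 2 + real m + 1))"
      using A l by (simp add: powr_divide powr_add)
    then show "ennreal (A powr (a / 2 + real m) * bessel_term a m
        * (Gamma (0 + a / 2 + real m + 1) / l powr (0 + a / 2 + real m + 1)))
      = ennreal (1 / l) * ennreal ((A / l) powr (a / 2 + real m) * bessel_term (2 * (a / 2)) m
        * Gamma (a / 2 + real m + 1))"
      using l by (simp only:) (rule ennreal_mult', simp)
  qed
  also have "\<dots> \<le> ennreal (1 / l) * ennreal (exp (A / l))"
    unfolding ennreal_suminf_cmult using a A l by (intro mult_left_mono suminf_Gamma_ratio_le) auto
  also have "\<dots> = ennreal (1 / l * exp (A / l))"
    using l by (simp add: ennreal_mult[symmetric])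
  finally show ?thesis .
qed

text \<open>Chu--Vandermonde, \<open>(\<Sum>k. (m choose k) * (a + n choose n - k)) = (a + m + n
  choose n)\<close>, divided by \<open>fact m * Gamma (a + n + 1)\<close>. The right side is the
  coefficient produced by integrating a product of two Bessel series term by term; the left side is
  the coefficient of a product of two exponentials with one Bessel series.\<close>

lemma bessel_term_Vandermonde:
  assumes a: "0 \<le> a"
  shows "(\<Sum>k\<le>n. if k \<le> m then bessel_term a k / (fact (m - k) * fact (n - k)) else 0)
    = bessel_term a m * bessel_term a n * Gamma (a + real m + real n + 1)"
proof -
  have pos: "0 < Gamma (a + real i + 1)" for i
    by (rule Gamma_add_nat_pos[OF a])
  have nonpos: "a + real i + 1 \<notin> \<int>\<^sub>\<le>\<^sub>0" for i
    using a by (auto elim!: nonpos_Ints_cases)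
  have "(\<Sum>k\<le>n. if k \<le> m then bessel_term a k / (fact (m - k) * fact (n - k)) else 0)
      = (\<Sum>k\<in>{0..n}. 1 / (fact m * Gamma (a + real n + 1))
          * ((real m gchoose k) * ((a + real n) gchoose (n - k))))"
  proof (rule sum.cong)
    fix k assume "k \<in> {0..n}"
    then have k: "k \<le> n" by simp
    show "(if k \<le> m then bessel_term a k / (fact (m - k) * fact (n - k)) else 0)
      = 1 / (fact m * Gamma (a + real n + 1)) * ((real m gchoose k) * ((a + real n) gchoose (n - k)))"
    proof (cases "k \<le> m")
      case True
      have "(real m gchoose k) = fact m / (fact k * fact (m - k))"
        using True binomial_gbinomial[of m k, where ?'a = real] by (simp add: binomial_fact)
      moreover have "((a + real n) gchoose (n - k)) = Gamma (a + real n + 1) / (fact (n - k) * Gamma (a + real k + 1))"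
        using gbinomial_Gamma[OF nonpos, of n "n - k"] k by (simp add: of_nat_diff algebra_simps)
      ultimately show ?thesis
        using pos[of n] True by (simp add: bessel_term_def)
    next
      case False
      \<comment> \<open>The vanishing binomial coefficient matches the \<open>if\<close>, which is
        there because \<open>m - k\<close> is truncated subtraction.\<close>
      then have "real m gchoose k = 0"
        by (metis binomial_eq_0 binomial_gbinomial not_le of_nat_0)
      then show ?thesis using False by simp
    qed
  qed auto
  also have "\<dots> = 1 / (fact m * Gamma (a + real n + 1)) * ((real m + (a + real n)) gchoose n)"
    by (simp only: sum_distrib_left[symmetric] gbinomial_Vandermonde)
  also have "((real m + (a + real n)) gchoose n) = Gamma (a + real m + real n + 1) / (fact n * Gamma (a + real m + 1))"
    using gbinomial_Gamma[OF nonpos, of "m + n" n] by (simp add: algebra_simps)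
  finally show ?thesis
    by (simp add: bessel_term_def)
qed

text \<open>After scaling by p this is an identity of double series in \<open>\<alpha>\<close> and
  \<open>\<beta>\<close>, compared coefficient by coefficient through
  \<open>bessel_term_Vandermonde\<close>. All terms are nonnegative, so the resulting triple series
  may be summed in any order.\<close>

lemma Weber_second_exponential_integral:
  assumes a: "0 \<le> a" and A: "0 < A" and B: "0 < B" and p: "0 < p"
  shows "(\<integral>\<^sup>+z\<in>{0<..}. ennreal (exp (- p * z)) * ennreal (bessel_I a (2 * sqrt (A * z)))
        * ennreal (bessel_I a (2 * sqrt (B * z))) \<partial>lborel)
    = ennreal (1 / p * exp ((A + B) / p) * bessel_I a (2 * sqrt (A * B / p\<^sup>2)))"
proof -
  define \<alpha> \<beta> where "\<alpha> = A / p" and "\<beta> = B / p"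
  have pos: "0 < \<alpha>" "0 < \<beta>" using A B p by (auto simp: \<alpha>_def \<beta>_def)
  note bp = bessel_term_pos[OF a]
  let ?G = "\<lambda>m n. \<alpha> powr (a / 2 + real m) * \<beta> powr (a / 2 + real n)
      * (bessel_term a m * bessel_term a n * Gamma (a + real m + real n + 1))"
  have "(\<integral>\<^sup>+z\<in>{0<..}. ennreal (exp (- p * z)) * ennreal (bessel_I a (2 * sqrt (A * z)))
        * ennreal (bessel_I a (2 * sqrt (B * z))) \<partial>lborel)
    = (\<integral>\<^sup>+z. (\<Sum>n. ennreal (B powr (a / 2 + real n) * bessel_term a n)
        * (ennreal (z powr (a / 2 + real n) * exp (- p * z)) * ennreal (bessel_I a (2 * sqrt (A * z)))
            * indicator {0<..} z)) \<partial>lborel)"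
  proof (rule nn_integral_cong)
    fix z :: real
    show "ennreal (exp (- p * z)) * ennreal (bessel_I a (2 * sqrt (A * z)))
        * ennreal (bessel_I a (2 * sqrt (B * z))) * indicator {0<..} z
      = (\<Sum>n. ennreal (B powr (a / 2 + real n) * bessel_term a n)
        * (ennreal (z powr (a / 2 + real n) * exp (- p * z)) * ennreal (bessel_I a (2 * sqrt (A * z)))
            * indicator {0<..} z))"
    proof (cases "0 < z")
      case True
      have "ennreal (exp (- p * z)) * ennreal (bessel_I a (2 * sqrt (A * z)))
          * ennreal (bessel_I a (2 * sqrt (B * z)))
        = (\<Sum>n. ennreal (exp (- p * z)) * ennreal (bessel_I a (2 * sqrt (A * z)))
          * ennreal ((B * z) powr (a / 2 + real n) * bessel_term a n))"
        using True B by (subst ennreal_bessel_I(1)[OF a, of "B * z"]) auto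
      also have "\<dots> = (\<Sum>n. ennreal (B powr (a / 2 + real n) * bessel_term a n)
        * (ennreal (z powr (a / 2 + real n) * exp (- p * z)) * ennreal (bessel_I a (2 * sqrt (A * z)))))"
      proof (rule suminf_cong)
        fix n
        have rearrange: "x * y * z = u * (v * y)" if "x * z = u * v" for x y z u v :: ennreal
          using that by (simp only: mult.assoc[symmetric] flip: that) (simp only: mult_ac)
        have "ennreal (exp (- p * z)) * ennreal ((B * z) powr (a / 2 + real n) * bessel_term a n)
          = ennreal (B powr (a / 2 + real n) * bessel_term a n) * ennreal (z powr (a / 2 + real n) * exp (- p * z))"
          using True B bp[of n] by (simp add: ennreal_mult[symmetric] powr_mult mult_ac)
        then show "ennreal (exp (- p * z)) * ennreal (bessel_I a (2 * sqrt (A * z)))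
            * ennreal ((B * z) powr (a / 2 + real n) * bessel_term a n)
          = ennreal (B powr (a / 2 + real n) * bessel_term a n)
            * (ennreal (z powr (a / 2 + real n) * exp (- p * z)) * ennreal (bessel_I a (2 * sqrt (A * z))))"
          by (rule rearrange)
      qed
      finally show ?thesis
        using True by (simp del: ennreal_suminf_cmult)
    qed simp
  qed
  also have "\<dots> = (\<Sum>n. \<integral>\<^sup>+z. ennreal (B powr (a / 2 + real n) * bessel_term a n)
        * (ennreal (z powr (a / 2 + real n) * exp (- p * z)) * ennreal (bessel_I a (2 * sqrt (A * z)))
            * indicator {0<..} z) \<partial>lborel)"
    by (rule nn_integral_suminf) measurable
  \<comment> \<open>Only the Bessel factor with B has been expanded so far; integrating its n-th
    term against the other factor produces the series in m.\<close>
  also have "\<dots> = (\<Sum>n. \<Sum>m. ennreal (1 / p) * ennreal (?G m n))"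
  proof (rule suminf_cong)
    fix n
    have "(\<integral>\<^sup>+z. ennreal (B powr (a / 2 + real n) * bessel_term a n)
        * (ennreal (z powr (a / 2 + real n) * exp (- p * z)) * ennreal (bessel_I a (2 * sqrt (A * z)))
            * indicator {0<..} z) \<partial>lborel)
      = ennreal (B powr (a / 2 + real n) * bessel_term a n)
        * (\<integral>\<^sup>+z\<in>{0<..}. ennreal (z powr (a / 2 + real n) * exp (- p * z))
          * ennreal (bessel_I a (2 * sqrt (A * z))) \<partial>lborel)"
      by (rule nn_integral_cmult) measurable
    also have "\<dots> = ennreal (B powr (a / 2 + real n) * bessel_term a n)
        * (\<Sum>m. ennreal (A powr (a / 2 + real m) * bessel_term a m
        * (Gamma (a / 2 + real n + a / 2 + real m + 1) / p powr (a / 2 + real n + a / 2 + real m + 1))))"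
      using a A p by (subst nn_integral_powr_exp_bessel) auto
    also have "\<dots> = (\<Sum>m. ennreal (B powr (a / 2 + real n) * bessel_term a n)
        * ennreal (A powr (a / 2 + real m) * bessel_term a m
        * (Gamma (a / 2 + real n + a / 2 + real m + 1) / p powr (a / 2 + real n + a / 2 + real m + 1))))"
      by simp
    also have "\<dots> = (\<Sum>m. ennreal (1 / p) * ennreal (?G m n))"
    proof (rule suminf_cong)
      fix m
      have g: "0 \<le> Gamma (a + real m + real n + 1)"
        using a by (auto intro: Gamma_real_nonneg)
      have e: "a / 2 + real n + a / 2 + real m + 1 = a + real m + real n + 1" by simp
      \<comment> \<open>The exponent splits between the powers of \<open>A / p\<close> and
        \<open>B / p\<close>; the remaining 1 is the factor \<open>1 / p\<close>.\<close>
      have "p powr (a + real m + real n + 1) = p * (p powr (a / 2 + real m) * p powr (a / 2 + real n))"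
        using p by (simp add: powr_add[symmetric] powr_mult_base add_ac)
      then have "B powr (a / 2 + real n) * bessel_term a n
        * (A powr (a / 2 + real m) * bessel_term a m
        * (Gamma (a / 2 + real n + a / 2 + real m + 1) / p powr (a / 2 + real n + a / 2 + real m + 1)))
        = 1 / p * ?G m n"
        unfolding e using A B p by (simp add: \<alpha>_def \<beta>_def powr_divide)
      then show "ennreal (B powr (a / 2 + real n) * bessel_term a n)
        * ennreal (A powr (a / 2 + real m) * bessel_term a m
        * (Gamma (a / 2 + real n + a / 2 + real m + 1) / p powr (a / 2 + real n + a / 2 + real m + 1)))
        = ennreal (1 / p) * ennreal (?G m n)"
        using p bp[of n] by (simp only: ennreal_mult'[symmetric] less_imp_le powr_ge_zero mult_nonneg_nonneg
            divide_nonneg_nonneg zero_le_one)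
    qed
    finally show "(\<integral>\<^sup>+z. ennreal (B powr (a / 2 + real n) * bessel_term a n)
        * (ennreal (z powr (a / 2 + real n) * exp (- p * z)) * ennreal (bessel_I a (2 * sqrt (A * z)))
            * indicator {0<..} z) \<partial>lborel) = (\<Sum>m. ennreal (1 / p) * ennreal (?G m n))" .
  qed
  also have "\<dots> = ennreal (1 / p) * (\<Sum>n. \<Sum>m. ennreal (?G m n))"
    by simp
  also have "(\<Sum>n. \<Sum>m. ennreal (?G m n)) = (\<Sum>n. \<Sum>m. \<Sum>k. if k \<le> m \<and> k \<le> n then
      ennreal (\<alpha> powr (a / 2 + real m) * \<beta> powr (a / 2 + real n) * (bessel_term a k / (fact (m - k) * fact (n - k)))) else 0)"
  proof (intro suminf_cong)
    fix n m
    have "(\<Sum>k. if k \<le> m \<and> k \<le> n then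
        ennreal (\<alpha> powr (a / 2 + real m) * \<beta> powr (a / 2 + real n) * (bessel_term a k / (fact (m - k) * fact (n - k)))) else 0)
      = (\<Sum>k\<le>n. if k \<le> m \<and> k \<le> n then
        ennreal (\<alpha> powr (a / 2 + real m) * \<beta> powr (a / 2 + real n) * (bessel_term a k / (fact (m - k) * fact (n - k)))) else 0)"
      by (intro suminf_finite) auto
    also have "\<dots> = (\<Sum>k\<le>n. ennreal (\<alpha> powr (a / 2 + real m) * \<beta> powr (a / 2 + real n) *
        (if k \<le> m then bessel_term a k / (fact (m - k) * fact (n - k)) else 0)))"
      by (intro sum.cong) auto
    also have "\<dots> = ennreal (\<Sum>k\<le>n. \<alpha> powr (a / 2 + real m) * \<beta> powr (a / 2 + real n) *
        (if k \<le> m then bessel_term a k / (fact (m - k) * fact (n - k)) else 0))"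
      using less_imp_le[OF bp] by (intro sum_ennreal) auto
    also have "\<dots> = ennreal (?G m n)"
      by (simp only: sum_distrib_left[symmetric] bessel_term_Vandermonde[OF a])
    finally show "ennreal (?G m n) = (\<Sum>k. if k \<le> m \<and> k \<le> n then
        ennreal (\<alpha> powr (a / 2 + real m) * \<beta> powr (a / 2 + real n) * (bessel_term a k / (fact (m - k) * fact (n - k)))) else 0)" ..
  qed
  \<comment> \<open>With k outermost, shifting m and n by k decouples the inner sums into two
    exponential series.\<close>
  also have "\<dots> = (\<Sum>k. \<Sum>m. \<Sum>n. if k \<le> m \<and> k \<le> n then
      ennreal (\<alpha> powr (a / 2 + real m) * \<beta> powr (a / 2 + real n) * (bessel_term a k / (fact (m - k) * fact (n - k)))) else 0)"
    (is "(\<Sum>n. \<Sum>m. \<Sum>k. ?H n m k) = _")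
  proof -
    have "(\<Sum>n. \<Sum>m. \<Sum>k. ?H n m k) = (\<Sum>n. \<Sum>k. \<Sum>m. ?H n m k)"
      by (intro suminf_cong suminf_swap_ennreal)
    also have "\<dots> = (\<Sum>k. \<Sum>n. \<Sum>m. ?H n m k)"
      by (rule suminf_swap_ennreal)
    also have "\<dots> = (\<Sum>k. \<Sum>m. \<Sum>n. ?H n m k)"
      by (intro suminf_cong suminf_swap_ennreal)
    finally show ?thesis .
  qed
  also have "\<dots> = (\<Sum>k. ennreal (exp \<alpha>) * ennreal (exp \<beta>) * ennreal ((\<alpha> * \<beta>) powr (a / 2 + real k) * bessel_term a k))"
  proof (rule suminf_cong)
    fix k
    have inner: "(\<Sum>n. if k \<le> n then ennreal (c * \<beta> powr (a / 2 + real n) / fact (n - k)) else 0)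
        = ennreal (c * \<beta> powr (a / 2 + real k) * exp \<beta>)" if "0 \<le> c" for c
    proof -
      have "(\<Sum>n. if k \<le> n then ennreal (c * \<beta> powr (a / 2 + real n) / fact (n - k)) else 0)
         = (\<Sum>i. ennreal (c * \<beta> powr (a / 2 + real (i + k)) / fact (i + k - k)))"
        by (rule suminf_shift_ennreal[symmetric])
      also have "\<dots> = (\<Sum>i. ennreal (c * \<beta> powr (a / 2 + real k)) * ennreal (\<beta> ^ i / fact i))"
        using that pos by (intro suminf_cong) (simp add: ennreal_mult[symmetric] powr_add powr_realpow mult_ac)
      also have "\<dots> = ennreal (c * \<beta> powr (a / 2 + real k) * exp \<beta>)"
        using that pos by (simp add: suminf_ennreal_exp ennreal_mult)
      finally show ?thesis .
    qed
    have "(\<Sum>n. ?H n m k) = (if k \<le> m then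
        ennreal (bessel_term a k * \<beta> powr (a / 2 + real k) * exp \<beta> * \<alpha> powr (a / 2 + real m) / fact (m - k)) else 0)" for m
    proof (cases "k \<le> m")
      case True
      have "(\<Sum>n. ?H n m k) = (\<Sum>n. if k \<le> n then
          ennreal (\<alpha> powr (a / 2 + real m) * bessel_term a k / fact (m - k) * \<beta> powr (a / 2 + real n) / fact (n - k)) else 0)"
        using True by (intro suminf_cong) (auto simp: mult_ac)
      also have "\<dots> = ennreal (\<alpha> powr (a / 2 + real m) * bessel_term a k / fact (m - k) * \<beta> powr (a / 2 + real k) * exp \<beta>)"
        using bp[of k] by (intro inner) auto
      finally show ?thesis using True by (simp add: mult_ac)
    qed simp
    then have "(\<Sum>m. \<Sum>n. ?H n m k) = (\<Sum>m. if k \<le> m then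
        ennreal (bessel_term a k * \<beta> powr (a / 2 + real k) * exp \<beta> * \<alpha> powr (a / 2 + real m) / fact (m - k)) else 0)"
      by simp
    also have "\<dots> = (\<Sum>i. ennreal (bessel_term a k * \<beta> powr (a / 2 + real k) * exp \<beta> * \<alpha> powr (a / 2 + real (i + k)) / fact (i + k - k)))"
      by (rule suminf_shift_ennreal[symmetric])
    also have "\<dots> = (\<Sum>i. ennreal (bessel_term a k * \<beta> powr (a / 2 + real k) * exp \<beta> * \<alpha> powr (a / 2 + real k)) * ennreal (\<alpha> ^ i / fact i))"
      using bp[of k] pos by (intro suminf_cong) (simp add: ennreal_mult[symmetric] powr_add powr_realpow mult_ac)
    also have "\<dots> = ennreal (bessel_term a k * \<beta> powr (a / 2 + real k) * exp \<beta> * \<alpha> powr (a / 2 + real k)) * ennreal (exp \<alpha>)"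
      using pos by (simp add: suminf_ennreal_exp)
    also have "\<dots> = ennreal (exp \<alpha>) * ennreal (exp \<beta>) * ennreal ((\<alpha> * \<beta>) powr (a / 2 + real k) * bessel_term a k)"
      using bp[of k] pos by (simp add: ennreal_mult[symmetric] powr_mult mult_ac)
    finally show "(\<Sum>m. \<Sum>n. ?H n m k)
      = ennreal (exp \<alpha>) * ennreal (exp \<beta>) * ennreal ((\<alpha> * \<beta>) powr (a / 2 + real k) * bessel_term a k)" .
  qed
  also have "\<dots> = ennreal (exp \<alpha>) * ennreal (exp \<beta>) * ennreal (bessel_I a (2 * sqrt (\<alpha> * \<beta>)))"
    using pos by (simp add: ennreal_bessel_I(1)[OF a])
  also have "ennreal (1 / p) * \<dots> = ennreal (1 / p * exp (\<alpha> + \<beta>) * bessel_I a (2 * sqrt (\<alpha> * \<beta>)))"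
    using p pos ennreal_bessel_I(2)[OF a, of "\<alpha> * \<beta>"]
    by (simp add: ennreal_mult[symmetric] exp_add mult.assoc)
  finally show ?thesis
    by (simp add: \<alpha>_def \<beta>_def add_divide_distrib power2_eq_square)
qed

section \<open>The one-dimensional Laguerre heat kernel\<close>

definition laguerre_kernel1 :: "real \<Rightarrow> real \<Rightarrow> real \<Rightarrow> real \<Rightarrow> real" where
  "laguerre_kernel1 a t x y = 1 / (2 * sinh (t / 2))
     * exp (- (1 / 2) * (cosh (t / 2) / sinh (t / 2)) * (x + y))
     * bessel_I a (sqrt (x * y) / sinh (t / 2))"

lemma laguerre_kernel1_measurable [measurable]:
  assumes [measurable]: "f \<in> borel_measurable M" "g \<in> borel_measurable M"
  shows "(\<lambda>w. laguerre_kernel1 a t (f w) (g w)) \<in> borel_measurable M"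
  unfolding laguerre_kernel1_def by measurable

lemma laguerre_kernel1_sym: "laguerre_kernel1 a t x y = laguerre_kernel1 a t y x"
  by (simp add: laguerre_kernel1_def mult.commute add.commute)

text \<open>Splits off the part that depends on x alone; the rest has the form
  \<open>exp (- l * y) * bessel_I a (2 * sqrt (A * y))\<close> with
  \<open>l = cosh (t / 2) / (2 * sinh (t / 2))\<close> and
  \<open>A = x / (4 * (sinh (t / 2))\<^sup>2)\<close>, to which the Bessel integrals apply.\<close>

lemma laguerre_kernel1_eq:
  assumes "0 < t"
  shows "laguerre_kernel1 a t x y
    = 1 / (2 * sinh (t / 2)) * exp (- (cosh (t / 2) / (2 * sinh (t / 2))) * x)
      * (exp (- (cosh (t / 2) / (2 * sinh (t / 2))) * y)
        * bessel_I a (2 * sqrt (x / (4 * (sinh (t / 2))\<^sup>2) * y)))"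
proof -
  have s: "0 < sinh (t / 2)" using assms by simp
  have "sqrt (x / (4 * (sinh (t / 2))\<^sup>2) * y) = sqrt ((x * y) / (2 * sinh (t / 2))\<^sup>2)"
    by (simp add: power2_eq_square)
  also have "\<dots> = sqrt (x * y) / (2 * sinh (t / 2))"
    using s by (simp only: real_sqrt_divide real_sqrt_abs)
  finally have "2 * sqrt (x / (4 * (sinh (t / 2))\<^sup>2) * y) = sqrt (x * y) / sinh (t / 2)"
    by simp
  moreover have "exp (- (1 / 2) * (cosh (t / 2) / sinh (t / 2)) * (x + y))
      = exp (- (cosh (t / 2) / (2 * sinh (t / 2))) * x) * exp (- (cosh (t / 2) / (2 * sinh (t / 2))) * y)"
    by (simp add: exp_add[symmetric] distrib_left)
  ultimately show ?thesis
    by (simp add: laguerre_kernel1_def)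
qed

lemma laguerre_kernel1_nonneg:
  assumes "0 \<le> a" "0 < t" "0 < x" "0 < y"
  shows "0 \<le> laguerre_kernel1 a t x y"
proof -
  have "0 \<le> bessel_I a (2 * sqrt (x / (4 * (sinh (t / 2))\<^sup>2) * y))"
    using assms by (intro ennreal_bessel_I(2)) auto
  then show ?thesis
    using assms unfolding laguerre_kernel1_eq[OF assms(2)] by simp
qed

lemma ennreal_laguerre_kernel1:
  assumes "0 \<le> a" "0 < t" "0 < x" "0 < y"
  shows "ennreal (laguerre_kernel1 a t x y)
    = ennreal (1 / (2 * sinh (t / 2)) * exp (- (cosh (t / 2) / (2 * sinh (t / 2))) * x))
      * (ennreal (exp (- (cosh (t / 2) / (2 * sinh (t / 2))) * y))
        * ennreal (bessel_I a (2 * sqrt (x / (4 * (sinh (t / 2))\<^sup>2) * y))))"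
proof -
  have "0 \<le> bessel_I a (2 * sqrt (x / (4 * (sinh (t / 2))\<^sup>2) * y))"
    using assms by (intro ennreal_bessel_I(2)) auto
  then show ?thesis
    using assms unfolding laguerre_kernel1_eq[OF assms(2)] by (simp add: ennreal_mult[symmetric])
qed

text \<open>With \<open>l = c / (2 * s)\<close> and \<open>A = x / (4 * s\<^sup>2)\<close> the
  prefactors combine to \<open>1 / c\<close>, and \<open>c\<^sup>2 = 1 + s\<^sup>2\<close> collapses
  the exponents to \<open>- (s / (2 * c)) * x\<close>, which is negative.\<close>

lemma laguerre_kernel1_mass:
  assumes a: "0 \<le> a" and t: "0 < t" and x: "0 < x"
  shows "(\<integral>\<^sup>+y\<in>{0<..}. ennreal (laguerre_kernel1 a t x y) \<partial>lborel) \<le> ennreal (1 / cosh (t / 2))"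
proof -
  define s c where "s = sinh (t / 2)" and "c = cosh (t / 2)"
  have s: "0 < s" using t by (simp add: s_def)
  have c: "0 < c" by (simp add: c_def)
  have cs: "c\<^sup>2 = 1 + s\<^sup>2" by (simp add: c_def s_def cosh_square_eq add.commute)
  have "(\<integral>\<^sup>+y\<in>{0<..}. ennreal (laguerre_kernel1 a t x y) \<partial>lborel)
    = (\<integral>\<^sup>+y. ennreal (1 / (2 * s) * exp (- (c / (2 * s)) * x)) * (ennreal (exp (- (c / (2 * s)) * y))
        * ennreal (bessel_I a (2 * sqrt (x / (4 * s\<^sup>2) * y))) * indicator {0<..} y) \<partial>lborel)"
    using ennreal_laguerre_kernel1[OF a t x]
    by (intro nn_integral_cong) (auto simp: s_def c_def indicator_def)
  also have "\<dots> = ennreal (1 / (2 * s) * exp (- (c / (2 * s)) * x))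
      * (\<integral>\<^sup>+y\<in>{0<..}. ennreal (exp (- (c / (2 * s)) * y))
        * ennreal (bessel_I a (2 * sqrt (x / (4 * s\<^sup>2) * y))) \<partial>lborel)"
    by (rule nn_integral_cmult) measurable
  also have "\<dots> \<le> ennreal (1 / (2 * s) * exp (- (c / (2 * s)) * x))
      * ennreal (1 / (c / (2 * s)) * exp (x / (4 * s\<^sup>2) / (c / (2 * s))))"
    using a s c x by (intro mult_left_mono nn_integral_exp_bessel_le) auto
  also have "\<dots> = ennreal (1 / c * exp (- (s / (2 * c)) * x))"
  proof -
    have "- (c / (2 * s)) * x + x / (4 * s\<^sup>2) / (c / (2 * s)) = - (s / (2 * c)) * x"
    proof -
      have "- (c / (2 * s)) * x + x / (4 * s\<^sup>2) / (c / (2 * s)) = x * (1 - c\<^sup>2) / (2 * s * c)"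
        using s c by (simp add: field_simps power2_eq_square)
      also have "\<dots> = - (s / (2 * c)) * x"
        using s c unfolding cs by (simp add: field_simps power2_eq_square)
      finally show ?thesis .
    qed
    then have e: "exp (- (c / (2 * s)) * x) * exp (x / (4 * s\<^sup>2) / (c / (2 * s))) = exp (- (s / (2 * c)) * x)"
      by (simp only: exp_add[symmetric])
    have "1 / (2 * s) * exp (- (c / (2 * s)) * x) * (1 / (c / (2 * s)) * exp (x / (4 * s\<^sup>2) / (c / (2 * s))))
      = 1 / (2 * s) * (1 / (c / (2 * s))) * (exp (- (c / (2 * s)) * x) * exp (x / (4 * s\<^sup>2) / (c / (2 * s))))"
      by (simp only: mult_ac)
    also have "\<dots> = 1 / (2 * s) * (1 / (c / (2 * s))) * exp (- (s / (2 * c)) * x)"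
      by (simp only: e)
    also have "1 / (2 * s) * (1 / (c / (2 * s))) = 1 / c"
      using s c by simp
    finally show ?thesis
      using s c by (subst ennreal_mult[symmetric]) auto
  qed
  also have "\<dots> \<le> ennreal (1 / c * 1)"
    using s c x by (intro ennreal_leI mult_left_mono) auto
  finally show ?thesis by (simp add: c_def)
qed

lemma laguerre_kernel1_chapman_kolmogorov:
  assumes a: "0 \<le> a" and s: "0 < s" and t: "0 < t" and x: "0 < x" and y: "0 < y"
  shows "(\<integral>\<^sup>+z\<in>{0<..}. ennreal (laguerre_kernel1 a s x z) * ennreal (laguerre_kernel1 a t z y) \<partial>lborel)
    = ennreal (laguerre_kernel1 a (s + t) x y)"
proof -
  define S P R Q U V where "S = sinh (s / 2)" and "P = cosh (s / 2)"
    and "R = sinh (t / 2)" and "Q = cosh (t / 2)" and "U = sinh ((s + t) / 2)" and "V = cosh ((s + t) / 2)"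
  have pos: "0 < S" "0 < P" "0 < R" "0 < Q" "0 < U"
    using s t by (auto simp: S_def P_def R_def Q_def U_def)
  have P2: "P\<^sup>2 = 1 + S\<^sup>2" and Q2: "Q\<^sup>2 = 1 + R\<^sup>2"
    by (simp_all add: P_def S_def Q_def R_def cosh_square_eq add.commute)
  have U: "U = S * Q + P * R" and V: "V = P * Q + S * R"
    unfolding U_def V_def S_def P_def R_def Q_def add_divide_distrib by (simp_all add: sinh_add cosh_add)
  \<comment> \<open>The sum of the decay rates of the two kernels in z. The addition theorem for
    sinh makes it \<open>U / (2 * S * R)\<close>, so that S and R drop out of
    \<open>A * B / p\<^sup>2\<close>.\<close>
  define p where "p = P / (2 * S) + Q / (2 * R)"
  have p: "p = U / (2 * S * R)"
    using pos by (simp add: p_def U field_simps)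
  have p0: "0 < p" using pos by (simp add: p)
  define A B where "A = x / (4 * S\<^sup>2)" and "B = y / (4 * R\<^sup>2)"
  have AB: "0 < A" "0 < B" using x y pos by (auto simp: A_def B_def)
  let ?c = "1 / (2 * S) * exp (- (P / (2 * S)) * x) * (1 / (2 * R) * exp (- (Q / (2 * R)) * y))"
  have c: "0 \<le> ?c" using pos by simp
  have "(\<integral>\<^sup>+z\<in>{0<..}. ennreal (laguerre_kernel1 a s x z) * ennreal (laguerre_kernel1 a t z y) \<partial>lborel)
    = (\<integral>\<^sup>+z. ennreal ?c * (ennreal (exp (- p * z)) * ennreal (bessel_I a (2 * sqrt (A * z)))
        * ennreal (bessel_I a (2 * sqrt (B * z))) * indicator {0<..} z) \<partial>lborel)"
  proof (rule nn_integral_cong)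
    fix z :: real
    show "ennreal (laguerre_kernel1 a s x z) * ennreal (laguerre_kernel1 a t z y) * indicator {0<..} z
      = ennreal ?c * (ennreal (exp (- p * z)) * ennreal (bessel_I a (2 * sqrt (A * z)))
        * ennreal (bessel_I a (2 * sqrt (B * z))) * indicator {0<..} z)"
    proof (cases "0 < z")
      case True
      have I: "0 \<le> bessel_I a (2 * sqrt (A * z))" "0 \<le> bessel_I a (2 * sqrt (B * z))"
        using True AB by (auto intro!: ennreal_bessel_I(2)[OF a])
      have rearrange: "(c1 * e1 * (f1 * b1)) * (c2 * e2 * (f2 * b2)) = (c1 * e1 * (c2 * e2)) * (f1 * f2) * (b1 * b2)"
        for c1 e1 f1 b1 c2 e2 f2 b2 :: real
        by (simp only: mult_ac)
      have "laguerre_kernel1 a s x z * laguerre_kernel1 a t z y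
        = ?c * (exp (- (P / (2 * S)) * z) * exp (- (Q / (2 * R)) * z))
          * (bessel_I a (2 * sqrt (A * z)) * bessel_I a (2 * sqrt (B * z)))"
        unfolding laguerre_kernel1_sym[of a t z y] laguerre_kernel1_eq[OF s, of a x z] laguerre_kernel1_eq[OF t, of a y z]
          S_def P_def R_def Q_def A_def B_def by (rule rearrange)
      also have "exp (- (P / (2 * S)) * z) * exp (- (Q / (2 * R)) * z) = exp (- p * z)"
        by (simp add: p_def exp_add[symmetric] algebra_simps)
      finally have "laguerre_kernel1 a s x z * laguerre_kernel1 a t z y
        = ?c * (exp (- p * z) * bessel_I a (2 * sqrt (A * z)) * bessel_I a (2 * sqrt (B * z)))"
        by (simp only: mult.assoc)
      moreover have "0 \<le> laguerre_kernel1 a s x z" "0 \<le> laguerre_kernel1 a t z y"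
        using a s t x y True by (auto intro!: laguerre_kernel1_nonneg)
      ultimately have "ennreal (laguerre_kernel1 a s x z) * ennreal (laguerre_kernel1 a t z y)
        = ennreal ?c * (ennreal (exp (- p * z)) * ennreal (bessel_I a (2 * sqrt (A * z)))
          * ennreal (bessel_I a (2 * sqrt (B * z))))"
        using I c by (simp only: ennreal_mult[symmetric] mult_nonneg_nonneg exp_ge_zero)
      then show ?thesis
        using True by simp
    qed simp
  qed
  also have "\<dots> = ennreal ?c * (\<integral>\<^sup>+z\<in>{0<..}. ennreal (exp (- p * z)) * ennreal (bessel_I a (2 * sqrt (A * z)))
        * ennreal (bessel_I a (2 * sqrt (B * z))) \<partial>lborel)"
    by (rule nn_integral_cmult) measurable
  also have "\<dots> = ennreal ?c * ennreal (1 / p * exp ((A + B) / p) * bessel_I a (2 * sqrt (A * B / p\<^sup>2)))"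
    by (simp only: Weber_second_exponential_integral[OF a AB p0])
  also have "\<dots> = ennreal (?c * (1 / p * exp ((A + B) / p) * bessel_I a (2 * sqrt (A * B / p\<^sup>2))))"
    using c by (rule ennreal_mult'[symmetric])
  also have "?c * (1 / p * exp ((A + B) / p) * bessel_I a (2 * sqrt (A * B / p\<^sup>2)))
      = laguerre_kernel1 a (s + t) x y"
  proof -
    have arg: "2 * sqrt (A * B / p\<^sup>2) = sqrt (x * y) / U"
    proof -
      have "A * B / p\<^sup>2 = (x * y) / (2 * U)\<^sup>2"
        using pos unfolding A_def B_def p by (simp add: field_simps power2_eq_square)
      then have "sqrt (A * B / p\<^sup>2) = sqrt (x * y) / (2 * U)"
        using pos by (simp only: real_sqrt_divide real_sqrt_abs)
      then show ?thesis by simp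
    qed
    have pre: "1 / (2 * S) * (1 / (2 * R)) * (1 / p) = 1 / (2 * U)"
      using pos unfolding p by (simp add: field_simps)
    have ex: "- (P / (2 * S)) * x + A / p = - (V / (2 * U)) * x"
    proof -
      \<comment> \<open>This is the subtraction formula for sinh, since
        \<open>t / 2 = (s + t) / 2 - s / 2\<close>.\<close>
      have PU: "P * U - R = S * V"
      proof -
        have "P * U - R = S * P * Q + (P\<^sup>2 - 1) * R"
          by (simp add: U algebra_simps power2_eq_square)
        also have "\<dots> = S * V"
          unfolding P2 V by (simp add: algebra_simps power2_eq_square)
        finally show ?thesis .
      qed
      have "- (P / (2 * S)) * x + A / p = - x * (P * U - R) / (2 * S * U)"
        using pos unfolding A_def p by (simp add: field_simps power2_eq_square)
      also have "\<dots> = - (V / (2 * U)) * x"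
        using pos unfolding PU by (simp add: field_simps)
      finally show ?thesis .
    qed
    have ey: "- (Q / (2 * R)) * y + B / p = - (V / (2 * U)) * y"
    proof -
      have QU: "Q * U - S = R * V"
      proof -
        have "Q * U - S = P * R * Q + (Q\<^sup>2 - 1) * S"
          by (simp add: U algebra_simps power2_eq_square)
        also have "\<dots> = R * V"
          unfolding Q2 V by (simp add: algebra_simps power2_eq_square)
        finally show ?thesis .
      qed
      have "- (Q / (2 * R)) * y + B / p = - y * (Q * U - S) / (2 * R * U)"
        using pos unfolding B_def p by (simp add: field_simps power2_eq_square)
      also have "\<dots> = - (V / (2 * U)) * y"
        using pos unfolding QU by (simp add: field_simps)
      finally show ?thesis .
    qed
    have "exp (- (P / (2 * S)) * x) * exp (- (Q / (2 * R)) * y) * exp ((A + B) / p)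
      = exp ((- (P / (2 * S)) * x + A / p) + (- (Q / (2 * R)) * y + B / p))"
      by (simp add: exp_add[symmetric] add_divide_distrib algebra_simps)
    also have "\<dots> = exp (- (1 / 2) * (V / U) * (x + y))"
      unfolding ex ey by (simp add: algebra_simps add_divide_distrib)
    finally have e: "exp (- (P / (2 * S)) * x) * exp (- (Q / (2 * R)) * y) * exp ((A + B) / p)
      = exp (- (1 / 2) * (V / U) * (x + y))" .
    have "?c * (1 / p * exp ((A + B) / p) * bessel_I a (2 * sqrt (A * B / p\<^sup>2)))
      = (1 / (2 * S) * (1 / (2 * R)) * (1 / p))
        * (exp (- (P / (2 * S)) * x) * exp (- (Q / (2 * R)) * y) * exp ((A + B) / p))
        * bessel_I a (2 * sqrt (A * B / p\<^sup>2))"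
      by (simp only: mult_ac)
    also have "\<dots> = laguerre_kernel1 a (s + t) x y"
      unfolding pre e arg laguerre_kernel1_def U_def V_def ..
    finally show ?thesis .
  qed
  finally show ?thesis .
qed

text \<open>The value at x of the semigroup applied to
  \<open>y powr (a / 2) * exp (- l * y)\<close>. For \<open>l = 1 / 2\<close> the base of the power
  is \<open>exp (t / 2)\<close> and the formula becomes
  \<open>exp (- t * (a + 1) / 2) * (x powr (a / 2) * exp (- x / 2))\<close>: the lowest Laguerre
  function is an eigenfunction.\<close>

definition laguerre_moment :: "real \<Rightarrow> real \<Rightarrow> real \<Rightarrow> real \<Rightarrow> real" where
  "laguerre_moment a l x t = x powr (a / 2) / (2 * l * sinh (t / 2) + cosh (t / 2)) powr (a + 1)
     * exp (- (x * (sinh (t / 2) + 2 * l * cosh (t / 2)) / (2 * (2 * l * sinh (t / 2) + cosh (t / 2)))))"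

lemma laguerre_moment_tendsto:
  "(laguerre_moment a l x \<longlongrightarrow> x powr (a / 2) * exp (- l * x)) (at_right 0)"
proof -
  have "continuous (at 0 within {0<..}) (laguerre_moment a l x)"
    unfolding laguerre_moment_def[abs_def]
    by (intro continuous_intros continuous_divide) auto
  then show ?thesis
    by (simp add: continuous_within laguerre_moment_def mult.commute)
qed

lemma nn_integral_laguerre_kernel1_moment:
  assumes a: "0 \<le> a" and t: "0 < t" and x: "0 < x" and l: "0 \<le> l"
  shows "(\<integral>\<^sup>+y\<in>{0<..}. ennreal (laguerre_kernel1 a t x y) * ennreal (y powr (a / 2) * exp (- l * y)) \<partial>lborel)
    = ennreal (laguerre_moment a l x t)"
proof -
  define s c where "s = sinh (t / 2)" and "c = cosh (t / 2)"
  have s: "0 < s" using t by (simp add: s_def)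
  have c: "0 < c" by (simp add: c_def)
  have cs: "c\<^sup>2 = 1 + s\<^sup>2" by (simp add: c_def s_def cosh_square_eq add.commute)
  define q where "q = l + c / (2 * s)"
  define D where "D = 2 * l * s + c"
  have D: "0 < D" using l s c by (simp add: D_def add_nonneg_pos)
  have qD: "q = D / (2 * s)" using s by (simp add: q_def D_def field_simps)
  have q: "0 < q" using D s by (simp add: qD)
  let ?C = "1 / (2 * s) * exp (- (c / (2 * s)) * x)"
  have "(\<integral>\<^sup>+y\<in>{0<..}. ennreal (laguerre_kernel1 a t x y) * ennreal (y powr (a / 2) * exp (- l * y)) \<partial>lborel)
    = (\<integral>\<^sup>+y. ennreal ?C * (ennreal (y powr (a / 2) * exp (- q * y))
        * ennreal (bessel_I a (2 * sqrt (x / (4 * s\<^sup>2) * y))) * indicator {0<..} y) \<partial>lborel)"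
  proof (rule nn_integral_cong)
    fix y :: real
    show "ennreal (laguerre_kernel1 a t x y) * ennreal (y powr (a / 2) * exp (- l * y)) * indicator {0<..} y
      = ennreal ?C * (ennreal (y powr (a / 2) * exp (- q * y))
        * ennreal (bessel_I a (2 * sqrt (x / (4 * s\<^sup>2) * y))) * indicator {0<..} y)"
    proof (cases "0 < y")
      case True
      have rearrange: "u * (v * w) * z = u * (r * w)" if "v * z = r" for u v w z r :: ennreal
        unfolding that[symmetric] by (simp only: mult_ac)
      have "ennreal (exp (- (c / (2 * s)) * y)) * ennreal (y powr (a / 2) * exp (- l * y))
        = ennreal (y powr (a / 2) * exp (- q * y))"
        by (simp add: ennreal_mult[symmetric] q_def distrib_right exp_add exp_diff exp_minus field_simps)
      then have "ennreal (laguerre_kernel1 a t x y) * ennreal (y powr (a / 2) * exp (- l * y))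
        = ennreal ?C * (ennreal (y powr (a / 2) * exp (- q * y))
          * ennreal (bessel_I a (2 * sqrt (x / (4 * s\<^sup>2) * y))))"
        unfolding ennreal_laguerre_kernel1[OF a t x True, folded s_def c_def] by (rule rearrange)
      then show ?thesis
        using True by simp
    qed simp
  qed
  also have "\<dots> = ennreal ?C * (\<integral>\<^sup>+y\<in>{0<..}. ennreal (y powr (a / 2) * exp (- q * y))
        * ennreal (bessel_I a (2 * sqrt (x / (4 * s\<^sup>2) * y))) \<partial>lborel)"
    by (rule nn_integral_cmult) measurable
  also have "\<dots> = ennreal ?C
      * ennreal ((x / (4 * s\<^sup>2)) powr (a / 2) / q powr (a + 1) * exp (x / (4 * s\<^sup>2) / q))"
    using a q s x by (subst nn_integral_powr_half_exp_bessel) auto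
  also have "\<dots> = ennreal (?C * ((x / (4 * s\<^sup>2)) powr (a / 2) / q powr (a + 1) * exp (x / (4 * s\<^sup>2) / q)))"
    using s by (intro ennreal_mult'[symmetric]) simp
  also have "?C * ((x / (4 * s\<^sup>2)) powr (a / 2) / q powr (a + 1) * exp (x / (4 * s\<^sup>2) / q))
      = laguerre_moment a l x t"
  proof -
    have "- (c / (2 * s)) * x + x / (4 * s\<^sup>2) / q = - (x * (s + 2 * l * c) / (2 * D))"
    proof -
      have "- (c / (2 * s)) * x + x / (4 * s\<^sup>2) / q = x * (1 - c * D) / (2 * s * D)"
        using s D by (simp add: qD field_simps power2_eq_square)
      \<comment> \<open>Here \<open>c\<^sup>2 = 1 + s\<^sup>2\<close> removes the constant 1, so a
        factor s splits off and cancels the singular \<open>1 / s\<close>.\<close>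
      also have "1 - c * D = - s * (s + 2 * l * c)"
        using cs by (simp add: D_def algebra_simps power2_eq_square)
      also have "x * (- s * (s + 2 * l * c)) / (2 * s * D) = - (x * (s + 2 * l * c) / (2 * D))"
        using s D by simp
      finally show ?thesis .
    qed
    then have e: "exp (- (c / (2 * s)) * x) * exp (x / (4 * s\<^sup>2) / q) = exp (- (x * (s + 2 * l * c) / (2 * D)))"
      by (simp only: exp_add[symmetric])
    have "(4 * s\<^sup>2) powr (a / 2) = (2 * s) powr a"
    proof -
      have "(4 * s\<^sup>2) powr (a / 2) = ((2 * s) powr 2) powr (a / 2)"
        using s by (simp add: power2_eq_square)
      also have "\<dots> = (2 * s) powr a"
        by (simp only: powr_powr) simp
      finally show ?thesis .
    qed
    then have "(x / (4 * s\<^sup>2)) powr (a / 2) = x powr (a / 2) / (2 * s) powr a"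
      using x s by (simp add: powr_divide)
    moreover have "q powr (a + 1) = D powr (a + 1) / ((2 * s) powr a * (2 * s))"
      using s D by (simp add: qD powr_divide powr_add)
    ultimately have "1 / (2 * s) * ((x / (4 * s\<^sup>2)) powr (a / 2) / q powr (a + 1)) = x powr (a / 2) / D powr (a + 1)"
      using s by simp
    then have *: "1 / (2 * s) * ((x / (4 * s\<^sup>2)) powr (a / 2) / q powr (a + 1))
        * (exp (- (c / (2 * s)) * x) * exp (x / (4 * s\<^sup>2) / q)) = laguerre_moment a l x t"
      unfolding e by (simp only: laguerre_moment_def s_def c_def D_def)
    show ?thesis
      unfolding *[symmetric] by (simp only: mult_ac)
  qed
  finally show ?thesis .
qed

text \<open>A Korovkin argument: the kernel reproduces \<open>y\<^bsup>a/2\<^esup> e\<^bsup>-ly\<^esup>\<close> for \<open>l = 0, 1, 2\<close> in the limit,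
  and \<open>y\<^bsup>a/2\<^esup> (1 - C (e\<^bsup>-y\<^esup> - e\<^bsup>-x\<^esup>)\<^sup>2)\<close> is, for large \<open>C\<close>, dominated by a multiple of the indicator
  function of a small neighbourhood of \<open>x\<close>.\<close>

lemma laguerre_kernel1_concentration:
  assumes a: "0 \<le> a" and x: "0 < x" and d: "0 < d"
  shows "((\<lambda>t. enn2real (\<integral>\<^sup>+y\<in>{0<..} \<inter> ball x d. ennreal (laguerre_kernel1 a t x y) \<partial>lborel)) \<longlongrightarrow> 1) (at_right 0)"
proof (rule order_tendstoI)
  let ?J = "\<lambda>t. \<integral>\<^sup>+y\<in>{0<..} \<inter> ball x d. ennreal (laguerre_kernel1 a t x y) \<partial>lborel"
  have J_le: "?J t \<le> 1" if t: "0 < t" for t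
  proof -
    have "?J t \<le> (\<integral>\<^sup>+y\<in>{0<..}. ennreal (laguerre_kernel1 a t x y) \<partial>lborel)"
      by (intro nn_integral_mono) (auto simp: indicator_def)
    also have "\<dots> \<le> ennreal (1 / cosh (t / 2))"
      by (rule laguerre_kernel1_mass[OF a t x])
    also have "\<dots> \<le> 1"
      using cosh_real_ge_1[of "t / 2"] by simp
    finally show ?thesis .
  qed
  have J_eq: "?J t = ennreal (enn2real (?J t))" "enn2real (?J t) \<le> 1" if t: "0 < t" for t
  proof -
    show "?J t = ennreal (enn2real (?J t))"
      using J_le[OF t] by (metis ennreal_enn2real ennreal_one_less_top le_less_trans)
    show "enn2real (?J t) \<le> 1"
      using J_le[OF t] by (simp add: enn2real_leI)
  qed
  show "\<forall>\<^sub>F t in at_right 0. enn2real (?J t) < b" if "1 < b" for b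
    using eventually_at_right_less[of 0] by eventually_elim (use J_eq(2) that in force)
  show "\<forall>\<^sub>F t in at_right 0. b < enn2real (?J t)" if b: "b < 1" for b
  proof -
    \<comment> \<open>The given b may be negative; raising it to a positive \<open>b'\<close> below
      1 only strengthens the claim and makes the next constant positive.\<close>
    define b' where "b' = max b (1 / 2)"
    have b': "b \<le> b'" "0 < b'" "b' < 1" using b by (auto simp: b'_def)
    define X where "X = x powr (a / 2)"
    have X: "0 < X" using x by (simp add: X_def)
    \<comment> \<open>\<open>N\<close> is \<open>X\<close> divided by the midpoint of
      \<open>b'\<close> and 1: \<open>X < N\<close> leaves room for continuity at x, while
      \<open>b' * N < X\<close> still yields the lower bound \<open>b'\<close>.\<close>
    define N where "N = 2 * X / (1 + b')"
    have N: "X < N" "b' * N < X" "0 < N"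
      using b' X by (auto simp: N_def field_simps)
    have "((\<lambda>y. y powr (a / 2)) \<longlongrightarrow> X) (at x)"
      unfolding X_def using x by (intro tendsto_intros) auto
    then have "\<forall>\<^sub>F y in at x. y powr (a / 2) < N"
      using N by (intro order_tendstoD)
    then obtain r where r: "0 < r" "\<And>y. y \<noteq> x \<Longrightarrow> dist y x < r \<Longrightarrow> y powr (a / 2) < N"
      unfolding eventually_at by auto
    define \<delta> where "\<delta> = min r d"
    have \<delta>: "0 < \<delta>" "\<delta> \<le> r" "\<delta> \<le> d" using r d by (auto simp: \<delta>_def)
    \<comment> \<open>By monotonicity of exp, \<open>m\<close> is the least distance of
      \<open>exp (- y)\<close> from \<open>exp (- x)\<close> when y is at least
      \<open>\<delta>\<close> away from x; \<open>C = 1 / m\<^sup>2\<close> makes the bracket in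
      \<open>key\<close> nonpositive there.\<close>
    define m where "m = min (exp (- x) - exp (- (x + \<delta>))) (exp (- (x - \<delta>)) - exp (- x))"
    have m: "0 < m" using \<delta> by (simp add: m_def)
    define C where "C = 1 / m\<^sup>2"
    have C: "0 < C" using m by (simp add: C_def)
    have key: "y powr (a / 2) * (1 - C * (exp (- y) - exp (- x))\<^sup>2) \<le> N * indicator (ball x d) y" if y: "0 < y" for y
    proof (cases "dist y x < \<delta>")
      case True
      then have "y powr (a / 2) \<le> N"
        using r(2)[of y] \<delta> N by (cases "y = x") (auto simp: X_def)
      moreover have "y powr (a / 2) * (1 - C * (exp (- y) - exp (- x))\<^sup>2) \<le> y powr (a / 2) * 1"
        using C by (intro mult_left_mono) auto
      moreover have "y \<in> ball x d"
        using True \<delta> by (auto simp: dist_commute)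
      ultimately show ?thesis by simp
    next
      case False
      then have "\<bar>y - x\<bar> \<ge> \<delta>" by (simp add: dist_real_def)
      then have "m \<le> \<bar>exp (- y) - exp (- x)\<bar>"
      proof (cases "x \<le> y")
        case True
        then have "exp (- y) \<le> exp (- (x + \<delta>))" using \<open>\<bar>y - x\<bar> \<ge> \<delta>\<close> by simp
        then show ?thesis unfolding m_def by linarith
      next
        case False
        then have "exp (- (x - \<delta>)) \<le> exp (- y)" using \<open>\<bar>y - x\<bar> \<ge> \<delta>\<close> by simp
        then show ?thesis unfolding m_def by linarith
      qed
      then have "m\<^sup>2 \<le> (exp (- y) - exp (- x))\<^sup>2"
        using m by (simp add: abs_le_square_iff[symmetric])
      then have "1 \<le> C * (exp (- y) - exp (- x))\<^sup>2"
        using m by (simp add: C_def field_simps)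
      then have "y powr (a / 2) * (1 - C * (exp (- y) - exp (- x))\<^sup>2) \<le> 0"
        by (intro mult_nonneg_nonpos) auto
      also have "0 \<le> N * indicator (ball x d) y"
        using N by simp
      finally show ?thesis .
    qed
    define L where "L l = laguerre_moment a l x" for l
    have L_nonneg: "0 \<le> L l t" for l t
      by (simp add: L_def laguerre_moment_def)
    \<comment> \<open>This is \<open>key\<close> integrated against the kernel with the square
      expanded; the negative terms are moved across so that both sides are sums in
      \<open>ennreal\<close>.\<close>
    have ineq: "L 0 t + 2 * C * exp (- x) * L 1 t \<le> N * enn2real (?J t) + C * (exp (- x))\<^sup>2 * L 0 t + C * L 2 t"
      if t: "0 < t" for t
    proof -
      have [measurable]: "{0<..} \<inter> ball x d \<in> sets borel"
        by (intro borel_open open_Int) auto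
      let ?k = "\<lambda>y. ennreal (laguerre_kernel1 a t x y)"
      let ?\<phi> = "\<lambda>l y. ennreal (y powr (a / 2) * exp (- l * y))"
      let ?I = "indicator {0<..} :: real \<Rightarrow> ennreal"
      have mom: "(\<integral>\<^sup>+y. ?k y * ?\<phi> l y * ?I y \<partial>lborel) = ennreal (L l t)" if "0 \<le> l" for l
        unfolding L_def by (rule nn_integral_laguerre_kernel1_moment[OF a t x that])
      have "ennreal (L 0 t) + ennreal (2 * C * exp (- x)) * ennreal (L 1 t)
        = (\<integral>\<^sup>+y. ?k y * ?\<phi> 0 y * ?I y + ennreal (2 * C * exp (- x)) * (?k y * ?\<phi> 1 y * ?I y) \<partial>lborel)"
        by (subst nn_integral_add) (auto simp: nn_integral_cmult mom[symmetric])
      also have "\<dots> \<le> (\<integral>\<^sup>+y. ennreal N * (?k y * indicator ({0<..} \<inter> ball x d) y)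
          + (ennreal (C * (exp (- x))\<^sup>2) * (?k y * ?\<phi> 0 y * ?I y) + ennreal C * (?k y * ?\<phi> 2 y * ?I y)) \<partial>lborel)"
      proof (rule nn_integral_mono)
        fix y :: real
        show "?k y * ?\<phi> 0 y * ?I y + ennreal (2 * C * exp (- x)) * (?k y * ?\<phi> 1 y * ?I y)
          \<le> ennreal N * (?k y * indicator ({0<..} \<inter> ball x d) y)
          + (ennreal (C * (exp (- x))\<^sup>2) * (?k y * ?\<phi> 0 y * ?I y) + ennreal C * (?k y * ?\<phi> 2 y * ?I y))"
        proof (cases "0 < y")
          case True
          define w where "w = y powr (a / 2)"
          have w: "0 \<le> w" by (simp add: w_def)
          have "exp (- 2 * y) = (exp (- y))\<^sup>2"
            by (simp add: power2_eq_square exp_add[symmetric])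
          then have "w + 2 * C * exp (- x) * (w * exp (- y))
            \<le> N * indicator (ball x d) y + (C * (exp (- x))\<^sup>2 * w + C * (w * exp (- 2 * y)))"
            using key[OF True] by (simp add: w_def power2_eq_square algebra_simps)
          then have "ennreal (w + 2 * C * exp (- x) * (w * exp (- y)))
            \<le> ennreal (N * indicator (ball x d) y + (C * (exp (- x))\<^sup>2 * w + C * (w * exp (- 2 * y))))"
            by (rule ennreal_leI)
          then have "ennreal w + ennreal (2 * C * exp (- x)) * ennreal (w * exp (- y))
            \<le> ennreal N * indicator (ball x d) y + (ennreal (C * (exp (- x))\<^sup>2) * ennreal w + ennreal C * ennreal (w * exp (- 2 * y)))"
            using C w N by (simp add: ennreal_mult[symmetric] ennreal_indicator[symmetric] ennreal_plus[symmetric] del: ennreal_plus)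
          from mult_left_mono[OF this, of "?k y"] show ?thesis
            using True by (simp add: w_def distrib_left mult_ac indicator_def)
        qed simp
      qed
      also have "\<dots> = ennreal N * ?J t + (ennreal (C * (exp (- x))\<^sup>2) * ennreal (L 0 t) + ennreal C * ennreal (L 2 t))"
        by (simp add: nn_integral_add nn_integral_cmult mom[symmetric])
      also have "\<dots> = ennreal N * ennreal (enn2real (?J t)) + (ennreal (C * (exp (- x))\<^sup>2) * ennreal (L 0 t) + ennreal C * ennreal (L 2 t))"
        using J_eq(1)[OF t] by simp
      finally show ?thesis
        using N C L_nonneg by (simp add: ennreal_mult[symmetric] ennreal_plus[symmetric] add_nonneg_nonneg del: ennreal_plus)
    qed
    have "((\<lambda>t. L 0 t + 2 * C * exp (- x) * L 1 t - C * (exp (- x))\<^sup>2 * L 0 t - C * L 2 t) \<longlongrightarrow>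
        X * exp (- 0 * x) + 2 * C * exp (- x) * (X * exp (- 1 * x)) - C * (exp (- x))\<^sup>2 * (X * exp (- 0 * x)) - C * (X * exp (- 2 * x)))
        (at_right 0)"
      unfolding L_def X_def by (intro tendsto_intros laguerre_moment_tendsto)
    \<comment> \<open>The terms with \<open>C\<close> cancel because the square
      \<open>(exp (- y) - exp (- x))\<^sup>2\<close> vanishes at \<open>y = x\<close>.\<close>
    also have "X * exp (- 0 * x) + 2 * C * exp (- x) * (X * exp (- 1 * x)) - C * (exp (- x))\<^sup>2 * (X * exp (- 0 * x)) - C * (X * exp (- 2 * x)) = X"
    proof -
      have "exp (- 2 * x) = (exp (- x))\<^sup>2"
        by (simp add: power2_eq_square exp_add[symmetric])
      then show ?thesis by (simp add: power2_eq_square)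
    qed
    finally have "\<forall>\<^sub>F t in at_right 0. b' * N < L 0 t + 2 * C * exp (- x) * L 1 t - C * (exp (- x))\<^sup>2 * L 0 t - C * L 2 t"
      using N by (intro order_tendstoD)
    then show ?thesis
      using eventually_at_right_less[of 0]
    proof eventually_elim
      case (elim t)
      have "N * b' < N * enn2real (?J t)"
        using ineq[OF elim(2)] elim(1) by (simp add: mult.commute)
      then show ?case using N b' by simp
    qed
  qed
qed

section \<open>The semigroup of standard Laguerre functions\<close>

lemma nn_integral_lborel_vec_prod:
  fixes f :: "'n::finite \<Rightarrow> real \<Rightarrow> ennreal"
  assumes [measurable]: "\<And>i. f i \<in> borel_measurable borel"
  shows "(\<integral>\<^sup>+x. (\<Prod>i\<in>UNIV. f i (x $ i)) \<partial>(lborel :: (real ^ 'n) measure)) = (\<Prod>i\<in>UNIV. \<integral>\<^sup>+y. f i y \<partial>lborel)"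
proof -
  \<comment> \<open>The product formula is indexed by basis vectors; \<open>axis i 1\<close> is the
    basis vector of coordinate i, and \<open>inv ?b\<close> translates back.\<close>
  let ?b = "\<lambda>i :: 'n. axis i (1 :: real)"
  have inj: "inj ?b" by (auto simp: inj_def axis_eq_axis)
  have B: "(Basis :: (real ^ 'n) set) = range ?b"
    by (auto simp: Basis_vec_def)
  have "(\<integral>\<^sup>+x. (\<Prod>b\<in>Basis. f (inv ?b b) (x \<bullet> b)) \<partial>(lborel :: (real ^ 'n) measure))
      = (\<Prod>b\<in>(Basis :: (real ^ 'n) set). \<integral>\<^sup>+y. f (inv ?b b) y \<partial>lborel)"
    by (rule nn_integral_lborel_prod) auto
  moreover have "inv ?b (?b i) = i" for i
    by (rule inv_f_f[OF inj])
  ultimately show ?thesis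
    unfolding B using inj by (simp add: prod.reindex inner_axis)
qed

lemma open_pos_orthant: "open (pos_orthant :: (real ^ 'n) set)"
proof -
  have "open (\<Inter>i. {x :: real ^ 'n. 0 < x $ i})"
    by (intro open_INT ballI open_Collect_less continuous_intros) auto
  also have "(\<Inter>i. {x :: real ^ 'n. 0 < x $ i}) = pos_orthant"
    by (auto simp: pos_orthant_def)
  finally show ?thesis .
qed

lemma sets_pos_orthant [measurable]: "(pos_orthant :: (real ^ 'n) set) \<in> sets borel"
  by (rule borel_open[OF open_pos_orthant])

lemma space_orthant_measure [simp]: "space (orthant_measure :: (real ^ 'n) measure) = pos_orthant"
  by (simp add: orthant_measure_def space_restrict_space)

lemma sets_orthant_measure_iff:
  "A \<in> sets (orthant_measure :: (real ^ 'n) measure) \<longleftrightarrow> A \<in> sets borel \<and> A \<subseteq> pos_orthant"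
  unfolding orthant_measure_def by (subst sets_restrict_space_iff) auto

lemma emeasure_orthant_measure:
  "A \<subseteq> pos_orthant \<Longrightarrow> emeasure (orthant_measure :: (real ^ 'n) measure) A = emeasure lborel A"
  unfolding orthant_measure_def by (rule emeasure_restrict_space) auto

lemma nn_integral_orthant_measure:
  "(\<integral>\<^sup>+x. f x \<partial>(orthant_measure :: (real ^ 'n) measure)) = (\<integral>\<^sup>+x. f x * indicator pos_orthant x \<partial>lborel)"
  unfolding orthant_measure_def by (rule nn_integral_restrict_space) simp

lemma measurable_orthant_measure_nth [measurable]:
  "(\<lambda>x. x $ i) \<in> borel_measurable (orthant_measure :: (real ^ 'n) measure)"
  unfolding orthant_measure_def by (intro measurable_restrict_space1) simp

lemma nn_integral_orthant_prod:
  fixes f :: "'n::finite \<Rightarrow> real \<Rightarrow> ennreal"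
  assumes [measurable]: "\<And>i. f i \<in> borel_measurable borel"
  shows "(\<integral>\<^sup>+x. (\<Prod>i\<in>UNIV. f i (x $ i)) \<partial>(orthant_measure :: (real ^ 'n) measure))
    = (\<Prod>i\<in>UNIV. \<integral>\<^sup>+y\<in>{0<..}. f i y \<partial>lborel)"
proof -
  have ind: "(\<Prod>i\<in>UNIV. indicator {0<..} (x $ i)) = (indicator pos_orthant x :: ennreal)" for x :: "real ^ 'n"
    by (auto simp: indicator_def pos_orthant_def)
  have "(\<integral>\<^sup>+x. (\<Prod>i\<in>UNIV. f i (x $ i)) \<partial>(orthant_measure :: (real ^ 'n) measure))
      = (\<integral>\<^sup>+x. (\<Prod>i\<in>UNIV. f i (x $ i) * indicator {0<..} (x $ i)) \<partial>(lborel :: (real ^ 'n) measure))"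
    by (simp add: nn_integral_orthant_measure prod.distrib ind)
  also have "\<dots> = (\<Prod>i\<in>UNIV. \<integral>\<^sup>+y\<in>{0<..}. f i y \<partial>lborel)"
    by (rule nn_integral_lborel_vec_prod) measurable
  finally show ?thesis .
qed

interpretation orthant: sigma_finite_measure "orthant_measure :: (real ^ 'n) measure"
  unfolding orthant_measure_def
  by (rule sigma_finite_measure_restrict_space) (auto intro: sigma_finite_lborel)

lemma laguerre_kernel_prod:
  "laguerre_kernel \<alpha> t x y = (\<Prod>i\<in>UNIV. laguerre_kernel1 (\<alpha> $ i) t (x $ i) (y $ i))"
proof -
  have "exp (- (1 / 2) * (cosh (t / 2) / sinh (t / 2)) * (\<Sum>i\<in>UNIV. x $ i + y $ i))
      = (\<Prod>i\<in>UNIV. exp (- (1 / 2) * (cosh (t / 2) / sinh (t / 2)) * (x $ i + y $ i)))"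
    by (simp only: sum_distrib_left exp_sum finite_UNIV finite)
  then show ?thesis
    by (simp add: laguerre_kernel_def laguerre_kernel1_def prod.distrib prod_dividef)
qed

section \<open>The kernel in several dimensions\<close>

context
  fixes \<alpha> :: "real ^ 'n"
  assumes \<alpha>: "\<And>i. 0 \<le> \<alpha> $ i"
begin

lemma ennreal_laguerre_kernel:
  assumes "0 < t" "x \<in> pos_orthant" "y \<in> pos_orthant"
  shows "ennreal (laguerre_kernel \<alpha> t x y) = (\<Prod>i\<in>UNIV. ennreal (laguerre_kernel1 (\<alpha> $ i) t (x $ i) (y $ i)))"
  unfolding laguerre_kernel_prod using assms \<alpha>
  by (intro prod_ennreal[symmetric] laguerre_kernel1_nonneg) (auto simp: pos_orthant_def)

lemma laguerre_kernel_mass: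
  assumes t: "0 < t" and x: "x \<in> pos_orthant"
  shows "(\<integral>\<^sup>+y. ennreal (laguerre_kernel \<alpha> t x y) \<partial>orthant_measure) \<le> ennreal (1 / cosh (t / 2) ^ CARD('n))"
proof -
  have "(\<integral>\<^sup>+y. ennreal (laguerre_kernel \<alpha> t x y) \<partial>orthant_measure)
      = (\<integral>\<^sup>+y. (\<Prod>i\<in>UNIV. ennreal (laguerre_kernel1 (\<alpha> $ i) t (x $ i) (y $ i))) \<partial>orthant_measure)"
    using t x by (intro nn_integral_cong ennreal_laguerre_kernel) auto
  also have "\<dots> = (\<Prod>i\<in>UNIV. \<integral>\<^sup>+y\<in>{0<..}. ennreal (laguerre_kernel1 (\<alpha> $ i) t (x $ i) y) \<partial>lborel)"
    by (rule nn_integral_orthant_prod) measurable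
  also have "\<dots> \<le> (\<Prod>i\<in>(UNIV :: 'n set). ennreal (1 / cosh (t / 2)))"
    using t x \<alpha> by (intro prod_mono_ennreal) (auto simp: pos_orthant_def intro!: laguerre_kernel1_mass)
  also have "\<dots> = ennreal (1 / cosh (t / 2) ^ CARD('n))"
    by (simp add: ennreal_power power_one_over)
  finally show ?thesis .
qed

lemma symmetric_kernel_laguerre:
  assumes t: "0 < t"
  shows "symmetric_kernel orthant_measure (laguerre_kernel \<alpha> t) (1 / cosh (t / 2) ^ CARD('n))"
proof
  show "(\<lambda>z. laguerre_kernel \<alpha> t (fst z) (snd z)) \<in> borel_measurable (orthant_measure \<Otimes>\<^sub>M orthant_measure)"
    unfolding laguerre_kernel_prod by measurable
  show "0 \<le> laguerre_kernel \<alpha> t x y" if "x \<in> space orthant_measure" "y \<in> space orthant_measure" for x y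
    unfolding laguerre_kernel_prod using that t \<alpha>
    by (intro prod_nonneg ballI laguerre_kernel1_nonneg) (auto simp: pos_orthant_def)
  show "laguerre_kernel \<alpha> t x y = laguerre_kernel \<alpha> t y x" for x y
    by (simp add: laguerre_kernel_prod laguerre_kernel1_sym)
  show "(\<integral>\<^sup>+y. ennreal (laguerre_kernel \<alpha> t x y) \<partial>orthant_measure) \<le> ennreal (1 / cosh (t / 2) ^ CARD('n))"
    if "x \<in> space orthant_measure" for x
    using that by (intro laguerre_kernel_mass[OF t]) simp
qed simp

lemma laguerre_kernel_chapman_kolmogorov:
  assumes s: "0 < s" and t: "0 < t" and x: "x \<in> pos_orthant" and y: "y \<in> pos_orthant"
  shows "(\<integral>\<^sup>+z. ennreal (laguerre_kernel \<alpha> s x z) * ennreal (laguerre_kernel \<alpha> t z y) \<partial>orthant_measure)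
    = ennreal (laguerre_kernel \<alpha> (s + t) x y)"
proof -
  have "(\<integral>\<^sup>+z. ennreal (laguerre_kernel \<alpha> s x z) * ennreal (laguerre_kernel \<alpha> t z y) \<partial>orthant_measure)
      = (\<integral>\<^sup>+z. (\<Prod>i\<in>UNIV. ennreal (laguerre_kernel1 (\<alpha> $ i) s (x $ i) (z $ i))
          * ennreal (laguerre_kernel1 (\<alpha> $ i) t (z $ i) (y $ i))) \<partial>orthant_measure)"
    using s t x y by (intro nn_integral_cong) (simp add: ennreal_laguerre_kernel prod.distrib)
  also have "\<dots> = (\<Prod>i\<in>UNIV. \<integral>\<^sup>+z\<in>{0<..}. ennreal (laguerre_kernel1 (\<alpha> $ i) s (x $ i) z)
          * ennreal (laguerre_kernel1 (\<alpha> $ i) t z (y $ i)) \<partial>lborel)"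
    by (rule nn_integral_orthant_prod) measurable
  also have "\<dots> = (\<Prod>i\<in>UNIV. ennreal (laguerre_kernel1 (\<alpha> $ i) (s + t) (x $ i) (y $ i)))"
    using s t x y \<alpha> by (intro prod.cong laguerre_kernel1_chapman_kolmogorov) (auto simp: pos_orthant_def)
  also have "\<dots> = ennreal (laguerre_kernel \<alpha> (s + t) x y)"
    using s t x y by (simp add: ennreal_laguerre_kernel)
  finally show ?thesis .
qed

text \<open>The upper bound is the mass bound. For the lower bound, U contains a cube around x, on
  which the mass is a product of one-dimensional masses that tend to 1.\<close>

lemma laguerre_kernel_concentration:
  assumes U: "open U" "U \<subseteq> pos_orthant" and x: "x \<in> U"
  shows "((\<lambda>t. \<integral>\<^sup>+y. ennreal (laguerre_kernel \<alpha> t x y) * indicator U y \<partial>orthant_measure) \<longlongrightarrow> 1) (at_right 0)"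
proof -
  have xp: "x \<in> pos_orthant" using U x by auto
  obtain r where r: "0 < r" "ball x r \<subseteq> U"
    using U x open_contains_ball by blast
  \<comment> \<open>A cube of half-side \<open>r / CARD('n)\<close> fits into the ball of radius r
    because the Euclidean norm is at most the sum of the absolute values of the coordinates.\<close>
  define d where "d = r / real CARD('n)"
  have d: "0 < d" using r by (simp add: d_def)
  have box: "y \<in> U" if "\<And>i. y $ i \<in> ball (x $ i) d" for y
  proof -
    have "norm (y - x) \<le> (\<Sum>i\<in>UNIV. \<bar>(y - x) $ i\<bar>)"
      by (rule norm_le_l1_cart)
    also have "\<dots> < (\<Sum>i\<in>(UNIV :: 'n set). d)"
      using that by (intro sum_strict_mono) (auto simp: dist_real_def abs_minus_commute)
    also have "\<dots> = r" by (simp add: d_def)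
    finally show ?thesis
      using r by (auto simp: dist_norm norm_minus_commute)
  qed
  define j where "j i t = enn2real (\<integral>\<^sup>+y\<in>{0<..} \<inter> ball (x $ i) d. ennreal (laguerre_kernel1 (\<alpha> $ i) t (x $ i) y) \<partial>lborel)" for i t
  have "((\<lambda>t. \<Prod>i\<in>UNIV. j i t) \<longlongrightarrow> (\<Prod>i\<in>(UNIV :: 'n set). 1)) (at_right 0)"
    unfolding j_def using xp \<alpha> d
    by (intro tendsto_prod laguerre_kernel1_concentration) (auto simp: pos_orthant_def)
  then have "((\<lambda>t. ennreal (\<Prod>i\<in>UNIV. j i t)) \<longlongrightarrow> ennreal 1) (at_right 0)"
    by (intro tendsto_ennrealI) simp
  then have lim: "((\<lambda>t. ennreal (\<Prod>i\<in>UNIV. j i t)) \<longlongrightarrow> 1) (at_right 0)" by simp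
  have lower: "ennreal (\<Prod>i\<in>UNIV. j i t) \<le> (\<integral>\<^sup>+y. ennreal (laguerre_kernel \<alpha> t x y) * indicator U y \<partial>orthant_measure)"
    if t: "0 < t" for t
  proof -
    have [measurable]: "ball (x $ i) d \<in> sets borel" for i by simp
    have "ennreal (\<Prod>i\<in>UNIV. j i t) = (\<Prod>i\<in>UNIV. ennreal (j i t))"
      by (rule prod_ennreal[symmetric]) (simp add: j_def)
    also have "\<dots> \<le> (\<Prod>i\<in>UNIV. \<integral>\<^sup>+y\<in>{0<..}. ennreal (laguerre_kernel1 (\<alpha> $ i) t (x $ i) y) * indicator (ball (x $ i) d) y \<partial>lborel)"
    proof (rule prod_mono_ennreal)
      fix i
      show "ennreal (j i t) \<le> (\<integral>\<^sup>+y\<in>{0<..}. ennreal (laguerre_kernel1 (\<alpha> $ i) t (x $ i) y) * indicator (ball (x $ i) d) y \<partial>lborel)"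
      proof -
        \<comment> \<open>\<open>enn2real\<close> sends \<infinity> to 0, so no finiteness has to be
          checked.\<close>
        have "ennreal (enn2real u) \<le> u" for u by (cases u) auto
        then have "ennreal (j i t) \<le> (\<integral>\<^sup>+y\<in>{0<..} \<inter> ball (x $ i) d. ennreal (laguerre_kernel1 (\<alpha> $ i) t (x $ i) y) \<partial>lborel)"
          unfolding j_def .
        also have "\<dots> = (\<integral>\<^sup>+y\<in>{0<..}. ennreal (laguerre_kernel1 (\<alpha> $ i) t (x $ i) y) * indicator (ball (x $ i) d) y \<partial>lborel)"
          by (intro nn_integral_cong) (auto simp: indicator_def)
        finally show ?thesis .
      qed
    qed
    also have "\<dots> = (\<integral>\<^sup>+y. (\<Prod>i\<in>UNIV. ennreal (laguerre_kernel1 (\<alpha> $ i) t (x $ i) (y $ i)) * indicator (ball (x $ i) d) (y $ i)) \<partial>orthant_measure)"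
      by (rule nn_integral_orthant_prod[symmetric]) measurable
    also have "\<dots> \<le> (\<integral>\<^sup>+y. ennreal (laguerre_kernel \<alpha> t x y) * indicator U y \<partial>orthant_measure)"
    proof (rule nn_integral_mono)
      fix y :: "real ^ 'n" assume y: "y \<in> space orthant_measure"
      have "(\<Prod>i\<in>UNIV. indicator (ball (x $ i) d) (y $ i)) \<le> (indicator U y :: ennreal)"
      proof (cases "y \<in> U")
        case True
        then show ?thesis
          using prod_mono_ennreal[of UNIV "\<lambda>i. indicator (ball (x $ i) d) (y $ i)" "\<lambda>_. 1"]
          by (simp add: indicator_def)
      next
        case False
        then obtain i where "y $ i \<notin> ball (x $ i) d" using box by blast
        then have "(\<Prod>i\<in>UNIV. indicator (ball (x $ i) d) (y $ i)) = (0 :: ennreal)"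
          by (intro prod_zero bexI[of _ i]) (auto simp: indicator_def)
        then show ?thesis by (simp only: zero_le)
      qed
      then show "(\<Prod>i\<in>UNIV. ennreal (laguerre_kernel1 (\<alpha> $ i) t (x $ i) (y $ i)) * indicator (ball (x $ i) d) (y $ i))
          \<le> ennreal (laguerre_kernel \<alpha> t x y) * indicator U y"
        using y xp t by (simp add: ennreal_laguerre_kernel prod.distrib mult_left_mono)
    qed
    finally show ?thesis .
  qed
  have upper: "(\<integral>\<^sup>+y. ennreal (laguerre_kernel \<alpha> t x y) * indicator U y \<partial>orthant_measure) \<le> 1" if t: "0 < t" for t
  proof -
    have "(\<integral>\<^sup>+y. ennreal (laguerre_kernel \<alpha> t x y) * indicator U y \<partial>orthant_measure)
        \<le> (\<integral>\<^sup>+y. ennreal (laguerre_kernel \<alpha> t x y) \<partial>orthant_measure)"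
      by (intro nn_integral_mono) (auto simp: indicator_def)
    also have "\<dots> \<le> ennreal (1 / cosh (t / 2) ^ CARD('n))"
      by (rule laguerre_kernel_mass[OF t xp])
    also have "\<dots> \<le> 1"
      using cosh_real_ge_1[of "t / 2"] by (simp add: one_le_power)
    finally show ?thesis .
  qed
  show ?thesis
    by (rule tendsto_sandwich[OF _ _ lim tendsto_const])
      (use lower upper in \<open>auto intro: eventually_mono[OF eventually_at_right_less]\<close>)
qed

lemma kernel_semigroup_laguerre:
  "kernel_semigroup orthant_measure (laguerre_kernel \<alpha>) (\<lambda>t. 1 / cosh (t / 2) ^ CARD('n))"
proof (intro kernel_semigroup.intro kernel_semigroup_axioms.intro)
  show "sigma_finite_measure (orthant_measure :: (real ^ 'n) measure)"
    by (rule orthant.sigma_finite_measure_axioms)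
  show "symmetric_kernel orthant_measure (laguerre_kernel \<alpha> t) (1 / cosh (t / 2) ^ CARD('n))" if "0 < t" for t
    by (rule symmetric_kernel_laguerre[OF that])
  show "1 / cosh (t / 2) ^ CARD('n) \<le> 1" for t :: real
    using cosh_real_ge_1[of "t / 2"] by (simp add: one_le_power)
  show "(\<integral>\<^sup>+z. ennreal (laguerre_kernel \<alpha> s x z) * ennreal (laguerre_kernel \<alpha> t z y) \<partial>orthant_measure)
      = ennreal (laguerre_kernel \<alpha> (s + t) x y)"
    if "0 < s" "0 < t" "x \<in> space orthant_measure" "y \<in> space orthant_measure" for s t x y
    using that by (intro laguerre_kernel_chapman_kolmogorov) auto
  show "\<exists>U\<in>sets orthant_measure. A \<subseteq> U \<and> emeasure orthant_measure (U - A) < ennreal e \<and>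
      (\<forall>x\<in>U. ((\<lambda>t. \<integral>\<^sup>+y. ennreal (laguerre_kernel \<alpha> t x y) * indicator U y \<partial>orthant_measure) \<longlongrightarrow> 1) (at_right 0))"
    if A: "A \<in> sets orthant_measure" and e: "0 < e" for A :: "(real ^ 'n) set" and e :: real
  proof -
    have A': "A \<in> sets borel" "A \<subseteq> pos_orthant" using A by (auto simp: sets_orthant_measure_iff)
    then have "A \<in> sets lebesgue" by simp
    \<comment> \<open>Outer regularity of Lebesgue measure; intersecting with the open orthant keeps
      the set open and does not increase the excess over A.\<close>
    then obtain S where S: "open S" "A \<subseteq> S" "emeasure lebesgue (S - A) < ennreal e"
      using sets_lebesgue_outer_open[OF _ e] by metis
    define U where "U = S \<inter> pos_orthant"
    have U: "open U" "A \<subseteq> U" "U \<subseteq> pos_orthant"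
      using S A' open_pos_orthant by (auto simp: U_def)
    have "emeasure orthant_measure (U - A) = emeasure lborel (U - A)"
      using U by (intro emeasure_orthant_measure) auto
    also have "\<dots> \<le> emeasure lborel (S - A)"
      using S A' by (intro emeasure_mono) (auto simp: U_def)
    also have "\<dots> = emeasure lebesgue (S - A)"
      using S A' by (simp add: main_part_sets borel_open)
    finally have "emeasure orthant_measure (U - A) < ennreal e"
      using S by simp
    then show ?thesis
      using U laguerre_kernel_concentration[OF U(1,3)]
      by (intro bexI[of _ U]) (auto simp: sets_orthant_measure_iff)
  qed
qed

end

theorem theorem3p1:
  fixes \<alpha> :: "real ^ 'n"
  assumes "\<And>i. 0 \<le> \<alpha> $ i"
  shows "submarkovian_symmetric_diffusion_semigroup
           (orthant_measure :: (real ^ 'n) measure) (L1_plus_Linf orthant_measure)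
           (laguerre_semigroup \<alpha>)
       \<and> \<not> markovian_symmetric_diffusion_semigroup
           (orthant_measure :: (real ^ 'n) measure) (L1_plus_Linf orthant_measure)
           (laguerre_semigroup \<alpha>)
       \<and> (\<forall>p t. 1 \<le> p \<longrightarrow> 0 < t \<longrightarrow>
           Lp_opnorm orthant_measure p (laguerre_semigroup \<alpha> t)
             \<le> ennreal (1 / cosh (t / 2) ^ CARD('n)))"
proof (intro conjI allI impI)
  let ?M = "orthant_measure :: (real ^ 'n) measure"
  interpret kernel_semigroup ?M "laguerre_kernel \<alpha>" "\<lambda>t. 1 / cosh (t / 2) ^ CARD('n)"
    using assms by (rule kernel_semigroup_laguerre)
  have T: "laguerre_semigroup \<alpha> = T"
    by (intro ext) (simp add: laguerre_semigroup_def T_def kernel_op_def)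
  show "submarkovian_symmetric_diffusion_semigroup ?M (L1_plus_Linf ?M) (laguerre_semigroup \<alpha>)"
    unfolding T by (rule submarkovian)
  show "\<not> markovian_symmetric_diffusion_semigroup ?M (L1_plus_Linf ?M) (laguerre_semigroup \<alpha>)"
  proof
    assume "markovian_symmetric_diffusion_semigroup ?M (L1_plus_Linf ?M) (laguerre_semigroup \<alpha>)"
    then have "AE x in ?M. T 1 (\<lambda>_. 1) x = 1"
      unfolding T by (rule markovian_symmetric_diffusion_semigroup.conservative) simp
    \<comment> \<open>At time 1 the image of the constant 1 is at most
      \<open>1 / cosh (1 / 2) ^ CARD('n) < 1\<close> at every point, so conservation would force the
      whole orthant, a nonempty open set, to be null.\<close>
    then have "AE x in ?M. False"
      using AE_space
    proof eventually_elim
      case (elim x)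
      have "kernel_op ?M (laguerre_kernel \<alpha> 1) (\<lambda>_. 1) x \<le> complex_of_real (1 / cosh (1 / 2) ^ CARD('n))"
        using symmetric_kernel.kernel_op_one_le[OF kernel[of 1] elim(2)] by simp
      then have "1 \<le> 1 / cosh (1 / 2 :: real) ^ CARD('n)"
        using elim(1) by (simp add: T_def less_eq_complex_def)
      moreover have "1 < cosh (1 / 2 :: real)"
        using cosh_real_strict_mono[of 0 "1 / 2"] by simp
      then have "1 < cosh (1 / 2 :: real) ^ CARD('n)"
        by (rule one_less_power) simp
      ultimately show False by simp
    qed
    then have "emeasure ?M (space ?M) = 0"
      by (simp add: AE_iff_measurable[OF sets.top] del: space_orthant_measure)
    then have "(pos_orthant :: (real ^ 'n) set) \<in> null_sets lborel"
      by (intro null_setsI) (simp_all add: emeasure_orthant_measure)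
    then have "negligible (pos_orthant :: (real ^ 'n) set)"
      by (simp add: negligible_iff_null_sets null_sets_completionI)
    moreover have "(\<chi> i. 1) \<in> (pos_orthant :: (real ^ 'n) set)"
      by (simp add: pos_orthant_def)
    ultimately show False
      using open_not_negligible[OF open_pos_orthant] by blast
  qed
  fix p :: ennreal and t :: real assume p: "1 \<le> p" and t: "0 < t"
  show "Lp_opnorm ?M p (laguerre_semigroup \<alpha> t) \<le> ennreal (1 / cosh (t / 2) ^ CARD('n))"
    unfolding Lp_opnorm_def
  proof (rule SUP_least)
    fix f assume f: "f \<in> {f \<in> Lp_space ?M p. Lp_norm ?M p f \<le> 1}"
    have "Lp_norm ?M p (laguerre_semigroup \<alpha> t f) \<le> ennreal (1 / cosh (t / 2) ^ CARD('n)) * Lp_norm ?M p f"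
      using symmetric_kernel.Lp_norm_kernel_op_le[OF kernel[OF t] p, of f] t f
      by (simp add: T T_def Lp_space_def)
    also have "\<dots> \<le> ennreal (1 / cosh (t / 2) ^ CARD('n)) * 1"
      using f by (intro mult_left_mono) auto
    finally show "Lp_norm ?M p (laguerre_semigroup \<alpha> t f) \<le> ennreal (1 / cosh (t / 2) ^ CARD('n))"
      by simp
  qed
qed

end
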